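(* Let $F$ be a finite group and $D$ an irreducible representation of $F$. Let $0\le k\le n$ be integers, let $E$ be an irreducible representation of $S_{n-k}$ and $E'$ an irreducible representation of $S_k$. Let $U:=\mathrm{ind}^{S_n}_{S_{n-k}\times S_k} E\boxtimes E'$, and let its decomposition into irreducible $S_n$-representations be $U\cong m_1E_1\oplus\cdots\oplus m_rE_r$. Let $$A:=\mathrm{ind}^{F\wr S_n}_{F\wr S_{n-k}\times F\wr S_k}(D;E)\boxtimes(D;E').$$ Then the decomposition of $A$ into irreducible $F\wr S_n$-representations is $$A\cong\bigoplus_{i=1}^r m_i\,(D;E_i).$$ In particular, if $U$ is a multiplicity-free $S_n$-representation, then $A$ is a multiplicity-free $F\wr S_n$-representation.
   Context: All groups are finite and all representations are finite-dimensional over $\mathbb{C}$. $F\wr S_n=F^n\rtimes S_n$ with product $(f,\sigma)(f',\sigma')=(f\,(\sigma\cdot f'),\sigma\sigma')$, $(\sigma\cdot f')_i=f'_{\sigma^{-1}(i)}$; by convention $F\wr S_0$ is trivial. The subgroup $F\wr S_{n-k}\times F\wr S_k$ of $F\wr S_n$ is $F\wr(S_{n-k}\times S_k)=F^n\rtimes(S_{n-k}\times S_k)$. For an irreducible representation $D$ of $F$ and an irreducible representation $D''$ of $S_m$, $(D;D''):=D^{(m)}\otimes D''$ is the (irreducible) representation of $F\wr S_m$ in which $D^{(m)}$ is the vector space $D^{\otimes m}$ with action $((f_1,\dots,f_m),\pi)\cdot(v_1\otimes\cdots\otimes v_m)=f_1v_{\pi^{-1}(1)}\otimes\cdots\otimes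 f_mv_{\pi^{-1}(m)}$, $D''$ is inflated to $F\wr S_m$ along the projection $F\wr S_m\to S_m$, and $\otimes$ is the inner tensor product. *)

theory Defs
  imports Complex_Main "HOL-Library.Function_Algebras" "HOL-Algebra.Sym_Groups"
begin

section \<open>Complex vector spaces\<close>

text \<open>
  The complex analogue of the class \<^class>\<open>real_vector\<close>. A vector space is a subspace of a
  type of this class; the type is only an ambient space and may be infinite-dimensional.
\<close>

class complex_vector = ab_group_add +
  fixes scaleC :: "complex \<Rightarrow> 'a \<Rightarrow> 'a"  (infixr \<open>*\<^sub>C\<close> 75)
  assumes scaleC_add_right: "a *\<^sub>C (x + y) = a *\<^sub>C x + a *\<^sub>C y"
    and scaleC_add_left: "(a + b) *\<^sub>C x = a *\<^sub>C x + b *\<^sub>C x"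
    and scaleC_scaleC: "a *\<^sub>C b *\<^sub>C x = (a * b) *\<^sub>C x"
    and scaleC_one: "1 *\<^sub>C x = x"

global_interpretation cvec: vector_space "scaleC :: complex \<Rightarrow> 'a \<Rightarrow> 'a::complex_vector"
  by unfold_locales (rule scaleC_add_right scaleC_add_left scaleC_scaleC scaleC_one)+

instantiation complex :: complex_vector
begin

definition scaleC_complex_def [simp]: "scaleC a (x::complex) = a * x"

instance by standard (simp_all add: algebra_simps)

end

instantiation "fun" :: (type, complex_vector) complex_vector
begin

definition scaleC_fun_def: "scaleC a f = (\<lambda>x. a *\<^sub>C f x)"

instance
  by standard
    (simp_all add: scaleC_fun_def fun_eq_iff scaleC_add_right scaleC_add_left scaleC_scaleC scaleC_one)

end

lemma scaleC_fun_apply [simp]: "(a *\<^sub>C f) x = a *\<^sub>C f x"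
  by (simp add: scaleC_fun_def)

definition linear_on :: "'v::complex_vector set \<Rightarrow> ('v \<Rightarrow> 'w::complex_vector) \<Rightarrow> bool" where
  "linear_on V f \<longleftrightarrow>
     (\<forall>x\<in>V. \<forall>y\<in>V. f (x + y) = f x + f y) \<and> (\<forall>c. \<forall>x\<in>V. f (c *\<^sub>C x) = c *\<^sub>C f x)"

section \<open>Representations\<close>

text \<open>Values of the action outside the group or outside the space are irrelevant throughout.\<close>

record ('g, 'v) repn =
  rspace :: "'v set"
  ract :: "'g \<Rightarrow> 'v \<Rightarrow> 'v"

definition is_rep :: "('g, 'x) monoid_scheme \<Rightarrow> ('g, 'v::complex_vector) repn \<Rightarrow> bool" where
  "is_rep G R \<longleftrightarrow>
     (\<exists>B. finite B \<and> rspace R = cvec.span B) \<and>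
     (\<forall>g\<in>carrier G. ract R g ` rspace R \<subseteq> rspace R \<and> linear_on (rspace R) (ract R g)) \<and>
     (\<forall>v\<in>rspace R. ract R \<one>\<^bsub>G\<^esub> v = v) \<and>
     (\<forall>g\<in>carrier G. \<forall>h\<in>carrier G. \<forall>v\<in>rspace R. ract R (g \<otimes>\<^bsub>G\<^esub> h) v = ract R g (ract R h v))"

definition irreducible_rep :: "('g, 'x) monoid_scheme \<Rightarrow> ('g, 'v::complex_vector) repn \<Rightarrow> bool" where
  "irreducible_rep G R \<longleftrightarrow>
     is_rep G R \<and> rspace R \<noteq> {0} \<and>
     (\<forall>W. cvec.subspace W \<and> W \<subseteq> rspace R \<and> (\<forall>g\<in>carrier G. ract R g ` W \<subseteq> W)
        \<longrightarrow> W = {0} \<or> W = rspace R)"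

definition iso_rep :: "('g, 'x) monoid_scheme \<Rightarrow> ('g, 'v::complex_vector) repn \<Rightarrow>
    ('g, 'w::complex_vector) repn \<Rightarrow> bool" where
  "iso_rep G R S \<longleftrightarrow>
     (\<exists>T. linear_on (rspace R) T \<and> bij_betw T (rspace R) (rspace S) \<and>
          (\<forall>g\<in>carrier G. \<forall>v\<in>rspace R. T (ract R g v) = ract S g (T v)))"

definition direct_sum_rep :: "'i set \<Rightarrow> ('i \<Rightarrow> ('g, 'v::complex_vector) repn) \<Rightarrow>
    ('g, 'i \<Rightarrow> 'v) repn" where
  "direct_sum_rep I R =
     \<lparr> rspace = {\<phi>. (\<forall>i\<in>I. \<phi> i \<in> rspace (R i)) \<and> (\<forall>i. i \<notin> I \<longrightarrow> \<phi> i = 0)},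
       ract = (\<lambda>g \<phi> i. if i \<in> I then ract (R i) g (\<phi> i) else 0) \<rparr>"

text \<open>
  \<open>decomposes G R r m E\<close>: the decomposition of \<open>R\<close> into irreducibles is
  \<open>m 1 \<cdot> E 1 \<oplus> \<dots> \<oplus> m r \<cdot> E r\<close>, where the \<open>E i\<close> are pairwise non-isomorphic and \<open>m i\<close> is the
  multiplicity of \<open>E i\<close>.
\<close>

definition decomposes :: "('g, 'x) monoid_scheme \<Rightarrow> ('g, 'v::complex_vector) repn \<Rightarrow> nat \<Rightarrow>
    (nat \<Rightarrow> nat) \<Rightarrow> (nat \<Rightarrow> ('g, 'w::complex_vector) repn) \<Rightarrow> bool" where
  "decomposes G R r m E \<longleftrightarrow>
     (\<forall>i\<in>{1..r}. irreducible_rep G (E i) \<and> 1 \<le> m i) \<and>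
     (\<forall>i\<in>{1..r}. \<forall>j\<in>{1..r}. i \<noteq> j \<longrightarrow> \<not> iso_rep G (E i) (E j)) \<and>
     iso_rep G R (direct_sum_rep (SIGMA i:{1..r}. {1..m i}) (\<lambda>(i, j). E i))"

text \<open>
  Taking the constituents in the ambient type of \<open>R\<close> itself is no
  restriction, since every constituent of \<open>R\<close> is isomorphic to a subrepresentation of \<open>R\<close>.
\<close>

definition multiplicity_free :: "('g, 'x) monoid_scheme \<Rightarrow> ('g, 'v::complex_vector) repn \<Rightarrow> bool" where
  "multiplicity_free G R \<longleftrightarrow>
     (\<exists>r (E :: nat \<Rightarrow> ('g, 'v) repn). decomposes G R r (\<lambda>_. 1) E)"

definition pullback_rep :: "('g \<Rightarrow> 'h) \<Rightarrow> ('h, 'v) repn \<Rightarrow> ('g, 'v) repn" where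
  "pullback_rep \<theta> R = \<lparr> rspace = rspace R, ract = (\<lambda>g. ract R (\<theta> g)) \<rparr>"

text \<open>
  \<open>R\<close> is a representation of the subgroup \<open>H\<close> of the finite group \<open>G\<close>. The induced representation
  is the space of maps \<open>\<phi> : G \<rightarrow> R\<close> with \<open>\<phi> (x h) = h\<inverse> \<cdot> \<phi> x\<close> for \<open>h \<in> H\<close>, with \<open>G\<close> acting by left
  translation; \<open>\<phi>\<close> corresponds to the sum of \<open>x \<otimes> \<phi> x\<close> over representatives \<open>x\<close> of \<open>G / H\<close>.
\<close>

definition induced_rep :: "('g, 'x) monoid_scheme \<Rightarrow> 'g set \<Rightarrow> ('g, 'v::complex_vector) repn \<Rightarrow>
    ('g, 'g \<Rightarrow> 'v) repn" where
  "induced_rep G H R =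
     \<lparr> rspace = {\<phi>. (\<forall>x\<in>carrier G. \<phi> x \<in> rspace R) \<and> (\<forall>x. x \<notin> carrier G \<longrightarrow> \<phi> x = 0) \<and>
                    (\<forall>x\<in>carrier G. \<forall>h\<in>H. \<phi> (x \<otimes>\<^bsub>G\<^esub> h) = ract R (inv\<^bsub>G\<^esub> h) (\<phi> x))},
       ract = (\<lambda>g \<phi> x. if x \<in> carrier G then \<phi> (inv\<^bsub>G\<^esub> g \<otimes>\<^bsub>G\<^esub> x) else 0) \<rparr>"

section \<open>Tensor products\<close>

text \<open>
  The tensor product of \<open>V\<close> and \<open>W\<close> is the span of the pure tensors \<open>x \<otimes> y\<close>, where \<open>x \<otimes> y\<close> is the
  functional \<open>B \<mapsto> B x y\<close> on bilinear forms on \<open>V \<times> W\<close>. The space of bilinear forms separates the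
  elements of the algebraic tensor product, so this is a model of it. An operation on pure tensors
  that comes from linear maps on the factors is extended linearly by precomposing the forms.
\<close>

definition bilinear_forms :: "'v::complex_vector set \<Rightarrow> 'w::complex_vector set \<Rightarrow>
    ('v \<Rightarrow> 'w \<Rightarrow> complex) set" where
  "bilinear_forms V W =
     {B. (\<forall>y\<in>W. linear_on V (\<lambda>x. B x y)) \<and> (\<forall>x\<in>V. linear_on W (\<lambda>y. B x y))}"

definition pure_tensor :: "'v::complex_vector set \<Rightarrow> 'w::complex_vector set \<Rightarrow> 'v \<Rightarrow> 'w \<Rightarrow>
    (('v \<Rightarrow> 'w \<Rightarrow> complex) \<Rightarrow> complex)" where
  "pure_tensor V W x y = (\<lambda>B. if B \<in> bilinear_forms V W then B x y else 0)"

definition outer_tensor :: "('g, 'v::complex_vector) repn \<Rightarrow> ('h, 'w::complex_vector) repn \<Rightarrow>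
    ('g \<times> 'h, ('v \<Rightarrow> 'w \<Rightarrow> complex) \<Rightarrow> complex) repn"  (infixr \<open>\<boxtimes>\<close> 70) where
  "R \<boxtimes> S =
     \<lparr> rspace = cvec.span {pure_tensor (rspace R) (rspace S) x y | x y. x \<in> rspace R \<and> y \<in> rspace S},
       ract = (\<lambda>(g, h) T B. if B \<in> bilinear_forms (rspace R) (rspace S)
                             then T (\<lambda>x y. B (ract R g x) (ract S h y)) else 0) \<rparr>"

definition inner_tensor :: "('g, 'v::complex_vector) repn \<Rightarrow> ('g, 'w::complex_vector) repn \<Rightarrow>
    ('g, ('v \<Rightarrow> 'w \<Rightarrow> complex) \<Rightarrow> complex) repn" where
  "inner_tensor R S = pullback_rep (\<lambda>g. (g, g)) (R \<boxtimes> S)"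

definition multilinear_forms :: "nat \<Rightarrow> 'v::complex_vector set \<Rightarrow> ((nat \<Rightarrow> 'v) \<Rightarrow> complex) set" where
  "multilinear_forms m V =
     {B. \<forall>v \<in> {1..m} \<rightarrow>\<^sub>E V. \<forall>i\<in>{1..m}. linear_on V (\<lambda>x. B (v(i := x)))}"

definition pure_power :: "nat \<Rightarrow> 'v::complex_vector set \<Rightarrow> (nat \<Rightarrow> 'v) \<Rightarrow>
    (((nat \<Rightarrow> 'v) \<Rightarrow> complex) \<Rightarrow> complex)" where
  "pure_power m V v = (\<lambda>B. if B \<in> multilinear_forms m V then B v else 0)"

section \<open>Wreath products\<close>

definition wreath :: "('f, 'x) monoid_scheme \<Rightarrow> nat \<Rightarrow> ((nat \<Rightarrow> 'f) \<times> (nat \<Rightarrow> nat)) monoid" where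
  "wreath F n =
     \<lparr> carrier = ({1..n} \<rightarrow>\<^sub>E carrier F) \<times> carrier (sym_group n),
       mult = (\<lambda>(f, \<sigma>) (f', \<sigma>'). (\<lambda>i\<in>{1..n}. f i \<otimes>\<^bsub>F\<^esub> f' (inv' \<sigma> i), \<sigma> \<circ> \<sigma>')),
       one = (\<lambda>i\<in>{1..n}. \<one>\<^bsub>F\<^esub>, id) \<rparr>"

definition tensor_power :: "nat \<Rightarrow> ('f, 'v::complex_vector) repn \<Rightarrow>
    ((nat \<Rightarrow> 'f) \<times> (nat \<Rightarrow> nat), ((nat \<Rightarrow> 'v) \<Rightarrow> complex) \<Rightarrow> complex) repn" where
  "tensor_power m D =
     \<lparr> rspace = cvec.span (pure_power m (rspace D) ` ({1..m} \<rightarrow>\<^sub>E rspace D)),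
       ract = (\<lambda>(f, \<pi>) T B. if B \<in> multilinear_forms m (rspace D)
                             then T (\<lambda>v. B (\<lambda>i\<in>{1..m}. ract D (f i) (v (inv' \<pi> i)))) else 0) \<rparr>"

text \<open>The representation \<open>(D; D'')\<close> of \<open>F \<wr> S\<^sub>m\<close>.\<close>

definition wreath_rep :: "nat \<Rightarrow> ('f, 'v::complex_vector) repn \<Rightarrow> (nat \<Rightarrow> nat, 'w::complex_vector) repn \<Rightarrow>
    ((nat \<Rightarrow> 'f) \<times> (nat \<Rightarrow> nat), (((((nat \<Rightarrow> 'v) \<Rightarrow> complex) \<Rightarrow> complex) \<Rightarrow> 'w \<Rightarrow> complex) \<Rightarrow> complex)) repn"
  where "wreath_rep m D D'' = inner_tensor (tensor_power m D) (pullback_rep snd D'')"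

text \<open>
  \<open>S\<^bsub>n-k\<^esub> \<times> S\<^sub>k\<close> as the subgroup of \<open>S\<^sub>n\<close> preserving the blocks \<open>{1..n-k}\<close> and \<open>{n-k+1..n}\<close>. Representations
  of the direct product are transported to the subgroup along \<open>young_split\<close>, which
  renumbers the second block as \<open>{1..k}\<close>. Similarly for the wreath products.
\<close>

definition young_subgroup :: "nat \<Rightarrow> nat \<Rightarrow> (nat \<Rightarrow> nat) set" where
  "young_subgroup n k = {\<sigma> \<in> carrier (sym_group n). \<sigma> ` {1..n - k} = {1..n - k}}"

definition young_split :: "nat \<Rightarrow> nat \<Rightarrow> (nat \<Rightarrow> nat) \<Rightarrow> (nat \<Rightarrow> nat) \<times> (nat \<Rightarrow> nat)" where
  "young_split n k \<sigma> =
     (\<lambda>i. if i \<in> {1..n - k} then \<sigma> i else i,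
      \<lambda>i. if i \<in> {1..k} then \<sigma> (n - k + i) - (n - k) else i)"

definition wreath_young_subgroup :: "('f, 'x) monoid_scheme \<Rightarrow> nat \<Rightarrow> nat \<Rightarrow>
    ((nat \<Rightarrow> 'f) \<times> (nat \<Rightarrow> nat)) set" where
  "wreath_young_subgroup F n k = ({1..n} \<rightarrow>\<^sub>E carrier F) \<times> young_subgroup n k"

definition wreath_young_split :: "nat \<Rightarrow> nat \<Rightarrow> (nat \<Rightarrow> 'f) \<times> (nat \<Rightarrow> nat) \<Rightarrow>
    ((nat \<Rightarrow> 'f) \<times> (nat \<Rightarrow> nat)) \<times> ((nat \<Rightarrow> 'f) \<times> (nat \<Rightarrow> nat))" where
  "wreath_young_split n k = (\<lambda>(f, \<sigma>).
     ((\<lambda>i\<in>{1..n - k}. f i, fst (young_split n k \<sigma>)),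
      (\<lambda>i\<in>{1..k}. f (n - k + i), snd (young_split n k \<sigma>))))"

section \<open>The actions on pure tensors\<close>

lemma linear_on_compose:
  "linear_on V f \<Longrightarrow> f ` V \<subseteq> W \<Longrightarrow> linear_on W h \<Longrightarrow> linear_on V (\<lambda>x. h (f x))"
  unfolding linear_on_def by (simp add: image_subset_iff)

lemma outer_tensor_pure:
  assumes "is_rep G R" "is_rep H S" "g \<in> carrier G" "h \<in> carrier H"
  shows "ract (R \<boxtimes> S) (g, h) (pure_tensor (rspace R) (rspace S) x y) =
         pure_tensor (rspace R) (rspace S) (ract R g x) (ract S h y)"
proof
  fix B
  have R: "linear_on (rspace R) (ract R g)" "ract R g ` rspace R \<subseteq> rspace R"
    and S: "linear_on (rspace S) (ract S h)" "ract S h ` rspace S \<subseteq> rspace S"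
    using assms by (simp_all add: is_rep_def)
  have "(\<lambda>x y. B (ract R g x) (ract S h y)) \<in> bilinear_forms (rspace R) (rspace S)"
    if "B \<in> bilinear_forms (rspace R) (rspace S)"
    using that R(2) S(2) linear_on_compose[OF R, of "\<lambda>x. B x (ract S h y)" for y]
      linear_on_compose[OF S, of "B (ract R g x)" for x]
    by (simp add: bilinear_forms_def image_subset_iff)
  then show "ract (R \<boxtimes> S) (g, h) (pure_tensor (rspace R) (rspace S) x y) B =
      pure_tensor (rspace R) (rspace S) (ract R g x) (ract S h y) B"
    by (simp only: outer_tensor_def pure_tensor_def repn.simps case_prod_conv if_True split: if_split) iprover
qed

lemma tensor_power_pure:
  assumes D: "is_rep F D" and f: "f \<in> {1..m} \<rightarrow>\<^sub>E carrier F" and p: "\<pi> permutes {1..m}"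
  shows "ract (tensor_power m D) (f, \<pi>) (pure_power m (rspace D) v) =
         pure_power m (rspace D) (\<lambda>i\<in>{1..m}. ract D (f i) (v (inv' \<pi> i)))"
proof -
  have "(\<lambda>v. B (\<lambda>i\<in>{1..m}. ract D (f i) (v (inv' \<pi> i)))) \<in> multilinear_forms m (rspace D)"
    if B: "B \<in> multilinear_forms m (rspace D)" for B
    unfolding multilinear_forms_def mem_Collect_eq
  proof (intro ballI)
    fix v i assume v: "v \<in> {1..m} \<rightarrow>\<^sub>E rspace D" and i: "i \<in> {1..m}"
    let ?w = "\<lambda>i\<in>{1..m}. ract D (f i) (v (inv' \<pi> i))"
    have pi: "\<pi> i \<in> {1..m}" using i p by (simp only: permutes_in_image)
    have w: "?w \<in> {1..m} \<rightarrow>\<^sub>E rspace D"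
    proof (rule restrict_PiE_iff[THEN iffD2], intro ballI)
      fix j assume j: "j \<in> {1..m}"
      have "inv' \<pi> j \<in> {1..m}" using permutes_in_image[OF permutes_inv[OF p]] j by blast
      then have "v (inv' \<pi> j) \<in> rspace D" using v by (rule PiE_mem[rotated])
      moreover have "f j \<in> carrier F" using f j by (rule PiE_mem)
      ultimately show "ract D (f j) (v (inv' \<pi> j)) \<in> rspace D"
        using D unfolding is_rep_def by blast
    qed
    have eq: "(\<lambda>j\<in>{1..m}. ract D (f j) ((v(i := x)) (inv' \<pi> j))) = ?w(\<pi> i := ract D (f (\<pi> i)) x)" for x
    proof
      fix j
      have "inv' \<pi> j = i \<longleftrightarrow> j = \<pi> i" using permutes_inverses[OF p] by metis
      then show "(\<lambda>j\<in>{1..m}. ract D (f j) ((v(i := x)) (inv' \<pi> j))) j =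
            (?w(\<pi> i := ract D (f (\<pi> i)) x)) j"
        using pi by (cases "j \<in> {1..m}") (auto simp: restrict_def simp del: One_nat_def atLeastAtMost_iff)
    qed
    have fpi: "f (\<pi> i) \<in> carrier F" using f pi by (rule PiE_mem)
    have "linear_on (rspace D) (\<lambda>x. B (?w(\<pi> i := ract D (f (\<pi> i)) x)))"
    proof (rule linear_on_compose[where f = "ract D (f (\<pi> i))"])
      show "linear_on (rspace D) (ract D (f (\<pi> i)))" "ract D (f (\<pi> i)) ` rspace D \<subseteq> rspace D"
        using D fpi unfolding is_rep_def by blast+
      show "linear_on (rspace D) (\<lambda>y. B (?w(\<pi> i := y)))"
        using B w pi unfolding multilinear_forms_def by blast
    qed
    then show "linear_on (rspace D) (\<lambda>x. B (\<lambda>j\<in>{1..m}. ract D (f j) ((v(i := x)) (inv' \<pi> j))))"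
      by (simp only: eq)
  qed
  note closed = this
  show ?thesis
  proof
    fix B
    show "ract (tensor_power m D) (f, \<pi>) (pure_power m (rspace D) v) B =
        pure_power m (rspace D) (\<lambda>i\<in>{1..m}. ract D (f i) (v (inv' \<pi> i))) B"
    proof (cases "B \<in> multilinear_forms m (rspace D)")
      case True
      then show ?thesis
        using closed[OF True] by (simp only: tensor_power_def pure_power_def repn.simps case_prod_conv if_True)
    next
      case False
      then show ?thesis
        by (simp only: tensor_power_def pure_power_def repn.simps case_prod_conv if_False)
    qed
  qed
qed

end

theory Submission
  imports Defs "HOL-Computational_Algebra.Fundamental_Theorem_Algebra"
begin

text \<open>
  Call a representation \<open>X\<close> of \<open>F \<wr> S\<^sub>n\<close> of type \<open>D\<^sup>\<otimes>\<^sup>n \<otimes> E\<close>, where \<open>E\<close> is a representation of \<open>S\<^sub>n\<close>, if it is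
  spanned by values of an equivariant map \<open>\<mu> : D\<^sup>n \<times> E \<rightarrow> X\<close> that is linear in every argument and satisfies
  \<open>\<mu> v e \<noteq> 0\<close> whenever \<open>e\<close> and all entries of \<open>v\<close> are non-zero. By Schur's lemma, every rank-one
  operator on \<open>D\<close> is a combination of elements of \<open>F\<close>, so the group algebra of \<open>F\<^sup>n\<close> contains operators that
  act on every such \<open>X\<close> by \<open>\<mu> v e \<mapsto> (\<Prod>i. \<xi> i (v i)) \<mu> x e\<close>. They show that \<open>X\<close> and \<open>E\<close> determine each
  other up to isomorphism and that \<open>X\<close> is irreducible if \<open>E\<close> is. Both \<open>A\<close> and \<open>\<Oplus>i. m i (D; E i)\<close> are of
  type \<open>D\<^sup>\<otimes>\<^sup>n \<otimes> U\<close>, hence isomorphic.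
\<close>

section \<open>Linear maps on subspaces\<close>

text \<open>The fact behind the last sentence is the projection formula: for the n-th tensor power M
  of D, inducing the tensor product of N with the restriction of M gives M tensored with the
  representation induced from N. Tensor products are modelled by functionals on forms, so the two
  sides live in different nested function types. An explicit isomorphism would be a composite of
  associativity, distributivity and projection isomorphisms, each with its own proof of
  well-definedness. A map \<mu> with spanning values and a non-degeneracy condition can instead be
  written down for each side separately. The two sides become comparable because the contracting
  operators come from fixed elements of the group algebra of F^n: the same operator exists on both
  spaces. Contractions reduce a vector of X to vectors of \<open>E\<close>, and a non-zero vector
  survives some contraction, so the linear relations among the \<open>\<mu> v e\<close> are dictated
  by D and \<open>E\<close>. Working over the complex numbers matters for the eigenvalue in Schur's
  lemma; it is what makes every endomorphism of D a combination of elements of F.\<close>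

lemma linear_onI:
  assumes "\<And>x y. x \<in> V \<Longrightarrow> y \<in> V \<Longrightarrow> f (x + y) = f x + f y"
    and "\<And>c x. x \<in> V \<Longrightarrow> f (c *\<^sub>C x) = c *\<^sub>C f x"
  shows "linear_on V f"
  using assms by (simp add: linear_on_def)

lemma linear_on_add: "linear_on V f \<Longrightarrow> x \<in> V \<Longrightarrow> y \<in> V \<Longrightarrow> f (x + y) = f x + f y"
  by (simp add: linear_on_def)

lemma linear_on_scale: "linear_on V f \<Longrightarrow> x \<in> V \<Longrightarrow> f (c *\<^sub>C x) = c *\<^sub>C f x"
  by (simp add: linear_on_def)

lemma linear_on_subset: "linear_on V f \<Longrightarrow> W \<subseteq> V \<Longrightarrow> linear_on W f"
  unfolding linear_on_def by (meson subsetD)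

lemma linear_on_0: "linear_on V f \<Longrightarrow> cvec.subspace V \<Longrightarrow> f 0 = 0"
  using linear_on_scale[of V f 0 0] by (simp add: cvec.subspace_0)

lemma linear_on_minus:
  assumes "linear_on V f" "cvec.subspace V" "x \<in> V" "y \<in> V"
  shows "f (x - y) = f x - f y"
proof -
  have "f (x + (-1) *\<^sub>C y) = f x + f ((-1) *\<^sub>C y)"
    using assms by (intro linear_on_add[OF assms(1)] cvec.subspace_scale)
  also have "f ((-1) *\<^sub>C y) = (-1) *\<^sub>C f y"
    using assms by (intro linear_on_scale[OF assms(1)])
  finally show ?thesis by simp
qed

lemma linear_on_sum:
  assumes "linear_on V f" "cvec.subspace V" "\<And>i. i \<in> I \<Longrightarrow> g i \<in> V"
  shows "f (\<Sum>i\<in>I. g i) = (\<Sum>i\<in>I. f (g i))"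
proof (cases "finite I")
  case True
  then show ?thesis using assms(3)
  proof (induction I)
    case (insert i I)
    then show ?case
      using assms(1,2) linear_on_add[OF assms(1), of "g i" "sum g I"] cvec.subspace_sum[of V I g]
      by simp
  qed (use assms linear_on_0 in auto)
qed (use assms linear_on_0 in auto)

lemma linear_on_eq_span:
  assumes "linear_on (cvec.span S) f" "linear_on (cvec.span S) h" "\<And>s. s \<in> S \<Longrightarrow> f s = h s"
    and "x \<in> cvec.span S"
  shows "f x = h x"
proof -
  have "x \<in> cvec.span S \<and> f x = h x"
    using assms(4)
  proof (induction rule: cvec.span_induct_alt)
    case base
    then show ?case using assms(1,2) by (simp add: linear_on_0 cvec.span_zero)
  next
    case (step c x y)
    then show ?case
      using assms(1-3)
      by (simp add: linear_on_add linear_on_scale cvec.span_add cvec.span_scale cvec.span_base)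
  qed
  then show ?thesis by simp
qed

lemma linear_on_subspace_vimage:
  assumes "linear_on V f" "cvec.subspace V" "cvec.subspace W"
  shows "cvec.subspace {x \<in> V. f x \<in> W}"
  using assms unfolding cvec.subspace_def
  by (auto simp: linear_on_add linear_on_scale linear_on_0[OF assms(1,2)])

lemma linear_on_span_image:
  assumes "linear_on (cvec.span S) f" "\<And>s. s \<in> S \<Longrightarrow> f s \<in> W" "cvec.subspace W"
  shows "f ` cvec.span S \<subseteq> W"
proof -
  have "cvec.span S \<subseteq> {x \<in> cvec.span S. f x \<in> W}"
    using assms by (intro cvec.span_minimal linear_on_subspace_vimage) (auto intro: cvec.span_base)
  then show ?thesis by blast
qed

lemma linear_on_subspace_image:
  assumes "linear_on V f" "cvec.subspace V"
  shows "cvec.subspace (f ` V)"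
  unfolding cvec.subspace_def
proof (intro conjI ballI allI)
  fix x y assume "x \<in> f ` V" "y \<in> f ` V"
  then obtain u v where "u \<in> V" "v \<in> V" "x = f u" "y = f v" by blast
  then show "x + y \<in> f ` V"
    using linear_on_add[OF assms(1)] cvec.subspace_add[OF assms(2)] by (intro image_eqI[of _ _ "u + v"]) auto
next
  fix c x assume "x \<in> f ` V"
  then obtain u where "u \<in> V" "x = f u" by blast
  then show "c *\<^sub>C x \<in> f ` V"
    using linear_on_scale[OF assms(1)] cvec.subspace_scale[OF assms(2)] by (intro image_eqI[of _ _ "c *\<^sub>C u"]) auto
qed (use assms in \<open>metis image_eqI linear_on_0 cvec.subspace_0\<close>)

lemma linear_on_span_image_eq:
  assumes "linear_on (cvec.span S) f"
  shows "f ` cvec.span S = cvec.span (f ` S)"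
proof
  show "f ` cvec.span S \<subseteq> cvec.span (f ` S)"
    using assms by (intro linear_on_span_image) (auto intro: cvec.span_base)
  show "cvec.span (f ` S) \<subseteq> f ` cvec.span S"
    using assms by (intro cvec.span_minimal linear_on_subspace_image) (auto intro: cvec.span_base)
qed

lemma linear_on_inj_on:
  assumes "linear_on V f" "cvec.subspace V" "\<And>x. x \<in> V \<Longrightarrow> f x = 0 \<Longrightarrow> x = 0"
  shows "inj_on f V"
proof (rule inj_onI)
  fix x y assume "x \<in> V" "y \<in> V" "f x = f y"
  then have "f (x - y) = 0" "x - y \<in> V"
    using assms by (simp_all add: linear_on_minus cvec.subspace_diff)
  then show "x = y" using assms(3) by fastforce
qed

lemma linear_on_the_inv_into:
  assumes "linear_on V f" "cvec.subspace V" "bij_betw f V W"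
  shows "linear_on W (the_inv_into V f)"
proof -
  have inj: "inj_on f V" and im: "f ` V = W" using assms(3) by (auto simp: bij_betw_def)
  show ?thesis
  proof (rule linear_onI)
    fix x y assume "x \<in> W" "y \<in> W"
    then obtain u v where uv: "u \<in> V" "v \<in> V" "x = f u" "y = f v" using im by blast
    have "the_inv_into V f (f (u + v)) = the_inv_into V f (f u) + the_inv_into V f (f v)"
      using uv inj assms(2) by (simp only: the_inv_into_f_f cvec.subspace_add)
    then show "the_inv_into V f (x + y) = the_inv_into V f x + the_inv_into V f y"
      using uv linear_on_add[OF assms(1)] by simp
  next
    fix c x assume "x \<in> W"
    then obtain u where u: "u \<in> V" "x = f u" using im by blast
    have "the_inv_into V f (f (c *\<^sub>C u)) = c *\<^sub>C the_inv_into V f (f u)"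
      using u inj assms(2) by (simp only: the_inv_into_f_f cvec.subspace_scale)
    then show "the_inv_into V f (c *\<^sub>C x) = c *\<^sub>C the_inv_into V f x"
      using u linear_on_scale[OF assms(1)] by simp
  qed
qed

text \<open>Two values related to the same x differ by one related to 0, so \<open>zero\<close>
  makes \<open>R\<close> single-valued. This yields a linear map from a description of its graph,
  where a definition on spanning vectors would have to respect all their linear relations.\<close>

lemma linear_relation_graph:
  fixes V :: "'v::complex_vector set" and R :: "'v \<Rightarrow> 'w::complex_vector \<Rightarrow> bool"
  assumes V: "cvec.subspace V"
    and add: "\<And>x x' y y'. R x y \<Longrightarrow> R x' y' \<Longrightarrow> R (x + x') (y + y')"
    and scale: "\<And>c x y. R x y \<Longrightarrow> R (c *\<^sub>C x) (c *\<^sub>C y)"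
    and total: "\<And>x. x \<in> V \<Longrightarrow> \<exists>y. R x y"
    and zero: "\<And>y. R 0 y \<Longrightarrow> y = 0"
  shows "\<exists>T. linear_on V T \<and> (\<forall>x\<in>V. \<forall>y. R x y \<longleftrightarrow> y = T x)"
proof -
  have uniq: "y = y'" if "R x y" "R x y'" for x y y'
    using zero[of "y - y'"] add[OF that(1) scale[OF that(2), of "-1"]] by simp
  define T where "T x = (SOME y. R x y)" for x
  have T: "R x (T x)" if "x \<in> V" for x
    unfolding T_def using total[OF that] by (rule someI_ex)
  have "linear_on V T"
    by (intro linear_onI uniq[OF T])
      (auto intro: T add scale cvec.subspace_add[OF V] cvec.subspace_scale[OF V])
  then show ?thesis using T uniq by blast
qed

text \<open>Extract a basis from \<open>B0\<close> and take its coordinate functionals. The last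
  clause writes the identity of V as a sum of rank-one maps, the form in which
  \<open>slot_op_sum\<close> uses it.\<close>

lemma coordinates:
  assumes "finite B0" and V: "V = cvec.span B0"
  obtains B and co :: "'v::complex_vector \<Rightarrow> 'v \<Rightarrow> complex" where
    "finite B" "B \<subseteq> V" "V = cvec.span B" "\<And>b. linear_on V (co b)"
    "\<And>v. v \<in> V \<Longrightarrow> (\<Sum>b\<in>B. co b v *\<^sub>C b) = v"
proof -
  obtain B where B: "B \<subseteq> B0" "cvec.independent B" "B0 \<subseteq> cvec.span B"
    using cvec.maximal_independent_subset[of B0] by blast
  have fin: "finite B" using B(1) assms(1) finite_subset by blast
  have span: "V = cvec.span B"
    using B V by (metis cvec.span_eq cvec.span_superset order_trans cvec.span_mono)
  show thesis
  proof (rule that[OF fin _ span])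
    show "B \<subseteq> V" using span cvec.span_superset by blast
    show "linear_on V (\<lambda>v. cvec.representation B v b)" for b
      using B(2) by (intro linear_onI) (simp_all add: span cvec.representation_add cvec.representation_scale)
    show "(\<Sum>b\<in>B. cvec.representation B v b *\<^sub>C b) = v" if "v \<in> V" for v
      using that B(2) fin by (intro cvec.sum_representation_eq) (auto simp: span)
  qed
qed

lemma functional_nonzero:
  fixes d :: "'v::complex_vector"
  assumes "finite B0" "V = cvec.span B0" "d \<in> V" "d \<noteq> 0"
  obtains \<xi> :: "'v \<Rightarrow> complex" where "linear_on V \<xi>" "\<xi> d = 1"
proof -
  obtain B and co :: "'v \<Rightarrow> 'v \<Rightarrow> complex" where co: "finite B" "B \<subseteq> V" "V = cvec.span B"
    "\<And>b. linear_on V (co b)" "\<And>v. v \<in> V \<Longrightarrow> (\<Sum>b\<in>B. co b v *\<^sub>C b) = v"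
    using coordinates[OF assms(1,2)] by metis
  have "\<exists>b\<in>B. co b d \<noteq> 0"
  proof (rule ccontr)
    assume "\<not> ?thesis"
    then have "(\<Sum>b\<in>B. co b d *\<^sub>C b) = 0" by simp
    then show False using co(5) assms(3,4) by simp
  qed
  then obtain b where "co b d \<noteq> 0" by blast
  then show thesis
    using that[of "\<lambda>v. co b v / co b d"] co(4)[of b]
    by (simp add: linear_on_def add_divide_distrib)
qed

text \<open>Each \<open>\<xi> i\<close> is chosen for its own vector only: the \<open>v i\<close>
  will sit in different tensor slots, so no condition links different indices.\<close>

lemma dual_functionals:
  fixes v :: "'i \<Rightarrow> 'v::complex_vector"
  assumes "finite B0" "V = cvec.span B0" "\<And>i. i \<in> I \<Longrightarrow> v i \<in> V" "\<And>i. i \<in> I \<Longrightarrow> v i \<noteq> 0"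
  obtains \<xi> :: "'i \<Rightarrow> 'v \<Rightarrow> complex" where "\<And>i. i \<in> I \<Longrightarrow> linear_on V (\<xi> i)" "\<And>i. i \<in> I \<Longrightarrow> \<xi> i (v i) = 1"
proof -
  have "\<exists>\<xi>::'v \<Rightarrow> complex. linear_on V \<xi> \<and> \<xi> (v i) = 1" if i: "i \<in> I" for i
    by (rule functional_nonzero[OF assms(1,2) assms(3)[OF i] assms(4)[OF i]]) blast
  then have "\<forall>i\<in>I. \<exists>\<xi>::'v \<Rightarrow> complex. linear_on V \<xi> \<and> \<xi> (v i) = 1" by blast
  then obtain \<xi> where "\<forall>i\<in>I. linear_on V (\<xi> i) \<and> \<xi> i (v i) = (1::complex)"
    unfolding bchoice_iff by blast
  then show thesis using that by blast
qed

section \<open>Schur's lemma and matrix coefficients\<close>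

text \<open>The minimal polynomial of a single vector: with p(T) v abbreviated to
  \<open>pe p\<close>, take p of least degree annihilating v, split off a root z, and the cofactor q
  gives the eigenvector \<open>pe q\<close>.\<close>

lemma eigenvector_exists:
  fixes V :: "'v::complex_vector set"
  assumes B: "finite B" "V = cvec.span B" and T: "linear_on V T" "T ` V \<subseteq> V"
    and v: "v \<in> V" "v \<noteq> 0"
  obtains w z where "w \<in> V" "w \<noteq> 0" "T w = z *\<^sub>C w"
proof -
  have V: "cvec.subspace V" by (simp add: B)
  have Tv: "(T ^^ i) v \<in> V" for i by (induction i) (use T v in auto)
  define pe where "pe p = (\<Sum>i\<le>degree p. coeff p i *\<^sub>C (T ^^ i) v)" for p
  have pe_eq: "pe p = (\<Sum>i\<le>N. coeff p i *\<^sub>C (T ^^ i) v)" if "degree p \<le> N" for p N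
    unfolding pe_def using that by (intro sum.mono_neutral_left) (auto simp: coeff_eq_0)
  have peV: "pe p \<in> V" for p
    unfolding pe_def by (intro cvec.subspace_sum cvec.subspace_scale V Tv)
  have "\<exists>p. p \<noteq> 0 \<and> pe p = 0"
  \<comment> \<open>Linear dependence concerns sets, so the iterates must be distinct to give
    \<open>card B + 1\<close> vectors. If two iterates agree, a difference of two monomials
    annihilates v.\<close>
  proof (cases "inj_on (\<lambda>i. (T ^^ i) v) {..card B}")
    case True
    let ?S = "(\<lambda>i. (T ^^ i) v) ` {..card B}"
    have "card ?S = Suc (card B)" using True by (simp add: card_image)
    then have "cvec.dependent ?S"
      using cvec.independent_span_bound[OF B(1), of ?S] Tv B(2) by fastforce
    then obtain u where u: "\<exists>x\<in>?S. u x \<noteq> 0" "(\<Sum>x\<in>?S. u x *\<^sub>C x) = 0"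
      by (auto simp: cvec.dependent_finite)
    define p where "p = (\<Sum>i\<le>card B. monom (u ((T ^^ i) v)) i)"
    have co: "coeff p i = (if i \<le> card B then u ((T ^^ i) v) else 0)" for i
      by (simp add: p_def coeff_sum)
    have "degree p \<le> card B" by (rule degree_le) (simp add: co)
    then have "pe p = (\<Sum>i\<le>card B. u ((T ^^ i) v) *\<^sub>C (T ^^ i) v)"
      by (simp add: pe_eq co)
    also have "\<dots> = 0" using u(2) True by (simp add: sum.reindex)
    finally have "pe p = 0" .
    moreover have "p \<noteq> 0"
    proof -
      obtain i where "i \<le> card B" "u ((T ^^ i) v) \<noteq> 0" using u(1) by blast
      then have "coeff p i \<noteq> coeff 0 i" by (simp add: co)
      then show ?thesis by metis
    qed
    ultimately show ?thesis by blast
  next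
    case False
    then obtain i j where ij: "i \<noteq> j" "(T ^^ i) v = (T ^^ j) v" by (auto simp: inj_on_def)
    define p where "p = monom (1::complex) i - monom 1 j"
    have co: "coeff p l = (if l = i then 1 else 0) - (if l = j then 1 else 0)" for l
      by (auto simp: p_def)
    have "degree p \<le> i + j" by (rule degree_le) (simp add: co)
    then have "pe p = (\<Sum>l\<le>i + j. coeff p l *\<^sub>C (T ^^ l) v)" by (rule pe_eq)
    also have "\<dots> = (\<Sum>l\<le>i + j. (if l = i then (T ^^ l) v else 0) - (if l = j then (T ^^ l) v else 0))"
      by (intro sum.cong) (auto simp: co)
    also have "\<dots> = 0" using ij by (simp add: sum_subtractf)
    finally have "pe p = 0" .
    moreover have "coeff p i \<noteq> coeff 0 i" using ij by (simp add: co)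
    ultimately show ?thesis by metis
  qed
  \<comment> \<open>Least degree ensures that the cofactor of a root does not annihilate v as
    well.\<close>
  then obtain p where p: "p \<noteq> 0" "pe p = 0" and min: "\<And>q. degree q < degree p \<Longrightarrow> \<not> (q \<noteq> 0 \<and> pe q = 0)"
    using ex_has_least_nat[of "\<lambda>p. p \<noteq> 0 \<and> pe p = 0" _ degree] by (metis not_le)
  have "degree p \<noteq> 0"
  proof
    assume "degree p = 0"
    then have "pe p = coeff p 0 *\<^sub>C v" "coeff p 0 \<noteq> 0"
      using p by (auto simp: pe_def leading_coeff_0_iff[symmetric] simp del: leading_coeff_0_iff)
    then show False using p(2) v by simp
  qed
  then obtain z where "poly p z = 0"
    using fundamental_theorem_of_algebra[of p] by (auto simp: constant_degree)
  then obtain q where q: "p = [:-z, 1:] * q" by (auto simp: poly_eq_0_iff_dvd)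
  have q0: "q \<noteq> 0" using p q by auto
  have deg: "degree p = Suc (degree q)" using q0 unfolding q by (subst degree_mult_eq) auto
  have peq: "pe q \<noteq> 0" using min[of q] q0 deg by auto
  \<comment> \<open>This is \<open>p = (X - z) q\<close> coefficientwise; evaluated at T and applied
    to v it becomes \<open>0 = T (pe q) - z pe q\<close>.\<close>
  have co: "coeff p i = coeff (pCons 0 q) i - z * coeff q i" for i
    by (simp add: q)
  have Tpe: "T (pe q) = (\<Sum>i\<le>degree q. coeff q i *\<^sub>C (T ^^ Suc i) v)"
    unfolding pe_def
    by (subst linear_on_sum[OF T(1) V])
      (simp_all add: cvec.subspace_scale[OF V] Tv linear_on_scale[OF T(1)])
  have "0 = pe p" by (simp add: p)
  also have "\<dots> = (\<Sum>i\<le>Suc (degree q). coeff (pCons 0 q) i *\<^sub>C (T ^^ i) v)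
      - (\<Sum>i\<le>Suc (degree q). z *\<^sub>C coeff q i *\<^sub>C (T ^^ i) v)"
    unfolding pe_def deg by (simp add: co cvec.scale_left_diff_distrib sum_subtractf del: sum.atMost_Suc)
  also have "(\<Sum>i\<le>Suc (degree q). coeff (pCons 0 q) i *\<^sub>C (T ^^ i) v) = T (pe q)"
    unfolding Tpe by (subst sum.atMost_Suc_shift) simp
  also have "(\<Sum>i\<le>Suc (degree q). z *\<^sub>C coeff q i *\<^sub>C (T ^^ i) v) = z *\<^sub>C pe q"
    by (simp add: pe_eq[of q "Suc (degree q)"] cvec.scale_sum_right del: sum.atMost_Suc)
  finally have "T (pe q) = z *\<^sub>C pe q" by simp
  then show thesis by (rule that[OF peV peq])
qed

section \<open>Invariant subspaces, Schur's lemma and rank-one operators\<close>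

lemma is_repI:
  assumes "\<exists>B. finite B \<and> rspace R = cvec.span B"
    and "\<And>g v. g \<in> carrier G \<Longrightarrow> v \<in> rspace R \<Longrightarrow> ract R g v \<in> rspace R"
    and "\<And>g. g \<in> carrier G \<Longrightarrow> linear_on (rspace R) (ract R g)"
    and "\<And>v. v \<in> rspace R \<Longrightarrow> ract R \<one>\<^bsub>G\<^esub> v = v"
    and "\<And>g h v. g \<in> carrier G \<Longrightarrow> h \<in> carrier G \<Longrightarrow> v \<in> rspace R \<Longrightarrow>
           ract R (g \<otimes>\<^bsub>G\<^esub> h) v = ract R g (ract R h v)"
  shows "is_rep G R"
  using assms unfolding is_rep_def by blast

lemma is_repD:
  assumes "is_rep G R"
  shows "\<exists>B. finite B \<and> rspace R = cvec.span B"
    and "cvec.subspace (rspace R)"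
    and "g \<in> carrier G \<Longrightarrow> v \<in> rspace R \<Longrightarrow> ract R g v \<in> rspace R"
    and "g \<in> carrier G \<Longrightarrow> linear_on (rspace R) (ract R g)"
    and "v \<in> rspace R \<Longrightarrow> ract R \<one>\<^bsub>G\<^esub> v = v"
    and "g \<in> carrier G \<Longrightarrow> h \<in> carrier G \<Longrightarrow> v \<in> rspace R \<Longrightarrow>
           ract R (g \<otimes>\<^bsub>G\<^esub> h) v = ract R g (ract R h v)"
  using assms unfolding is_rep_def by auto

lemma irreducible_repD:
  assumes "irreducible_rep G R"
  shows "is_rep G R" "rspace R \<noteq> {0}"
    "cvec.subspace W \<Longrightarrow> W \<subseteq> rspace R \<Longrightarrow> (\<And>g w. g \<in> carrier G \<Longrightarrow> w \<in> W \<Longrightarrow> ract R g w \<in> W) \<Longrightarrow>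
      W = {0} \<or> W = rspace R"
  using assms unfolding irreducible_rep_def by (blast, blast, meson image_subsetI)

lemma irreducible_rep_nonzero:
  assumes "irreducible_rep G R"
  obtains d where "d \<in> rspace R" "d \<noteq> 0"
  using irreducible_repD(2)[OF assms] cvec.subspace_0[OF is_repD(2)[OF irreducible_repD(1)[OF assms]]]
  by blast

text \<open>T has an eigenvalue, and its eigenspace is invariant because T commutes with the action;
  being non-zero, it is everything.\<close>

lemma Schur:
  assumes R: "irreducible_rep G R" and T: "linear_on (rspace R) T" "T ` rspace R \<subseteq> rspace R"
    and comm: "\<And>g v. g \<in> carrier G \<Longrightarrow> v \<in> rspace R \<Longrightarrow> T (ract R g v) = ract R g (T v)"
  obtains z where "\<And>v. v \<in> rspace R \<Longrightarrow> T v = z *\<^sub>C v"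
proof -
  note rep = irreducible_repD(1)[OF R]
  obtain d where d: "d \<in> rspace R" "d \<noteq> 0" using irreducible_rep_nonzero[OF R] .
  obtain B where B: "finite B" "rspace R = cvec.span B" using is_repD(1)[OF rep] by blast
  obtain w z where w: "w \<in> rspace R" "w \<noteq> 0" "T w = z *\<^sub>C w"
    using eigenvector_exists[OF B T d] .
  let ?W = "{v \<in> rspace R. T v = z *\<^sub>C v}"
  have V: "cvec.subspace (rspace R)" using is_repD(2)[OF rep] .
  have "?W = {0} \<or> ?W = rspace R"
  proof (rule irreducible_repD(3)[OF R])
    show "cvec.subspace ?W"
      using V T(1) linear_on_0[OF T(1) V]
      by (auto simp: cvec.subspace_def linear_on_add linear_on_scale cvec.scale_right_distrib mult.commute)
    show "ract R g v \<in> ?W" if "g \<in> carrier G" "v \<in> ?W" for g v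
      using that comm is_repD(3,4)[OF rep that(1)] by (simp add: linear_on_scale)
  qed auto
  then have "?W = rspace R" using w by blast
  then show thesis using that by blast
qed

text \<open>
  The coefficients \<open>\<xi> (f\<inverse> x) dim D / |F|\<close> turn the action of \<open>F\<close> into the rank-one operator
  \<open>v \<mapsto> \<xi> v x\<close>: as a function of \<open>x\<close>, the sum over \<open>F\<close> is an intertwiner, hence a scalar,
  which is found by taking traces.
\<close>

definition rank_one_coeff ::
  "('f, 'x) monoid_scheme \<Rightarrow> ('f, 'v::complex_vector) repn \<Rightarrow> ('v \<Rightarrow> complex) \<Rightarrow> 'v \<Rightarrow> 'f \<Rightarrow> complex"
  where "rank_one_coeff F D \<xi> x f =
    of_nat (cvec.dim (rspace D)) / of_nat (card (carrier F)) * \<xi> (ract D (inv\<^bsub>F\<^esub> f) x)"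

lemma rank_one_coeff:
  assumes F: "group F" "finite (carrier F)" and D: "irreducible_rep F D"
    and \<xi>: "linear_on (rspace D) \<xi>" and x: "x \<in> rspace D" and v: "v \<in> rspace D"
  shows "(\<Sum>f\<in>carrier F. rank_one_coeff F D \<xi> x f *\<^sub>C ract D f v) = \<xi> v *\<^sub>C x"
proof -
  interpret F: group F by (rule F)
  note rep = irreducible_repD(1)[OF D]
  note [simp] = is_repD(3)[OF rep]
  have V: "cvec.subspace (rspace D)" using is_repD(2)[OF rep] .
  define T where "T y = (\<Sum>f\<in>carrier F. \<xi> (ract D (inv\<^bsub>F\<^esub> f) y) *\<^sub>C ract D f v)" for y
  have T: "linear_on (rspace D) T"
    by (rule linear_onI)
      (simp_all add: T_def linear_on_add[OF is_repD(4)[OF rep]] linear_on_scale[OF is_repD(4)[OF rep]]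
        linear_on_add[OF \<xi>] linear_on_scale[OF \<xi>] cvec.scale_left_distrib sum.distrib cvec.scale_sum_right)
  have TV: "T ` rspace D \<subseteq> rspace D"
    unfolding T_def using v by (auto intro!: cvec.subspace_sum[OF V] cvec.subspace_scale[OF V])
  have comm: "T (ract D g y) = ract D g (T y)" if g: "g \<in> carrier F" and y: "y \<in> rspace D" for g y
  proof -
    have "ract D g (T y) = (\<Sum>f\<in>carrier F. \<xi> (ract D (inv\<^bsub>F\<^esub> f) y) *\<^sub>C ract D (g \<otimes>\<^bsub>F\<^esub> f) v)"
      unfolding T_def using g v
      by (simp add: linear_on_sum[OF is_repD(4)[OF rep] V] cvec.subspace_scale[OF V]
          linear_on_scale[OF is_repD(4)[OF rep]] is_repD(6)[OF rep])
    \<comment> \<open>For f' = g f the inverse of f is the inverse of f' times g, so the translation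
      by g passes from v to the argument of \<xi>.\<close>
    also have "\<dots> = (\<Sum>f\<in>carrier F. \<xi> (ract D (inv\<^bsub>F\<^esub> f) (ract D g y)) *\<^sub>C ract D f v)"
      using g y
      by (intro sum.reindex_bij_witness[of _ "\<lambda>f. inv\<^bsub>F\<^esub> g \<otimes>\<^bsub>F\<^esub> f" "\<lambda>f. g \<otimes>\<^bsub>F\<^esub> f"])
        (simp_all add: F.inv_mult_group F.m_assoc[symmetric] is_repD(6)[OF rep, symmetric],
         simp add: F.m_assoc)
    finally show ?thesis by (simp add: T_def)
  qed
  obtain z where z: "\<And>y. y \<in> rspace D \<Longrightarrow> T y = z *\<^sub>C y"
    using Schur[OF D T TV comm] by blast
  obtain B0 where B0: "finite B0" "rspace D = cvec.span B0" using is_repD(1)[OF rep] by blast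
  obtain B where B: "B \<subseteq> B0" "cvec.independent B" "B0 \<subseteq> cvec.span B"
    using cvec.maximal_independent_subset[of B0] by blast
  have fin: "finite B" using B(1) B0(1) finite_subset by blast
  have span: "rspace D = cvec.span B"
    using B B0 by (metis cvec.span_eq cvec.span_superset order_trans cvec.span_mono)
  have BV: "b \<in> rspace D" if "b \<in> B" for b using that span cvec.span_base by blast
  have dim: "cvec.dim (rspace D) = card B"
    unfolding span by (rule cvec.dim_span_eq_card_independent[OF B(2)])
  have "card B \<noteq> 0"
    using irreducible_repD(2)[OF D] fin by (auto simp: span)
  let ?co = "\<lambda>b y. cvec.representation B y b"
  have co_lin: "linear_on (rspace D) (?co b)" for b
    using B(2) by (intro linear_onI) (simp_all add: span cvec.representation_add cvec.representation_scale)
  \<comment> \<open>The trace of \<open>T\<close> in the basis \<open>B\<close>, computed twice: as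
    the trace of a scalar, and as a sum of traces of rank-one maps.\<close>
  have "z * of_nat (card B) = (\<Sum>b\<in>B. ?co b (T b))"
    using B(2) by (simp add: z BV linear_on_scale[OF co_lin] cvec.representation_basis)
  also have "\<dots> = (\<Sum>b\<in>B. \<Sum>f\<in>carrier F. \<xi> (ract D (inv\<^bsub>F\<^esub> f) b) * ?co b (ract D f v))"
    unfolding T_def using v
    by (simp add: linear_on_sum[OF co_lin V] cvec.subspace_scale[OF V] linear_on_scale[OF co_lin])
  also have "\<dots> = (\<Sum>f\<in>carrier F. \<Sum>b\<in>B. \<xi> (ract D (inv\<^bsub>F\<^esub> f) b) * ?co b (ract D f v))"
    by (rule sum.swap)
  also have "\<dots> = (\<Sum>f\<in>carrier F. \<xi> v)"
  proof (intro sum.cong refl)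
    fix f assume f: "f \<in> carrier F"
    let ?\<xi> = "\<lambda>y. \<xi> (ract D (inv\<^bsub>F\<^esub> f) y)"
    have lin: "linear_on (rspace D) ?\<xi>"
      using f \<xi> by (intro linear_on_compose[OF is_repD(4)[OF rep]]) auto
    \<comment> \<open>The rank-one map taking y to \<open>?\<xi> y\<close> times f v has trace
      \<open>?\<xi>\<close> (f v), where f cancels against the inverse inside
      \<open>?\<xi>\<close>.\<close>
    have "(\<Sum>b\<in>B. ?\<xi> b * ?co b (ract D f v)) = (\<Sum>b\<in>B. ?\<xi> (?co b (ract D f v) *\<^sub>C b))"
      by (simp add: linear_on_scale[OF lin] BV mult.commute)
    also have "\<dots> = ?\<xi> (\<Sum>b\<in>B. ?co b (ract D f v) *\<^sub>C b)"
      by (rule linear_on_sum[OF lin V, symmetric]) (simp add: BV cvec.subspace_scale[OF V])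
    also have "(\<Sum>b\<in>B. ?co b (ract D f v) *\<^sub>C b) = ract D f v"
      using B(2) fin f v by (intro cvec.sum_representation_eq) (auto simp flip: span)
    also have "?\<xi> (ract D f v) = \<xi> v"
      using f v by (simp flip: is_repD(6)[OF rep] add: is_repD(5)[OF rep])
    finally show "(\<Sum>b\<in>B. ?\<xi> b * ?co b (ract D f v)) = \<xi> v" .
  qed
  finally have z_eq: "z * of_nat (card B) = of_nat (card (carrier F)) * \<xi> v" by simp
  have "card (carrier F) \<noteq> 0" using F(2) F.one_closed by auto
  have "(\<Sum>f\<in>carrier F. rank_one_coeff F D \<xi> x f *\<^sub>C ract D f v)
      = (of_nat (card B) / of_nat (card (carrier F))) *\<^sub>C T x"
    by (simp add: rank_one_coeff_def T_def cvec.scale_sum_right dim)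
  also have "\<dots> = (z * of_nat (card B) / of_nat (card (carrier F))) *\<^sub>C x"
    using x by (simp add: z)
  also have "\<dots> = \<xi> v *\<^sub>C x" using \<open>card (carrier F) \<noteq> 0\<close> by (simp add: z_eq)
  finally show ?thesis .
qed

section \<open>Wreath products\<close>

lemma wreath_simps:
  "carrier (wreath F n) = ({1..n} \<rightarrow>\<^sub>E carrier F) \<times> carrier (sym_group n)"
  "\<one>\<^bsub>wreath F n\<^esub> = (\<lambda>i\<in>{1..n}. \<one>\<^bsub>F\<^esub>, id)"
  "(f, \<sigma>) \<otimes>\<^bsub>wreath F n\<^esub> (f', \<sigma>') = (\<lambda>i\<in>{1..n}. f i \<otimes>\<^bsub>F\<^esub> f' (inv' \<sigma> i), \<sigma> \<circ> \<sigma>')"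
  by (simp_all add: wreath_def)

lemma snd_wreath_mult: "snd (g \<otimes>\<^bsub>wreath F n\<^esub> h) = snd g \<circ> snd h"
  by (cases g; cases h) (simp add: wreath_simps)

lemma snd_wreath_one: "snd \<one>\<^bsub>wreath F n\<^esub> = id"
  by (simp add: wreath_simps)

lemma permutes_inv_in: "\<sigma> permutes A \<Longrightarrow> i \<in> A \<Longrightarrow> inv' \<sigma> i \<in> A"
  by (simp add: permutes_in_image permutes_inv)

lemma permutes_inv_comp:
  "\<sigma> permutes A \<Longrightarrow> \<tau> permutes B \<Longrightarrow> inv' (\<sigma> \<circ> \<tau>) i = inv' \<tau> (inv' \<sigma> i)"
  by (metis o_inv_distrib permutes_bij comp_apply)

lemma group_wreath:
  assumes "group F"
  shows "group (wreath F n)"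
proof -
  interpret F: group F by fact
  note simps = wreath_simps sym_group_carrier permutes_inv_in permutes_compose permutes_inv_comp
  show ?thesis
  proof (rule groupI)
    fix g h assume "g \<in> carrier (wreath F n)" "h \<in> carrier (wreath F n)"
    then show "g \<otimes>\<^bsub>wreath F n\<^esub> h \<in> carrier (wreath F n)"
      by (cases g; cases h) (auto simp: simps PiE_iff simp del: One_nat_def atLeastAtMost_iff)
  next
    show "\<one>\<^bsub>wreath F n\<^esub> \<in> carrier (wreath F n)"
      by (auto simp: simps permutes_id)
  next
    fix g h k
    assume "g \<in> carrier (wreath F n)" "h \<in> carrier (wreath F n)" "k \<in> carrier (wreath F n)"
    then show "g \<otimes>\<^bsub>wreath F n\<^esub> h \<otimes>\<^bsub>wreath F n\<^esub> k = g \<otimes>\<^bsub>wreath F n\<^esub> (h \<otimes>\<^bsub>wreath F n\<^esub> k)"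
      by (cases g; cases h; cases k)
        (auto simp: simps PiE_iff F.m_assoc fun_eq_iff restrict_def
          simp del: One_nat_def atLeastAtMost_iff)
  next
    fix g assume g: "g \<in> carrier (wreath F n)"
    then show "\<one>\<^bsub>wreath F n\<^esub> \<otimes>\<^bsub>wreath F n\<^esub> g = g"
      by (cases g)
        (auto simp: simps PiE_iff fun_eq_iff restrict_def extensional_def
          simp del: One_nat_def atLeastAtMost_iff)
    obtain f \<sigma> where fs: "g = (f, \<sigma>)" "f \<in> {1..n} \<rightarrow>\<^sub>E carrier F" "\<sigma> permutes {1..n}"
      using g by (cases g) (auto simp: simps)
    \<comment> \<open>Inverting both components is not enough: the inverted base part must also be
      permuted by the inverse of \<sigma>, which puts the index \<open>\<sigma> i\<close>
      here.\<close>
    let ?h = "(\<lambda>i\<in>{1..n}. inv\<^bsub>F\<^esub> f (\<sigma> i), inv' \<sigma>)"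
    have "?h \<in> carrier (wreath F n)"
      using fs permutes_in_image[OF fs(3)]
      by (auto simp: simps PiE_iff permutes_inv simp del: One_nat_def atLeastAtMost_iff)
    moreover have "?h \<otimes>\<^bsub>wreath F n\<^esub> g = \<one>\<^bsub>wreath F n\<^esub>"
      using fs permutes_in_image[OF fs(3)]
      by (auto simp: simps PiE_iff fun_eq_iff permutes_inv_inv permutes_inverses restrict_def
          simp del: One_nat_def atLeastAtMost_iff)
    ultimately show "\<exists>h\<in>carrier (wreath F n). h \<otimes>\<^bsub>wreath F n\<^esub> g = \<one>\<^bsub>wreath F n\<^esub>" by blast
  qed
qed

lemma finite_sym_group: "finite (carrier (sym_group n))"
  by (simp add: sym_group_def finite_permutations)

lemma finite_wreath: "finite (carrier F) \<Longrightarrow> finite (carrier (wreath F n))"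
  by (simp add: wreath_simps finite_sym_group finite_PiE)

lemma snd_wreath_hom: "group F \<Longrightarrow> group_hom (wreath F n) (sym_group n) snd"
  by (intro group_hom.intro group_wreath sym_group_is_group group_hom_axioms.intro)
    (auto simp: hom_def snd_wreath_mult sym_group_mult wreath_simps(1))

lemma snd_wreath_in: "g \<in> carrier (wreath F n) \<Longrightarrow> snd g \<in> carrier (sym_group n)"
  by (auto simp: wreath_simps)

text \<open>This is what \<open>g\<close> does to the entries of a pure tensor. Keeping it as an
  action on tuples allows equivariance of a map \<mu> to be stated without reference to a particular
  tensor space.\<close>

definition tuple_act :: "nat \<Rightarrow> ('f, 'v) repn \<Rightarrow> (nat \<Rightarrow> 'f) \<times> (nat \<Rightarrow> nat) \<Rightarrow> (nat \<Rightarrow> 'v) \<Rightarrow> nat \<Rightarrow> 'v" where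
  "tuple_act n D g v = (\<lambda>i\<in>{1..n}. ract D (fst g i) (v (inv' (snd g) i)))"

lemma tuple_act_in:
  assumes "is_rep F D" "g \<in> carrier (wreath F n)" "v \<in> {1..n} \<rightarrow>\<^sub>E rspace D"
  shows "tuple_act n D g v \<in> {1..n} \<rightarrow>\<^sub>E rspace D"
  using assms(2,3)
  by (cases g)
    (auto simp: tuple_act_def wreath_simps sym_group_carrier PiE_iff permutes_inv_in
      intro!: is_repD(3)[OF assms(1)] simp del: One_nat_def atLeastAtMost_iff)

lemma tuple_act_one:
  assumes "is_rep F D" "v \<in> {1..n} \<rightarrow>\<^sub>E rspace D"
  shows "tuple_act n D \<one>\<^bsub>wreath F n\<^esub> v = v"
  using assms(2)
  by (auto simp: tuple_act_def wreath_simps PiE_iff is_repD(5)[OF assms(1)] fun_eq_iff extensional_def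
      simp del: One_nat_def atLeastAtMost_iff)

lemma tuple_act_mult:
  assumes "is_rep F D" "g \<in> carrier (wreath F n)" "h \<in> carrier (wreath F n)"
    "v \<in> {1..n} \<rightarrow>\<^sub>E rspace D"
  shows "tuple_act n D (g \<otimes>\<^bsub>wreath F n\<^esub> h) v = tuple_act n D g (tuple_act n D h v)"
  using assms(2-)
  by (cases g; cases h)
    (auto simp: tuple_act_def wreath_simps sym_group_carrier PiE_iff is_repD(6)[OF assms(1)] fun_eq_iff
      permutes_inv_in permutes_inv_comp simp del: One_nat_def atLeastAtMost_iff)

text \<open>Slot i is carried to slot \<open>snd g i\<close>, so changing one entry before acting
  changes just one entry afterwards. Multilinearity therefore survives composition with the
  action.\<close>

lemma tuple_act_upd:
  assumes "g \<in> carrier (wreath F n)" "i \<in> {1..n}"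
  shows "tuple_act n D g (v(i := x)) = (tuple_act n D g v)(snd g i := ract D (fst g (snd g i)) x)"
proof
  fix j
  have p: "snd g permutes {1..n}" using snd_wreath_in[OF assms(1)] by (simp add: sym_group_carrier)
  have "inv' (snd g) j = i \<longleftrightarrow> j = snd g i" using permutes_inv_eq[OF p] by metis
  moreover have "snd g i \<in> {1..n}" using permutes_in_image[OF p] assms(2) by blast
  ultimately show "tuple_act n D g (v(i := x)) j = ((tuple_act n D g v)(snd g i := ract D (fst g (snd g i)) x)) j"
    by (auto simp: tuple_act_def simp del: One_nat_def atLeastAtMost_iff)
qed

text \<open>Every component of \<open>g\<close> acts invertibly on D. Non-degeneracy can thus be
  tested after moving \<open>v\<close> by a group element, as happens at the points of an induced
  representation.\<close>

lemma tuple_act_nonzero: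
  assumes D: "is_rep F D" and F: "group F" and g: "g \<in> carrier (wreath F n)"
    and v: "v \<in> {1..n} \<rightarrow>\<^sub>E rspace D" "\<And>i. i \<in> {1..n} \<Longrightarrow> v i \<noteq> 0" and i: "i \<in> {1..n}"
  shows "tuple_act n D g v i \<noteq> 0"
proof
  interpret F: group F by (rule F)
  have p: "snd g permutes {1..n}" using snd_wreath_in[OF g] by (simp add: sym_group_carrier)
  let ?j = "inv' (snd g) i"
  have j: "?j \<in> {1..n}" using permutes_inv_in[OF p i] .
  have fi: "fst g i \<in> carrier F" using g i by (auto simp: wreath_simps simp del: One_nat_def atLeastAtMost_iff)
  have vj: "v ?j \<in> rspace D" using v(1) j by (rule PiE_mem)
  assume "tuple_act n D g v i = 0"
  then have z: "ract D (fst g i) (v ?j) = 0" using i by (simp add: tuple_act_def)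
  have "v ?j = ract D (inv\<^bsub>F\<^esub> fst g i \<otimes>\<^bsub>F\<^esub> fst g i) (v ?j)"
    using fi vj is_repD(5)[OF D] by simp
  also have "\<dots> = ract D (inv\<^bsub>F\<^esub> fst g i) 0"
    using fi vj z is_repD(6)[OF D, of "inv\<^bsub>F\<^esub> fst g i" "fst g i" "v ?j"] by simp
  also have "\<dots> = 0" using fi by (intro linear_on_0[OF is_repD(4)[OF D] is_repD(2)[OF D]]) simp
  finally show False using v(2)[OF j] by blast
qed

text \<open>The embedding of F as the i-th factor of the base group F^n.\<close>

definition slot :: "('f, 'x) monoid_scheme \<Rightarrow> nat \<Rightarrow> nat \<Rightarrow> 'f \<Rightarrow> (nat \<Rightarrow> 'f) \<times> (nat \<Rightarrow> nat)" where
  "slot F n i f = (\<lambda>j\<in>{1..n}. if j = i then f else \<one>\<^bsub>F\<^esub>, id)"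

lemma slot_in: "group F \<Longrightarrow> f \<in> carrier F \<Longrightarrow> slot F n i f \<in> carrier (wreath F n)"
  by (auto simp: slot_def wreath_simps sym_group_carrier permutes_id group.is_monoid monoid.one_closed)

lemma tuple_act_slot:
  assumes "is_rep F D" "v \<in> {1..n} \<rightarrow>\<^sub>E rspace D" "i \<in> {1..n}"
  shows "tuple_act n D (slot F n i f) v = v(i := ract D f (v i))"
  using assms(2,3)
  by (auto simp: tuple_act_def slot_def PiE_iff is_repD(5)[OF assms(1)] fun_eq_iff extensional_def
      simp del: One_nat_def atLeastAtMost_iff)

text \<open>The complement S_n of the base group, through which the action on \<open>E\<close> is
  recovered from the action on X.\<close>

definition perm_embed :: "('f, 'x) monoid_scheme \<Rightarrow> nat \<Rightarrow> (nat \<Rightarrow> nat) \<Rightarrow> (nat \<Rightarrow> 'f) \<times> (nat \<Rightarrow> nat)" where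
  "perm_embed F n \<sigma> = (\<lambda>i\<in>{1..n}. \<one>\<^bsub>F\<^esub>, \<sigma>)"

lemma perm_embed_in:
  "group F \<Longrightarrow> \<sigma> \<in> carrier (sym_group n) \<Longrightarrow> perm_embed F n \<sigma> \<in> carrier (wreath F n)"
  by (auto simp: perm_embed_def wreath_simps group.is_monoid monoid.one_closed)

lemma snd_perm_embed [simp]: "snd (perm_embed F n \<sigma>) = \<sigma>"
  by (simp add: perm_embed_def)

text \<open>The preimage is \<open>w\<close> composed with \<sigma>. It presents
  \<open>\<mu> w (ract E \<sigma> e)\<close> as a group element applied to some
  \<open>\<mu> v e\<close>, with the tuple \<open>w\<close> prescribed.\<close>

lemma tuple_act_perm_embed_surj:
  assumes "is_rep F D" "\<sigma> \<in> carrier (sym_group n)" "w \<in> {1..n} \<rightarrow>\<^sub>E rspace D"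
  obtains v where "v \<in> {1..n} \<rightarrow>\<^sub>E rspace D" "tuple_act n D (perm_embed F n \<sigma>) v = w"
proof
  have \<sigma>: "\<sigma> permutes {1..n}" using assms(2) by (simp add: sym_group_carrier)
  show "(\<lambda>i\<in>{1..n}. w (\<sigma> i)) \<in> {1..n} \<rightarrow>\<^sub>E rspace D"
    using assms(3) permutes_in_image[OF \<sigma>] by (auto simp: PiE_iff simp del: One_nat_def atLeastAtMost_iff)
  show "tuple_act n D (perm_embed F n \<sigma>) (\<lambda>i\<in>{1..n}. w (\<sigma> i)) = w"
    using assms(3) permutes_inv_in[OF \<sigma>] permutes_inverses[OF \<sigma>]
    by (auto simp: tuple_act_def perm_embed_def PiE_iff is_repD(5)[OF assms(1)] fun_eq_iff extensional_def
      simp del: One_nat_def atLeastAtMost_iff)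
qed

section \<open>Contractions\<close>

definition slot_op :: "('f, 'x) monoid_scheme \<Rightarrow> nat \<Rightarrow> ((nat \<Rightarrow> 'f) \<times> (nat \<Rightarrow> nat), 'v::complex_vector) repn \<Rightarrow>
    nat \<Rightarrow> ('f \<Rightarrow> complex) \<Rightarrow> 'v \<Rightarrow> 'v" where
  "slot_op F n X i c w = (\<Sum>f\<in>carrier F. c f *\<^sub>C ract X (slot F n i f) w)"

text \<open>
  On \<open>D\<^sup>\<otimes>\<^sup>n \<otimes> E\<close>, \<open>contract F n D X \<xi> x j\<close> applies the functionals \<open>\<xi> i\<close> to the first \<open>j\<close> tensor
  factors and puts the vectors \<open>x i\<close> in their place. Being a combination of group elements, it makes
  sense on every representation \<open>X\<close> and commutes with all intertwiners.
\<close>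

primrec contract :: "('f, 'x) monoid_scheme \<Rightarrow> nat \<Rightarrow> ('f, 'd::complex_vector) repn \<Rightarrow>
    ((nat \<Rightarrow> 'f) \<times> (nat \<Rightarrow> nat), 'v::complex_vector) repn \<Rightarrow>
    (nat \<Rightarrow> 'd \<Rightarrow> complex) \<Rightarrow> (nat \<Rightarrow> 'd) \<Rightarrow> nat \<Rightarrow> 'v \<Rightarrow> 'v" where
  "contract F n D X \<xi> x 0 w = w"
| "contract F n D X \<xi> x (Suc j) w =
     slot_op F n X (Suc j) (rank_one_coeff F D (\<xi> (Suc j)) (x (Suc j))) (contract F n D X \<xi> x j w)"

lemma contract_cong:
  assumes "\<And>i. i \<in> {1..j} \<Longrightarrow> \<xi> i = \<xi>' i" "\<And>i. i \<in> {1..j} \<Longrightarrow> x i = x' i"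
  shows "contract F n D X \<xi> x j w = contract F n D X \<xi>' x' j w"
  using assms by (induction j) auto

text \<open>\<open>W\<close> may be any invariant subspace: in the irreducibility proof it is a
  proper candidate, and contractions of its vectors must stay inside it.\<close>

lemma contract_in:
  assumes "group F" "cvec.subspace W" "\<And>g w. g \<in> carrier (wreath F n) \<Longrightarrow> w \<in> W \<Longrightarrow> ract X g w \<in> W"
    and "w \<in> W"
  shows "contract F n D X \<xi> x j w \<in> W"
  using assms(4)
  by (induction j)
    (auto simp: slot_op_def intro!: cvec.subspace_sum cvec.subspace_scale assms(2,3) slot_in[OF assms(1)])

lemma contract_commute:
  assumes "group F" "cvec.subspace (rspace X)"
    and closed: "\<And>g w. g \<in> carrier (wreath F n) \<Longrightarrow> w \<in> rspace X \<Longrightarrow> ract X g w \<in> rspace X"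
    and T: "linear_on (rspace X) T"
      "\<And>g w. g \<in> carrier (wreath F n) \<Longrightarrow> w \<in> rspace X \<Longrightarrow> T (ract X g w) = ract X' g (T w)"
    and w: "w \<in> rspace X"
  shows "T (contract F n D X \<xi> x j w) = contract F n D X' \<xi> x j (T w)"
proof (induction j)
  case (Suc j)
  have "contract F n D X \<xi> x j w \<in> rspace X"
    using contract_in[OF assms(1,2) closed w] .
  then have "T (slot_op F n X i c (contract F n D X \<xi> x j w))
      = slot_op F n X' i c (T (contract F n D X \<xi> x j w))" for i c
    using closed assms(2) unfolding slot_op_def
    by (subst linear_on_sum[OF T(1)])
      (simp_all add: cvec.subspace_scale slot_in[OF assms(1)] linear_on_scale[OF T(1)] T(2))
  then show ?case by (simp add: Suc)
qed simp

section \<open>Representations of the form \<open>D\<^sup>\<otimes>\<^sup>n \<otimes> E\<close>\<close>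

text \<open>
  \<open>\<mu> v e\<close> plays the role of the pure tensor \<open>v\<^sub>1 \<otimes> \<dots> \<otimes> v\<^sub>n \<otimes> e\<close>. The non-degeneracy axiom replaces
  the universal property of the tensor product: since \<open>D\<close> is irreducible, it forces \<open>X\<close> to be
  isomorphic to \<open>(D; E)\<close>.
\<close>

locale wreath_tensor =
  fixes F :: "('f, 'x) monoid_scheme" and n :: nat and D :: "('f, 'd::complex_vector) repn"
    and X :: "((nat \<Rightarrow> 'f) \<times> (nat \<Rightarrow> nat), 'v::complex_vector) repn"
    and E :: "(nat \<Rightarrow> nat, 'e::complex_vector) repn"
    and \<mu> :: "(nat \<Rightarrow> 'd) \<Rightarrow> 'e \<Rightarrow> 'v"
  assumes F: "group F" "finite (carrier F)" and D: "irreducible_rep F D"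
    and E: "is_rep (sym_group n) E"
    and space: "rspace X = cvec.span {\<mu> v e | v e. v \<in> {1..n} \<rightarrow>\<^sub>E rspace D \<and> e \<in> rspace E}"
    and act_linear: "\<And>g. g \<in> carrier (wreath F n) \<Longrightarrow> linear_on (rspace X) (ract X g)"
    and act: "\<And>g v e. g \<in> carrier (wreath F n) \<Longrightarrow> v \<in> {1..n} \<rightarrow>\<^sub>E rspace D \<Longrightarrow> e \<in> rspace E \<Longrightarrow>
      ract X g (\<mu> v e) = \<mu> (tuple_act n D g v) (ract E (snd g) e)"
    and multilinear: "\<And>v e i. v \<in> {1..n} \<rightarrow>\<^sub>E rspace D \<Longrightarrow> e \<in> rspace E \<Longrightarrow> i \<in> {1..n} \<Longrightarrow>
      linear_on (rspace D) (\<lambda>x. \<mu> (v(i := x)) e)"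
    and linear: "\<And>v. v \<in> {1..n} \<rightarrow>\<^sub>E rspace D \<Longrightarrow> linear_on (rspace E) (\<mu> v)"
    and nondegenerate: "\<And>v e. v \<in> {1..n} \<rightarrow>\<^sub>E rspace D \<Longrightarrow> (\<And>i. i \<in> {1..n} \<Longrightarrow> v i \<noteq> 0) \<Longrightarrow>
      e \<in> rspace E \<Longrightarrow> \<mu> v e = 0 \<Longrightarrow> e = 0"
begin

abbreviation "tuples \<equiv> {1..n} \<rightarrow>\<^sub>E rspace D"
abbreviation "frame \<xi> \<equiv> \<forall>i\<in>{1..n}. linear_on (rspace D) (\<xi> i)"

lemma rep_D: "is_rep F D"
  using D by (rule irreducible_repD)

lemma subspace_X: "cvec.subspace (rspace X)"
  by (simp add: space)

lemma mu_in: "v \<in> tuples \<Longrightarrow> e \<in> rspace E \<Longrightarrow> \<mu> v e \<in> rspace X"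
  unfolding space by (auto intro!: cvec.span_base)

lemma linear_eq:
  assumes "linear_on (rspace X) f" "linear_on (rspace X) h"
    "\<And>v e. v \<in> tuples \<Longrightarrow> e \<in> rspace E \<Longrightarrow> f (\<mu> v e) = h (\<mu> v e)" "w \<in> rspace X"
  shows "f w = h w"
  using assms unfolding space by (elim linear_on_eq_span) auto

lemma in_subspace:
  assumes "cvec.subspace W" "\<And>v e. v \<in> tuples \<Longrightarrow> e \<in> rspace E \<Longrightarrow> \<mu> v e \<in> W" "w \<in> rspace X"
  shows "w \<in> W"
proof -
  have "rspace X \<subseteq> W"
    unfolding space using assms by (intro cvec.span_minimal) auto
  then show ?thesis using assms(3) by blast
qed

lemma act_in:
  assumes "g \<in> carrier (wreath F n)" "w \<in> rspace X"
  shows "ract X g w \<in> rspace X"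
proof -
  have "w \<in> {w \<in> rspace X. ract X g w \<in> rspace X}"
    using assms act_linear[OF assms(1)] subspace_X
    by (intro in_subspace[OF _ _ assms(2)] linear_on_subspace_vimage)
      (auto simp: act intro!: mu_in tuple_act_in[OF rep_D] is_repD(3)[OF E] snd_wreath_in)
  then show ?thesis by simp
qed

text \<open>Expand the entries of \<open>v\<close> one after another in \<open>B\<close>, then
  \<open>e\<close> in \<open>C\<close>. For finite \<open>B\<close> and \<open>C\<close> only
  finitely many vectors remain, which is the source of the finite dimension of X.\<close>

lemma mu_span:
  assumes v: "v \<in> tuples" and e: "e \<in> rspace E"
    and B: "B \<subseteq> rspace D" "rspace D = cvec.span B" and C: "C \<subseteq> rspace E" "rspace E = cvec.span C"
  shows "\<mu> v e \<in> cvec.span {\<mu> v e | v e. v \<in> {1..n} \<rightarrow>\<^sub>E B \<and> e \<in> C}" (is "_ \<in> cvec.span ?S")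
proof -
  \<comment> \<open>\<open>J\<close> collects the slots whose entries may lie outside
    \<open>B\<close>; each induction step expands one of them.\<close>
  have "\<mu> v e \<in> cvec.span ?S"
    if "finite J" "J \<subseteq> {1..n}" "v \<in> tuples" "\<And>i. i \<in> {1..n} - J \<Longrightarrow> v i \<in> B" "e \<in> C" for J v e
    using that
  proof (induction J arbitrary: v)
    case empty
    then have "v \<in> {1..n} \<rightarrow>\<^sub>E B" by (auto simp: PiE_iff simp del: One_nat_def atLeastAtMost_iff)
    then show ?case using empty by (auto intro!: cvec.span_base)
  next
    case (insert j J)
    have j: "j \<in> {1..n}" using insert by blast
    have "\<mu> (v(j := x)) e \<in> cvec.span ?S" if "x \<in> B" for x
      using that insert.prems B insert.hyps j
      by (intro insert.IH) (auto simp: PiE_iff extensional_def simp del: One_nat_def atLeastAtMost_iff)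
    moreover have "linear_on (cvec.span B) (\<lambda>x. \<mu> (v(j := x)) e)"
      using multilinear[OF insert.prems(2) _ j, of e] insert.prems C B by auto
    ultimately have "(\<lambda>x. \<mu> (v(j := x)) e) ` cvec.span B \<subseteq> cvec.span ?S"
      by (intro linear_on_span_image) auto
    moreover have "v j \<in> cvec.span B" using insert.prems(2) j B(2) by (metis PiE_mem)
    ultimately have "\<mu> (v(j := v j)) e \<in> cvec.span ?S" by blast
    then show ?case by simp
  qed
  from this[of "{1..n}"] have "\<mu> v c \<in> cvec.span ?S" if "c \<in> C" for c
    using that v by simp
  then have "\<mu> v ` cvec.span C \<subseteq> cvec.span ?S"
    using linear[OF v] C(2) by (intro linear_on_span_image) auto
  then show ?thesis using e C(2) by blast
qed

lemma is_rep_X: "is_rep (wreath F n) X"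
proof -
  interpret G: group "wreath F n" using F(1) by (rule group_wreath)
  obtain B where B: "finite B" "rspace D = cvec.span B" using is_repD(1)[OF rep_D] by blast
  obtain C where C: "finite C" "rspace E = cvec.span C" using is_repD(1)[OF E] by blast
  let ?S = "{\<mu> v e | v e. v \<in> {1..n} \<rightarrow>\<^sub>E B \<and> e \<in> C}"
  have sub: "B \<subseteq> rspace D" "C \<subseteq> rspace E" using B C by (auto intro: cvec.span_base)
  have "?S = (\<lambda>(v, e). \<mu> v e) ` (({1..n} \<rightarrow>\<^sub>E B) \<times> C)" by auto
  then have fin: "finite ?S" using B C by (simp add: finite_PiE)
  have "?S \<subseteq> {\<mu> v e | v e. v \<in> tuples \<and> e \<in> rspace E}"
    using sub PiE_mono[of "{1..n}" "\<lambda>_. B" "\<lambda>_. rspace D"] by blast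
  then have "cvec.span ?S \<subseteq> rspace X" unfolding space by (rule cvec.span_mono)
  moreover have "rspace X \<subseteq> cvec.span ?S"
    using in_subspace[OF cvec.subspace_span mu_span[OF _ _ sub(1) B(2) sub(2) C(2)]] by blast
  ultimately have "cvec.span ?S = rspace X" by (rule equalityI)
  then have ex: "\<exists>B. finite B \<and> rspace X = cvec.span B"
    using fin by (intro exI[of _ ?S]) simp
  have one: "ract X \<one>\<^bsub>wreath F n\<^esub> w = w" if "w \<in> rspace X" for w
  proof (rule linear_eq[OF act_linear _ _ that])
    show "ract X \<one>\<^bsub>wreath F n\<^esub> (\<mu> v e) = \<mu> v e" if "v \<in> tuples" "e \<in> rspace E" for v e
      using that is_repD(5)[OF E, unfolded sym_group_one]
      by (simp add: act tuple_act_one[OF rep_D] snd_wreath_one)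
  qed (auto intro: linear_onI)
  have mult: "ract X (g \<otimes>\<^bsub>wreath F n\<^esub> h) w = ract X g (ract X h w)"
    if "g \<in> carrier (wreath F n)" "h \<in> carrier (wreath F n)" "w \<in> rspace X" for g h w
  proof (rule linear_eq[OF act_linear _ _ that(3)])
    show "linear_on (rspace X) (\<lambda>w. ract X g (ract X h w))"
      using that(1,2) act_in[OF that(2)] by (intro linear_on_compose[OF act_linear _ act_linear]) blast+
    show "ract X (g \<otimes>\<^bsub>wreath F n\<^esub> h) (\<mu> v e) = ract X g (ract X h (\<mu> v e))"
      if "v \<in> tuples" "e \<in> rspace E" for v e
      using that \<open>g \<in> _\<close> \<open>h \<in> _\<close>
      by (simp add: act tuple_act_mult[OF rep_D] tuple_act_in[OF rep_D] is_repD(3)[OF E] snd_wreath_in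
          snd_wreath_mult is_repD(6)[OF E, unfolded sym_group_mult] del: One_nat_def)
  qed (use that in auto)
  show ?thesis
    unfolding is_rep_def using ex one mult act_in act_linear by blast
qed

lemma slot_op_linear: "linear_on (rspace X) (slot_op F n X i c)"
  unfolding slot_op_def
  by (intro linear_onI)
    (simp_all add: linear_on_add[OF act_linear] linear_on_scale[OF act_linear] slot_in[OF F(1)]
      cvec.scale_right_distrib sum.distrib cvec.scale_sum_right mult.commute)

text \<open>A slot element has trivial permutation part and so fixes \<open>e\<close>.
  Multilinearity then moves the sum over F into slot i, where it is a rank-one operator on
  D.\<close>

lemma slot_op_mu:
  assumes "v \<in> tuples" "e \<in> rspace E" "i \<in> {1..n}" "linear_on (rspace D) \<xi>" "x \<in> rspace D"
  shows "slot_op F n X i (rank_one_coeff F D \<xi> x) (\<mu> v e) = \<xi> (v i) *\<^sub>C \<mu> (v(i := x)) e"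
proof -
  let ?c = "rank_one_coeff F D \<xi> x"
  note lin = multilinear[OF assms(1-3)]
  have vi: "v i \<in> rspace D" using assms(1,3) by blast
  have "slot_op F n X i ?c (\<mu> v e) = (\<Sum>f\<in>carrier F. ?c f *\<^sub>C \<mu> (v(i := ract D f (v i))) e)"
    unfolding slot_op_def using assms
    by (intro sum.cong refl)
      (simp add: act slot_in[OF F(1)] tuple_act_slot[OF rep_D],
       simp add: slot_def is_repD(5)[OF E, unfolded sym_group_one])
  also have "\<dots> = \<mu> (v(i := (\<Sum>f\<in>carrier F. ?c f *\<^sub>C ract D f (v i)))) e"
    using is_repD(2,3)[OF rep_D] vi
    by (subst linear_on_sum[OF lin]) (simp_all add: cvec.subspace_scale linear_on_scale[OF lin])
  also have "\<dots> = \<mu> (v(i := \<xi> (v i) *\<^sub>C x)) e"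
    using rank_one_coeff[OF F D assms(4,5) vi] by simp
  also have "\<dots> = \<xi> (v i) *\<^sub>C \<mu> (v(i := x)) e"
    using assms(5) by (simp add: linear_on_scale[OF lin])
  finally show ?thesis .
qed

text \<open>The rank-one maps with functional \<open>co b\<close> and vector \<open>b\<close> add up
  to the identity of D, here transported to slot i of X. Hence no non-zero vector is killed by all
  rank-one operators in a given slot.\<close>

lemma slot_op_sum:
  assumes "w \<in> rspace X" "i \<in> {1..n}" "finite B" "B \<subseteq> rspace D" "\<And>b. linear_on (rspace D) (co b)"
    "\<And>v. v \<in> rspace D \<Longrightarrow> (\<Sum>b\<in>B. co b v *\<^sub>C b) = v"
  shows "(\<Sum>b\<in>B. slot_op F n X i (rank_one_coeff F D (co b) b) w) = w"
proof (rule linear_eq[of "\<lambda>w. (\<Sum>b\<in>B. slot_op F n X i (rank_one_coeff F D (co b) b) w)" "\<lambda>w. w"])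
  show "linear_on (rspace X) (\<lambda>w. \<Sum>b\<in>B. slot_op F n X i (rank_one_coeff F D (co b) b) w)"
    by (intro linear_onI)
      (simp_all add: linear_on_add[OF slot_op_linear] linear_on_scale[OF slot_op_linear]
        sum.distrib cvec.scale_sum_right)
  show "(\<Sum>b\<in>B. slot_op F n X i (rank_one_coeff F D (co b) b) (\<mu> v e)) = \<mu> v e"
    if ve: "v \<in> tuples" "e \<in> rspace E" for v e
  proof -
    note lin = multilinear[OF ve assms(2)]
    have "(\<Sum>b\<in>B. slot_op F n X i (rank_one_coeff F D (co b) b) (\<mu> v e))
        = (\<Sum>b\<in>B. co b (v i) *\<^sub>C \<mu> (v(i := b)) e)"
      using assms(4,5) by (intro sum.cong refl slot_op_mu ve assms) auto
    also have "\<dots> = \<mu> (v(i := (\<Sum>b\<in>B. co b (v i) *\<^sub>C b))) e"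
      using is_repD(2)[OF rep_D] assms(4)
      by (subst linear_on_sum[OF lin]) (auto simp: cvec.subspace_scale linear_on_scale[OF lin] subset_iff)
    also have "(\<Sum>b\<in>B. co b (v i) *\<^sub>C b) = v i" using ve assms(2) by (intro assms(6)) blast
    finally show ?thesis by simp
  qed
qed (auto intro: linear_onI assms(1))

lemma contract_X_in: "w \<in> rspace X \<Longrightarrow> contract F n D X \<xi> x j w \<in> rspace X"
  using contract_in[OF F(1) subspace_X act_in] .

lemma contract_linear: "linear_on (rspace X) (contract F n D X \<xi> x j)"
proof (induction j)
  case (Suc j)
  have "contract F n D X \<xi> x j ` rspace X \<subseteq> rspace X" using contract_X_in by blast
  from linear_on_compose[OF Suc this slot_op_linear] show ?case by simp
qed (auto intro: linear_onI)

text \<open>Each step reads a slot that the earlier steps have left alone, so the scalars collected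
  come from the original entries of \<open>v\<close> and not from \<open>x\<close>.\<close>

lemma contract_mu_partial:
  assumes "v \<in> tuples" "e \<in> rspace E" "frame \<xi>" "x \<in> tuples" "j \<le> n"
  shows "override_on v x {1..j} \<in> tuples \<and>
    contract F n D X \<xi> x j (\<mu> v e) = (\<Prod>i\<in>{1..j}. \<xi> i (v i)) *\<^sub>C \<mu> (override_on v x {1..j}) e"
  using assms(5)
proof (induction j)
  case (Suc j)
  let ?w = "override_on v x {1..j}"
  have IH: "?w \<in> tuples" "contract F n D X \<xi> x j (\<mu> v e) = (\<Prod>i\<in>{1..j}. \<xi> i (v i)) *\<^sub>C \<mu> ?w e"
    using Suc by auto
  have j: "Suc j \<in> {1..n}" using Suc.prems by simp
  have xj: "x (Suc j) \<in> rspace D" using assms(4) j by blast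
  have w: "override_on v x {1..Suc j} = ?w(Suc j := x (Suc j))"
    by (auto simp: override_on_def fun_eq_iff le_Suc_eq)
  have "?w (Suc j) = v (Suc j)" by (simp add: override_on_def)
  then have "contract F n D X \<xi> x (Suc j) (\<mu> v e)
      = (\<Prod>i\<in>{1..j}. \<xi> i (v i)) *\<^sub>C \<xi> (Suc j) (v (Suc j)) *\<^sub>C \<mu> (?w(Suc j := x (Suc j))) e"
    using assms(3) j xj IH assms(2)
    by (simp add: IH linear_on_scale[OF slot_op_linear] mu_in slot_op_mu)
  moreover have "?w(Suc j := x (Suc j)) \<in> tuples"
    using IH(1) xj j by (auto simp: PiE_iff extensional_def simp del: One_nat_def atLeastAtMost_iff)
  ultimately show ?case
    unfolding w by (simp only: prod.nat_ivl_Suc' le_add2 plus_1_eq_Suc cvec.scale_scale mult.commute)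
qed (use assms in simp)

lemma contract_mu:
  assumes "v \<in> tuples" "e \<in> rspace E" "frame \<xi>" "x \<in> tuples"
  shows "contract F n D X \<xi> x n (\<mu> v e) = (\<Prod>i\<in>{1..n}. \<xi> i (v i)) *\<^sub>C \<mu> x e"
proof -
  have "override_on v x {1..n} = x"
    using assms(1,4) by (auto simp: override_on_def fun_eq_iff PiE_iff extensional_def)
  then show ?thesis using contract_mu_partial[OF assms order_refl] by simp
qed

text \<open>By \<open>slot_op_sum\<close>, some rank-one operator in the next slot keeps a non-zero
  vector non-zero; going through the slots builds \<xi> and \<open>x\<close>. Contractions therefore
  separate the vectors of X.\<close>

lemma contract_nonzero:
  assumes w: "w \<in> rspace X" "w \<noteq> 0"
  obtains \<xi> x where "frame \<xi>" "x \<in> tuples" "contract F n D X \<xi> x n w \<noteq> 0"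
proof -
  \<comment> \<open>Extensionality of \<open>x\<close> is dropped during the induction and restored
    at the end by restriction, which \<open>contract\<close> cannot notice.\<close>
  have "\<exists>\<xi> x. frame \<xi> \<and> (\<forall>i\<in>{1..n}. x i \<in> rspace D) \<and> contract F n D X \<xi> x j w \<noteq> 0" if "j \<le> n" for j
    using that
  proof (induction j)
    case 0
    then show ?case
      using w cvec.subspace_0[OF is_repD(2)[OF rep_D]]
      by (intro exI[of _ "\<lambda>_ _. 0"] exI[of _ "\<lambda>_. 0"]) (auto intro: linear_onI)
  next
    case (Suc j)
    obtain \<xi> x where fr: "frame \<xi>" "\<forall>i\<in>{1..n}. x i \<in> rspace D" and nz: "contract F n D X \<xi> x j w \<noteq> 0"
      using Suc by auto
    obtain B0 where B0: "finite B0" "rspace D = cvec.span B0" using is_repD(1)[OF rep_D] by blast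
    obtain B and co :: "'d \<Rightarrow> 'd \<Rightarrow> complex" where
      B: "finite B" "B \<subseteq> rspace D" "rspace D = cvec.span B" "\<And>b. linear_on (rspace D) (co b)"
        "\<And>v. v \<in> rspace D \<Longrightarrow> (\<Sum>b\<in>B. co b v *\<^sub>C b) = v"
      using coordinates[OF B0] by metis
    have "(\<Sum>b\<in>B. slot_op F n X (Suc j) (rank_one_coeff F D (co b) b) (contract F n D X \<xi> x j w)) \<noteq> 0"
      using slot_op_sum[OF contract_X_in[OF w(1)] _ B(1,2,4,5)] Suc.prems nz by simp
    then obtain b where b: "b \<in> B"
      "slot_op F n X (Suc j) (rank_one_coeff F D (co b) b) (contract F n D X \<xi> x j w) \<noteq> 0"
      by (meson sum.not_neutral_contains_not_neutral)
    let ?\<xi> = "\<xi>(Suc j := co b)" and ?x = "x(Suc j := b)"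
    have "contract F n D X ?\<xi> ?x j w = contract F n D X \<xi> x j w"
      by (rule contract_cong) auto
    then have "contract F n D X ?\<xi> ?x (Suc j) w \<noteq> 0" using b(2) by simp
    moreover have "frame ?\<xi>" using fr B(4) by simp
    moreover have "\<forall>i\<in>{1..n}. ?x i \<in> rspace D" using fr b(1) B(2) by auto
    ultimately show ?case by blast
  qed
  then obtain \<xi> x where fr: "frame \<xi>" "\<forall>i\<in>{1..n}. x i \<in> rspace D" "contract F n D X \<xi> x n w \<noteq> 0"
    by blast
  moreover have "contract F n D X \<xi> (restrict x {1..n}) n w = contract F n D X \<xi> x n w"
    by (rule contract_cong) auto
  ultimately show thesis by (intro that[of \<xi> "restrict x {1..n}"]) auto
qed

text \<open>The vector \<open>e\<close> arises by applying the functionals \<open>\<xi> i\<close> to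
  the slots of \<open>w\<close>, hence does not depend on \<open>x\<close>. For a pure vector
  \<open>\<mu> v e\<close> it is a multiple of its \<open>e\<close>; the property of
  \<open>w\<close> is closed under linear combinations and so extends to the span.\<close>

lemma contract_form:
  assumes "w \<in> rspace X" and fr: "frame \<xi>"
  shows "\<exists>e\<in>rspace E. \<forall>x\<in>tuples. contract F n D X \<xi> x n w = \<mu> x e"
proof -
  let ?W = "{w \<in> rspace X. \<exists>e\<in>rspace E. \<forall>x\<in>tuples. contract F n D X \<xi> x n w = \<mu> x e}"
  note subE = is_repD(2)[OF E]
  have "cvec.subspace ?W"
    unfolding cvec.subspace_def
  proof (intro conjI ballI allI)
    show "0 \<in> ?W"
      using linear_on_0[OF contract_linear subspace_X] linear_on_0[OF linear subE]
      by (auto intro!: bexI[of _ 0] cvec.subspace_0 subE subspace_X)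
  next
    fix u w assume "u \<in> ?W" "w \<in> ?W"
    then obtain d e where "u \<in> rspace X" "w \<in> rspace X" "d \<in> rspace E" "e \<in> rspace E"
      "\<forall>x\<in>tuples. contract F n D X \<xi> x n u = \<mu> x d" "\<forall>x\<in>tuples. contract F n D X \<xi> x n w = \<mu> x e"
      by blast
    then show "u + w \<in> ?W"
      using linear_on_add[OF contract_linear] linear_on_add[OF linear]
      by (auto intro!: bexI[of _ "d + e"] cvec.subspace_add subE subspace_X)
  next
    fix c w assume "w \<in> ?W"
    then obtain e where "w \<in> rspace X" "e \<in> rspace E"
      "\<forall>x\<in>tuples. contract F n D X \<xi> x n w = \<mu> x e"
      by blast
    then show "c *\<^sub>C w \<in> ?W"
      using linear_on_scale[OF contract_linear] linear_on_scale[OF linear]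
      by (auto intro!: bexI[of _ "c *\<^sub>C e"] cvec.subspace_scale subE subspace_X)
  qed
  moreover have "\<mu> v e \<in> ?W" if ve: "v \<in> tuples" "e \<in> rspace E" for v e
    using contract_mu[OF ve fr] ve linear_on_scale[OF linear ve(2)]
    by (auto simp: mu_in intro!: bexI[of _ "(\<Prod>i\<in>{1..n}. \<xi> i (v i)) *\<^sub>C e"] cvec.subspace_scale subE
        simp del: One_nat_def)
  ultimately have "w \<in> ?W" using assms(1) by (rule in_subspace)
  then show ?thesis by blast
qed

lemma dual_frame:
  obtains v0 \<xi> where "v0 \<in> tuples" "\<And>i. i \<in> {1..n} \<Longrightarrow> v0 i \<noteq> 0" "frame \<xi>"
    "\<And>i. i \<in> {1..n} \<Longrightarrow> \<xi> i (v0 i) = (1::complex)"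
proof -
  obtain d where d: "d \<in> rspace D" "d \<noteq> 0" using irreducible_rep_nonzero[OF D] .
  obtain B0 where B0: "finite B0" "rspace D = cvec.span B0" using is_repD(1)[OF rep_D] by blast
  obtain \<xi> :: "'d \<Rightarrow> complex" where "linear_on (rspace D) \<xi>" "\<xi> d = 1"
    using functional_nonzero[OF B0 d] .
  then show thesis using d by (intro that[of "\<lambda>i\<in>{1..n}. d" "\<lambda>_. \<xi>"]) auto
qed

lemma dual_frame_of:
  assumes "v \<in> tuples" "\<And>i. i \<in> {1..n} \<Longrightarrow> v i \<noteq> 0"
  obtains \<xi> where "frame \<xi>" "\<And>i. i \<in> {1..n} \<Longrightarrow> \<xi> i (v i) = (1::complex)"
proof -
  obtain B0 where B0: "finite B0" "rspace D = cvec.span B0" using is_repD(1)[OF rep_D] by blast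
  obtain \<xi> :: "nat \<Rightarrow> 'd \<Rightarrow> complex" where "\<And>i. i \<in> {1..n} \<Longrightarrow> linear_on (rspace D) (\<xi> i)"
    "\<And>i. i \<in> {1..n} \<Longrightarrow> \<xi> i (v i) = 1"
    using dual_functionals[OF B0, of "{1..n}" v] assms by (metis PiE_mem)
  then show thesis using that by blast
qed

lemma mu_eq_imp:
  assumes "e \<in> rspace E" "e' \<in> rspace E" "v \<in> tuples" "\<And>i. i \<in> {1..n} \<Longrightarrow> v i \<noteq> 0" "\<mu> v e = \<mu> v e'"
  shows "e = e'"
proof -
  have "\<mu> v (e - e') = 0"
    using assms by (simp add: linear_on_minus[OF linear is_repD(2)[OF E]])
  then have "e - e' = 0"
    using assms by (intro nondegenerate[of v]) (auto intro: cvec.subspace_diff is_repD(2)[OF E])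
  then show ?thesis by simp
qed

text \<open>Contracting a non-zero vector of \<open>W\<close> exhibits a non-zero \<open>e\<close>
  with every \<open>\<mu> x e\<close> in \<open>W\<close>. Such \<open>e\<close> form a
  subrepresentation of \<open>E\<close>, so irreducibility of \<open>E\<close> puts all of X into
  \<open>W\<close>.\<close>

lemma irreducible_X:
  assumes irr: "irreducible_rep (sym_group n) E"
  shows "irreducible_rep (wreath F n) X"
  unfolding irreducible_rep_def
proof (intro conjI allI impI)
  show "is_rep (wreath F n) X" by (rule is_rep_X)
  obtain v0 where v0: "v0 \<in> tuples" "\<And>i. i \<in> {1..n} \<Longrightarrow> v0 i \<noteq> 0" using dual_frame by metis
  obtain e where e: "e \<in> rspace E" "e \<noteq> 0" using irreducible_rep_nonzero[OF irr] .
  show "rspace X \<noteq> {0}" using nondegenerate[OF v0 e(1)] e(2) mu_in[OF v0(1) e(1)] by auto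
next
  fix W assume "cvec.subspace W \<and> W \<subseteq> rspace X \<and> (\<forall>g\<in>carrier (wreath F n). ract X g ` W \<subseteq> W)"
  then have W: "cvec.subspace W" "W \<subseteq> rspace X"
    and inv: "\<And>g w. g \<in> carrier (wreath F n) \<Longrightarrow> w \<in> W \<Longrightarrow> ract X g w \<in> W" by auto
  note subE = is_repD(2)[OF E]
  show "W = {0} \<or> W = rspace X"
  proof (cases "W = {0}")
    case False
    then obtain w where w: "w \<in> W" "w \<noteq> 0" using cvec.subspace_0[OF W(1)] by blast
    then have wX: "w \<in> rspace X" using W by blast
    obtain \<xi> x where \<xi>: "frame \<xi>" "x \<in> tuples" "contract F n D X \<xi> x n w \<noteq> 0"
      using contract_nonzero[OF wX w(2)] .
    obtain e where e: "e \<in> rspace E" "\<And>x. x \<in> tuples \<Longrightarrow> contract F n D X \<xi> x n w = \<mu> x e"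
      using contract_form[OF wX \<xi>(1)] by blast
    \<comment> \<open>All tuples are demanded at once because \<sigma> permutes the tuple along with
      acting on \<open>e\<close>; otherwise invariance would fail to follow.\<close>
    let ?E = "{e \<in> rspace E. \<forall>x\<in>tuples. \<mu> x e \<in> W}"
    have "\<mu> x e \<in> W" if "x \<in> tuples" for x
      using contract_in[OF F(1) W(1) inv w(1), where D = D and \<xi> = \<xi> and x = x and j = n] e(2)[OF that]
      by metis
    then have eE: "e \<in> ?E" using e(1) by blast
    have "e \<noteq> 0" using e(2)[OF \<xi>(2)] \<xi>(2,3) linear_on_0[OF linear subE] by auto
    moreover have "?E = {0} \<or> ?E = rspace E"
    proof (rule irreducible_repD(3)[OF irr])
      show "cvec.subspace ?E"
        using subE W(1) linear_on_0[OF linear subE]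
        unfolding cvec.subspace_def by (auto simp: linear_on_add[OF linear] linear_on_scale[OF linear])
      show "ract E \<sigma> e \<in> ?E" if \<sigma>: "\<sigma> \<in> carrier (sym_group n)" and e: "e \<in> ?E" for \<sigma> e
      proof -
        have "\<mu> x (ract E \<sigma> e) \<in> W" if x: "x \<in> tuples" for x
        proof -
          obtain v where v: "v \<in> tuples" "tuple_act n D (perm_embed F n \<sigma>) v = x"
            using tuple_act_perm_embed_surj[OF rep_D \<sigma> x] .
          then have "\<mu> x (ract E \<sigma> e) = ract X (perm_embed F n \<sigma>) (\<mu> v e)"
            using e \<sigma> by (simp add: act perm_embed_in[OF F(1)])
          then show ?thesis using inv[OF perm_embed_in[OF F(1) \<sigma>]] e v by auto
        qed
        then show ?thesis using e is_repD(3)[OF E \<sigma>] by auto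
      qed
    qed auto
    ultimately have "?E = rspace E" using eE by blast
    then have "rspace X \<subseteq> W"
      using in_subspace[OF W(1)] by blast
    then show ?thesis using W(2) by blast
  qed simp
qed

text \<open>Contracting with functionals dual to \<open>v\<close> and putting \<open>v\<close> back
  in place gives \<open>\<mu> v (\<kappa> w)\<close>; injectivity of \<open>\<mu> v\<close> makes
  \<kappa> linear. This left inverse of \<open>\<mu> v\<close> serves to pull forms on
  \<open>E\<close> back to X.\<close>

lemma contraction:
  assumes "v \<in> tuples" "\<And>i. i \<in> {1..n} \<Longrightarrow> v i \<noteq> 0"
  obtains \<kappa> where "linear_on (rspace X) \<kappa>" "\<And>w. w \<in> rspace X \<Longrightarrow> \<kappa> w \<in> rspace E"
    "\<And>e. e \<in> rspace E \<Longrightarrow> \<kappa> (\<mu> v e) = e"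
proof -
  obtain \<xi> where \<xi>: "frame \<xi>" "\<And>i. i \<in> {1..n} \<Longrightarrow> \<xi> i (v i) = (1::complex)"
    using dual_frame_of[OF assms] by metis
  have "\<forall>w\<in>rspace X. \<exists>e\<in>rspace E. contract F n D X \<xi> v n w = \<mu> v e"
    using contract_form[OF _ \<xi>(1)] assms(1) by blast
  then obtain \<kappa> where \<kappa>: "\<forall>w\<in>rspace X. \<kappa> w \<in> rspace E \<and> contract F n D X \<xi> v n w = \<mu> v (\<kappa> w)"
    by metis
  have eq: "\<kappa> w = e" if "w \<in> rspace X" "e \<in> rspace E" "contract F n D X \<xi> v n w = \<mu> v e" for w e
    using that \<kappa> by (intro mu_eq_imp[OF _ _ assms]) auto
  show thesis
  proof
    show "linear_on (rspace X) \<kappa>"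
    proof (rule linear_onI)
      show "\<kappa> (x + y) = \<kappa> x + \<kappa> y" if "x \<in> rspace X" "y \<in> rspace X" for x y
        using that \<kappa> assms(1)
        by (intro eq) (auto intro: cvec.subspace_add subspace_X is_repD(2)[OF E]
            simp: linear_on_add[OF contract_linear] linear_on_add[OF linear])
      show "\<kappa> (c *\<^sub>C x) = c *\<^sub>C \<kappa> x" if "x \<in> rspace X" for c x
        using that \<kappa> assms(1)
        by (intro eq) (auto intro: cvec.subspace_scale subspace_X is_repD(2)[OF E]
            simp: linear_on_scale[OF contract_linear] linear_on_scale[OF linear])
    qed
    show "\<kappa> w \<in> rspace E" if "w \<in> rspace X" for w using that \<kappa> by blast
    show "\<kappa> (\<mu> v e) = e" if "e \<in> rspace E" for e
      using that assms(1) contract_mu[OF assms(1) that \<xi>(1) assms(1)] \<xi>(2)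
      by (intro eq) (auto intro: mu_in simp del: One_nat_def)
  qed
qed

end

section \<open>Isomorphisms and direct sums\<close>

lemma iso_repE:
  assumes "iso_rep G R S"
  obtains T where "linear_on (rspace R) T" "bij_betw T (rspace R) (rspace S)"
    "\<And>g v. g \<in> carrier G \<Longrightarrow> v \<in> rspace R \<Longrightarrow> T (ract R g v) = ract S g (T v)"
  using assms unfolding iso_rep_def by metis

lemma iso_rep_sym:
  assumes "iso_rep G R S" "cvec.subspace (rspace R)"
    and closed: "\<And>g v. g \<in> carrier G \<Longrightarrow> v \<in> rspace R \<Longrightarrow> ract R g v \<in> rspace R"
  shows "iso_rep G S R"
proof -
  obtain T where T: "linear_on (rspace R) T" "bij_betw T (rspace R) (rspace S)"
    "\<And>g v. g \<in> carrier G \<Longrightarrow> v \<in> rspace R \<Longrightarrow> T (ract R g v) = ract S g (T v)"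
    using iso_repE[OF assms(1)] by metis
  let ?T = "the_inv_into (rspace R) T"
  have inj: "inj_on T (rspace R)" and im: "T ` rspace R = rspace S" using T(2) by (auto simp: bij_betw_def)
  have "?T (ract S g w) = ract R g (?T w)" if g: "g \<in> carrier G" and w: "w \<in> rspace S" for g w
  proof -
    obtain v where v: "v \<in> rspace R" "w = T v" using w im by blast
    then show ?thesis
      using T(3)[OF g v(1)] the_inv_into_f_f[OF inj] closed[OF g v(1)] by metis
  qed
  then show ?thesis
    unfolding iso_rep_def
    using linear_on_the_inv_into[OF T(1) assms(2) T(2)] bij_betw_the_inv_into[OF T(2)] by blast
qed

lemma iso_rep_trans:
  assumes "iso_rep G R S" "iso_rep G S Q"
  shows "iso_rep G R Q"
proof -
  obtain T where T: "linear_on (rspace R) T" "bij_betw T (rspace R) (rspace S)"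
    "\<And>g v. g \<in> carrier G \<Longrightarrow> v \<in> rspace R \<Longrightarrow> T (ract R g v) = ract S g (T v)"
    using iso_repE[OF assms(1)] by metis
  obtain T' where T': "linear_on (rspace S) T'" "bij_betw T' (rspace S) (rspace Q)"
    "\<And>g v. g \<in> carrier G \<Longrightarrow> v \<in> rspace S \<Longrightarrow> T' (ract S g v) = ract Q g (T' v)"
    using iso_repE[OF assms(2)] by metis
  have TS: "T ` rspace R \<subseteq> rspace S" using T(2) by (simp add: bij_betw_def)
  have "linear_on (rspace R) (T' \<circ> T)"
    using linear_on_compose[OF T(1) TS T'(1)] by (simp add: comp_def)
  moreover have "bij_betw (T' \<circ> T) (rspace R) (rspace Q)" using bij_betw_trans[OF T(2) T'(2)] .
  moreover have "(T' \<circ> T) (ract R g v) = ract Q g ((T' \<circ> T) v)" if "g \<in> carrier G" "v \<in> rspace R" for g v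
    using that T(3) T'(3)[OF that(1), of "T v"] TS by auto
  ultimately show ?thesis unfolding iso_rep_def by blast
qed

text \<open>The finite spanning set is carried back by the inverse intertwiner, and the group laws
  by injectivity. It serves for an induced representation, whose finite dimension is obtained from
  its decomposition.\<close>

lemma is_rep_iso:
  assumes iso: "iso_rep G R S" and S: "is_rep G S" and "group G"
    and sub: "cvec.subspace (rspace R)"
    and closed: "\<And>g v. g \<in> carrier G \<Longrightarrow> v \<in> rspace R \<Longrightarrow> ract R g v \<in> rspace R"
    and lin: "\<And>g. g \<in> carrier G \<Longrightarrow> linear_on (rspace R) (ract R g)"
  shows "is_rep G R"
proof -
  interpret group G by fact
  obtain T where T: "linear_on (rspace R) T" "bij_betw T (rspace R) (rspace S)"
    "\<And>g v. g \<in> carrier G \<Longrightarrow> v \<in> rspace R \<Longrightarrow> T (ract R g v) = ract S g (T v)"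
    using iso_repE[OF iso] by metis
  have inj: "inj_on T (rspace R)" and im: "T ` rspace R = rspace S" using T(2) by (auto simp: bij_betw_def)
  have TS: "T v \<in> rspace S" if "v \<in> rspace R" for v using that im by blast
  let ?T = "the_inv_into (rspace R) T"
  obtain B where B: "finite B" "rspace S = cvec.span B" using is_repD(1)[OF S] by blast
  have "linear_on (cvec.span B) ?T"
    using linear_on_the_inv_into[OF T(1) sub T(2)] B(2) by simp
  then have "cvec.span (?T ` B) = ?T ` rspace S"
    unfolding B(2) by (rule linear_on_span_image_eq[symmetric])
  also have "\<dots> = rspace R" using bij_betw_the_inv_into[OF T(2)] by (simp add: bij_betw_def)
  finally have ex: "\<exists>B. finite B \<and> rspace R = cvec.span B" using B(1) by blast
  have one: "ract R \<one>\<^bsub>G\<^esub> v = v" if "v \<in> rspace R" for v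
    using that by (intro inj_onD[OF inj]) (simp_all add: closed T(3) TS is_repD(5)[OF S])
  have mult: "ract R (g \<otimes>\<^bsub>G\<^esub> h) v = ract R g (ract R h v)"
    if "g \<in> carrier G" "h \<in> carrier G" "v \<in> rspace R" for g h v
    using that by (intro inj_onD[OF inj]) (simp_all add: closed T(3) TS is_repD(6)[OF S])
  show ?thesis unfolding is_rep_def using ex one mult closed lin by blast
qed

lemma irreducible_rep_iso:
  assumes iso: "iso_rep G R S" and S: "irreducible_rep G S" and R: "is_rep G R"
  shows "irreducible_rep G R"
  unfolding irreducible_rep_def
proof (intro conjI allI impI R)
  obtain T where T: "linear_on (rspace R) T" "bij_betw T (rspace R) (rspace S)"
    "\<And>g v. g \<in> carrier G \<Longrightarrow> v \<in> rspace R \<Longrightarrow> T (ract R g v) = ract S g (T v)"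
    using iso_repE[OF iso] by metis
  have inj: "inj_on T (rspace R)" and im: "T ` rspace R = rspace S" using T(2) by (auto simp: bij_betw_def)
  have sub: "cvec.subspace (rspace R)" using is_repD(2)[OF R] .
  have T0: "T 0 = 0" using linear_on_0[OF T(1) sub] .
  show "rspace R \<noteq> {0}" using im T0 irreducible_repD(2)[OF S] by auto
  fix W assume "cvec.subspace W \<and> W \<subseteq> rspace R \<and> (\<forall>g\<in>carrier G. ract R g ` W \<subseteq> W)"
  then have W: "cvec.subspace W" "W \<subseteq> rspace R" "\<And>g w. g \<in> carrier G \<Longrightarrow> w \<in> W \<Longrightarrow> ract R g w \<in> W"
    by auto
  have "T ` W = {0} \<or> T ` W = rspace S"
  proof (rule irreducible_repD(3)[OF S])
    show "cvec.subspace (T ` W)"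
      using linear_on_subspace_image[OF linear_on_subset[OF T(1) W(2)] W(1)] .
    show "T ` W \<subseteq> rspace S" using W(2) im by blast
    show "ract S g y \<in> T ` W" if g: "g \<in> carrier G" and y: "y \<in> T ` W" for g y
    proof -
      obtain w where w: "w \<in> W" "y = T w" using y by blast
      then have "ract S g y = T (ract R g w)" using T(3)[OF g] W(2) by auto
      then show ?thesis using W(3)[OF g w(1)] by blast
    qed
  qed
  moreover have "{0} \<subseteq> rspace R" using cvec.subspace_0[OF sub] by blast
  ultimately show "W = {0} \<or> W = rspace R"
    using inj_on_image_eq_iff[OF inj W(2), of "{0}"] inj_on_image_eq_iff[OF inj W(2) order_refl] im T0
    by auto
qed

section \<open>Direct sums and changes of ambient type\<close>

definition single :: "'i \<Rightarrow> 'v::zero \<Rightarrow> 'i \<Rightarrow> 'v" where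
  "single i a = (\<lambda>j. if j = i then a else 0)"

lemma single_apply [simp]: "single i a i = a" "j \<noteq> i \<Longrightarrow> single i a j = 0"
  by (simp_all add: single_def)

lemma single_linear: "linear_on V (single i)"
  by (rule linear_onI) (auto simp: single_def fun_eq_iff)

lemma sum_apply: "(\<Sum>i\<in>I. f i) x = (\<Sum>i\<in>I. (f i :: 'a \<Rightarrow> 'b::comm_monoid_add) x)"
  by (induction I rule: infinite_finite_induct) auto

lemma sum_single:
  fixes \<phi> :: "'i \<Rightarrow> 'v::comm_monoid_add"
  assumes "finite I" "\<And>i. i \<notin> I \<Longrightarrow> \<phi> i = 0"
  shows "(\<Sum>i\<in>I. single i (\<phi> i)) = \<phi>"
proof
  fix j
  have "(\<Sum>i\<in>I. single i (\<phi> i)) j = (\<Sum>i\<in>I. if i = j then \<phi> j else 0)"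
    unfolding sum_apply by (intro sum.cong) (auto simp: single_def)
  then show "(\<Sum>i\<in>I. single i (\<phi> i)) j = \<phi> j" using assms by simp
qed

lemma direct_sum_simps:
  "\<phi> \<in> rspace (direct_sum_rep I R) \<longleftrightarrow> (\<forall>i\<in>I. \<phi> i \<in> rspace (R i)) \<and> (\<forall>i. i \<notin> I \<longrightarrow> \<phi> i = 0)"
  "ract (direct_sum_rep I R) g \<phi> = (\<lambda>i. if i \<in> I then ract (R i) g (\<phi> i) else 0)"
  by (simp_all add: direct_sum_rep_def)

lemma subspace_direct_sum:
  "(\<And>i. i \<in> I \<Longrightarrow> cvec.subspace (rspace (R i))) \<Longrightarrow> cvec.subspace (rspace (direct_sum_rep I R))"
  unfolding cvec.subspace_def by (auto simp: direct_sum_simps)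

lemma direct_sum_span:
  assumes "finite I" "\<And>i. i \<in> I \<Longrightarrow> rspace (R i) = cvec.span (S i)"
  shows "rspace (direct_sum_rep I R) = cvec.span (\<Union>i\<in>I. single i ` S i)"
proof
  show "cvec.span (\<Union>i\<in>I. single i ` S i) \<subseteq> rspace (direct_sum_rep I R)"
    using assms(2)
    by (intro cvec.span_minimal subspace_direct_sum)
      (auto simp: direct_sum_simps single_def intro: cvec.span_base cvec.span_zero)
  show "rspace (direct_sum_rep I R) \<subseteq> cvec.span (\<Union>i\<in>I. single i ` S i)"
  proof
    fix \<phi> assume \<phi>: "\<phi> \<in> rspace (direct_sum_rep I R)"
    have "single i (\<phi> i) \<in> cvec.span (\<Union>i\<in>I. single i ` S i)" if i: "i \<in> I" for i
    proof -
      have "single i ` cvec.span (S i) \<subseteq> cvec.span (\<Union>i\<in>I. single i ` S i)"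
        using i by (intro linear_on_span_image single_linear) (auto intro: cvec.span_base)
      then show ?thesis using \<phi> i assms(2) by (auto simp: direct_sum_simps)
    qed
    then have "(\<Sum>i\<in>I. single i (\<phi> i)) \<in> cvec.span (\<Union>i\<in>I. single i ` S i)" by (rule cvec.span_sum)
    then show "\<phi> \<in> cvec.span (\<Union>i\<in>I. single i ` S i)"
      using \<phi> assms(1) by (simp add: sum_single direct_sum_simps)
  qed
qed

lemma direct_sum_act_linear:
  assumes "\<And>i. i \<in> I \<Longrightarrow> linear_on (rspace (R i)) (ract (R i) g)"
  shows "linear_on (rspace (direct_sum_rep I R)) (ract (direct_sum_rep I R) g)"
  by (rule linear_onI)
    (auto simp: direct_sum_simps fun_eq_iff linear_on_add[OF assms] linear_on_scale[OF assms])

lemma is_rep_direct_sum: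
  assumes "group G" "finite I" and R: "\<And>i. i \<in> I \<Longrightarrow> is_rep G (R i)"
  shows "is_rep G (direct_sum_rep I R)"
proof -
  have "\<forall>i\<in>I. \<exists>B. finite B \<and> rspace (R i) = cvec.span B" using is_repD(1)[OF R] by blast
  then obtain B where B: "\<forall>i\<in>I. finite (B i) \<and> rspace (R i) = cvec.span (B i)" by metis
  have "finite (\<Union>i\<in>I. single i ` B i)" using B assms(2) by simp
  moreover have "rspace (direct_sum_rep I R) = cvec.span (\<Union>i\<in>I. single i ` B i)"
    using B by (intro direct_sum_span assms) auto
  ultimately have ex: "\<exists>B. finite B \<and> rspace (direct_sum_rep I R) = cvec.span B" by blast
  have closed: "ract (direct_sum_rep I R) g \<phi> \<in> rspace (direct_sum_rep I R)"
    if "g \<in> carrier G" "\<phi> \<in> rspace (direct_sum_rep I R)" for g \<phi>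
    using that by (simp add: direct_sum_simps is_repD(3)[OF R])
  have one: "ract (direct_sum_rep I R) \<one>\<^bsub>G\<^esub> \<phi> = \<phi>" if "\<phi> \<in> rspace (direct_sum_rep I R)" for \<phi>
    using that by (auto simp: direct_sum_simps fun_eq_iff is_repD(5)[OF R])
  have mult: "ract (direct_sum_rep I R) (g \<otimes>\<^bsub>G\<^esub> h) \<phi> = ract (direct_sum_rep I R) g (ract (direct_sum_rep I R) h \<phi>)"
    if "g \<in> carrier G" "h \<in> carrier G" "\<phi> \<in> rspace (direct_sum_rep I R)" for g h \<phi>
    using that by (auto simp: direct_sum_simps fun_eq_iff is_repD(6)[OF R])
  have lin: "linear_on (rspace (direct_sum_rep I R)) (ract (direct_sum_rep I R) g)" if "g \<in> carrier G" for g
    using that by (intro direct_sum_act_linear is_repD(4)[OF R])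
  show ?thesis
    unfolding is_rep_def using ex closed one mult lin by blast
qed

lemma direct_sum_iso:
  assumes "\<And>i. i \<in> I \<Longrightarrow> iso_rep G (R i) (S i)"
  shows "iso_rep G (direct_sum_rep I R) (direct_sum_rep I S)"
proof -
  have "\<forall>i\<in>I. \<exists>T. linear_on (rspace (R i)) T \<and> bij_betw T (rspace (R i)) (rspace (S i)) \<and>
      (\<forall>g\<in>carrier G. \<forall>v\<in>rspace (R i). T (ract (R i) g v) = ract (S i) g (T v))"
    using assms unfolding iso_rep_def by blast
  then obtain T where T: "\<And>i. i \<in> I \<Longrightarrow> linear_on (rspace (R i)) (T i)"
    "\<And>i. i \<in> I \<Longrightarrow> bij_betw (T i) (rspace (R i)) (rspace (S i))"
    "\<And>i g v. i \<in> I \<Longrightarrow> g \<in> carrier G \<Longrightarrow> v \<in> rspace (R i) \<Longrightarrow> T i (ract (R i) g v) = ract (S i) g (T i v)"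
    by metis
  let ?R = "direct_sum_rep I R" and ?S = "direct_sum_rep I S"
  let ?T = "\<lambda>\<phi> i. if i \<in> I then T i (\<phi> i) else 0"
  let ?U = "\<lambda>\<psi> i. if i \<in> I then the_inv_into (rspace (R i)) (T i) (\<psi> i) else 0"
  have inv: "the_inv_into (rspace (R i)) (T i) (T i v) = v" "T i v \<in> rspace (S i)"
    if "i \<in> I" "v \<in> rspace (R i)" for i v
    using that T(2)[OF that(1)] by (auto simp: bij_betw_def the_inv_into_f_f)
  have inv': "T i (the_inv_into (rspace (R i)) (T i) v) = v" "the_inv_into (rspace (R i)) (T i) v \<in> rspace (R i)"
    if "i \<in> I" "v \<in> rspace (S i)" for i v
    using that T(2)[OF that(1)] f_the_inv_into_f_bij_betw[OF T(2)[OF that(1)], of v]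
      bij_betwE[OF bij_betw_the_inv_into[OF T(2)[OF that(1)]]] by auto
  show ?thesis
    unfolding iso_rep_def
  proof (intro exI conjI ballI)
    show "linear_on (rspace ?R) ?T"
      by (rule linear_onI)
        (auto simp: direct_sum_simps fun_eq_iff linear_on_add[OF T(1)] linear_on_scale[OF T(1)])
    show "bij_betw ?T (rspace ?R) (rspace ?S)"
      by (rule bij_betw_byWitness[where f' = ?U]) (auto simp: direct_sum_simps fun_eq_iff inv inv')
    show "?T (ract ?R g v) = ract ?S g (?T v)" if "g \<in> carrier G" "v \<in> rspace ?R" for g v
      using that by (auto simp: direct_sum_simps fun_eq_iff T(3))
  qed
qed

text \<open>\<open>multiplicity_free\<close> wants constituents in the ambient type of
  \<open>R\<close>, whereas the \<open>E i\<close> may live in another type. Their images under the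
  isomorphism from the direct sum are subrepresentations of \<open>R\<close> and take their
  place.\<close>

lemma multiplicity_free_transfer:
  fixes R :: "('g, 'v::complex_vector) repn" and E :: "nat \<Rightarrow> ('g, 'w::complex_vector) repn"
  assumes R: "is_rep G R" and "group G" and dec: "decomposes G R r (\<lambda>_. 1) E"
  shows "multiplicity_free G R"
proof -
  let ?I = "SIGMA i:{1..r}. {1..1::nat}"
  let ?S = "direct_sum_rep ?I (\<lambda>(i, j). E i)"
  have irr: "\<And>i. i \<in> {1..r} \<Longrightarrow> irreducible_rep G (E i)"
    and non: "\<And>i j. i \<in> {1..r} \<Longrightarrow> j \<in> {1..r} \<Longrightarrow> i \<noteq> j \<Longrightarrow> \<not> iso_rep G (E i) (E j)"
    and iso: "iso_rep G R ?S"
    using dec unfolding decomposes_def by blast+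
  have repE: "is_rep G (E i)" if "i \<in> {1..r}" for i using irreducible_repD(1)[OF irr[OF that]] .
  have iso': "iso_rep G ?S R"
    using iso_rep_sym[OF iso is_repD(2)[OF R] is_repD(3)[OF R]] .
  obtain T where T: "linear_on (rspace ?S) T" "bij_betw T (rspace ?S) (rspace R)"
    "\<And>g v. g \<in> carrier G \<Longrightarrow> v \<in> rspace ?S \<Longrightarrow> T (ract ?S g v) = ract R g (T v)"
    by (rule iso_repE[OF iso']) blast
  \<comment> \<open>The second index is 1 because all multiplicities are 1; \<open>\<iota> i\<close>
    embeds \<open>E i\<close> into \<open>R\<close> as one summand.\<close>
  define \<iota> where "\<iota> i e = T (single (i, 1::nat) e)" for i e
  have in_S: "single (i, 1::nat) e \<in> rspace ?S" if "i \<in> {1..r}" "e \<in> rspace (E i)" for i e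
    using that is_repD(2)[OF repE] by (auto simp: direct_sum_simps single_def cvec.subspace_0)
  have act_S: "ract ?S g (single (i, 1::nat) e) = single (i, 1) (ract (E i) g e)"
    if "i \<in> {1..r}" "g \<in> carrier G" for i g e
    using that linear_on_0[OF is_repD(4)[OF repE] is_repD(2)[OF repE]]
    by (auto simp: direct_sum_simps single_def fun_eq_iff)
  define E' where "E' i = \<lparr>rspace = \<iota> i ` rspace (E i), ract = ract R\<rparr>" for i
  have lin: "linear_on (rspace (E i)) (\<iota> i)" if "i \<in> {1..r}" for i
    unfolding \<iota>_def using in_S[OF that] by (intro linear_on_compose[OF single_linear _ T(1)]) blast
  have inj: "inj_on (\<iota> i) (rspace (E i))" if "i \<in> {1..r}" for i
  proof (rule inj_onI)
    fix x y assume "x \<in> rspace (E i)" "y \<in> rspace (E i)" "\<iota> i x = \<iota> i y"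
    then have "single (i, 1::nat) x = single (i, 1) y"
      using in_S[OF that] T(2) unfolding \<iota>_def by (meson bij_betw_imp_inj_on inj_onD)
    then show "x = y" by (metis single_apply(1))
  qed
  have iota_act: "\<iota> i (ract (E i) g e) = ract R g (\<iota> i e)"
    if "i \<in> {1..r}" "g \<in> carrier G" "e \<in> rspace (E i)" for i g e
    using T(3)[OF that(2) in_S[OF that(1,3)]] act_S[OF that(1,2)] by (simp add: \<iota>_def)
  have isoE: "iso_rep G (E i) (E' i)" if "i \<in> {1..r}" for i
    unfolding iso_rep_def E'_def using lin inj iota_act that
    by (intro exI[of _ "\<iota> i"]) (auto simp: bij_betw_def)
  have isoE': "iso_rep G (E' i) (E i)" if "i \<in> {1..r}" for i
    using iso_rep_sym[OF isoE is_repD(2)[OF repE] is_repD(3)[OF repE]] that by blast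
  have sub: "rspace (E' i) \<subseteq> rspace R" if "i \<in> {1..r}" for i
    using in_S[OF that] bij_betwE[OF T(2)] by (auto simp: E'_def \<iota>_def)
  have irrE': "irreducible_rep G (E' i)" if i: "i \<in> {1..r}" for i
  proof (rule irreducible_rep_iso[OF isoE'[OF i] irr[OF i]], rule is_rep_iso[OF isoE'[OF i] repE[OF i] \<open>group G\<close>])
    show "cvec.subspace (rspace (E' i))"
      using linear_on_subspace_image[OF lin[OF i] is_repD(2)[OF repE[OF i]]] by (simp add: E'_def)
    show "ract (E' i) g v \<in> rspace (E' i)" if "g \<in> carrier G" "v \<in> rspace (E' i)" for g v
      using that i is_repD(3)[OF repE] by (auto simp: E'_def simp flip: iota_act)
    show "linear_on (rspace (E' i)) (ract (E' i) g)" if "g \<in> carrier G" for g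
      using linear_on_subset[OF is_repD(4)[OF R that] sub[OF i]] by (simp add: E'_def)
  qed
  have "iso_rep G ?S (direct_sum_rep ?I (\<lambda>(i, j). E' i))"
    by (rule direct_sum_iso) (auto intro: isoE)
  then have "iso_rep G R (direct_sum_rep ?I (\<lambda>(i, j). E' i))" using iso_rep_trans[OF iso] by blast
  moreover have "\<not> iso_rep G (E' i) (E' j)" if "i \<in> {1..r}" "j \<in> {1..r}" "i \<noteq> j" for i j
    using non[OF that] iso_rep_trans[OF isoE iso_rep_trans[OF _ isoE']] that by blast
  ultimately have "decomposes G R r (\<lambda>_. 1) E'"
    unfolding decomposes_def using irrE' by blast
  then show ?thesis unfolding multiplicity_free_def by blast
qed

text \<open>\<open>R w y\<close> says that w and y have the same contractions, as vectors of
  \<open>E\<close>, along every frame. This relation is linear, contains all pairs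
  \<open>\<mu> v e\<close>, \<open>\<nu> v e\<close>, and relates 0 only to 0 in both directions, so
  it is the graph of an isomorphism.\<close>

lemma wreath_tensor_unique:
  assumes "wreath_tensor F n D X E \<mu>" "wreath_tensor F n D Y E \<nu>"
  shows "iso_rep (wreath F n) X Y"
proof -
  interpret X: wreath_tensor F n D X E \<mu> by fact
  interpret Y: wreath_tensor F n D Y E \<nu> by fact
  note subE = is_repD(2)[OF X.E]
  obtain v0 where v0: "v0 \<in> X.tuples" "\<And>i. i \<in> {1..n} \<Longrightarrow> v0 i \<noteq> 0" using X.dual_frame by metis
  define C where "C \<xi> w y e \<longleftrightarrow> e \<in> rspace E \<and> (\<forall>x\<in>X.tuples.
    contract F n D X \<xi> x n w = \<mu> x e \<and> contract F n D Y \<xi> x n y = \<nu> x e)" for \<xi> w y e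
  define R where "R w y \<longleftrightarrow> w \<in> rspace X \<and> y \<in> rspace Y \<and> (\<forall>\<xi>. X.frame \<xi> \<longrightarrow> (\<exists>e. C \<xi> w y e))"
    for w y
  have R_dest: "w \<in> rspace X" "y \<in> rspace Y" if "R w y" for w y using that by (simp_all add: R_def)
  have R_add: "R (w + w') (y + y')" if "R w y" "R w' y'" for w w' y y'
  proof -
    have "\<exists>e. C \<xi> (w + w') (y + y') e" if fr: "X.frame \<xi>" for \<xi>
    proof -
      obtain e e' where "C \<xi> w y e" "C \<xi> w' y' e'"
        using \<open>R w y\<close> \<open>R w' y'\<close> fr unfolding R_def by blast
      then have "C \<xi> (w + w') (y + y') (e + e')"
        using R_dest[OF \<open>R w y\<close>] R_dest[OF \<open>R w' y'\<close>] cvec.subspace_add[OF subE]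
        by (simp add: C_def linear_on_add[OF X.contract_linear] linear_on_add[OF Y.contract_linear]
            linear_on_add[OF X.linear] linear_on_add[OF Y.linear] del: One_nat_def)
      then show ?thesis by blast
    qed
    then show ?thesis
      using R_dest[OF \<open>R w y\<close>] R_dest[OF \<open>R w' y'\<close>] cvec.subspace_add[OF X.subspace_X]
        cvec.subspace_add[OF Y.subspace_X]
      unfolding R_def by blast
  qed
  have R_scale: "R (c *\<^sub>C w) (c *\<^sub>C y)" if "R w y" for c w y
  proof -
    have "\<exists>e. C \<xi> (c *\<^sub>C w) (c *\<^sub>C y) e" if fr: "X.frame \<xi>" for \<xi>
    proof -
      obtain e where "C \<xi> w y e" using \<open>R w y\<close> fr unfolding R_def by blast
      then have "C \<xi> (c *\<^sub>C w) (c *\<^sub>C y) (c *\<^sub>C e)"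
        using R_dest[OF \<open>R w y\<close>] cvec.subspace_scale[OF subE]
        by (simp add: C_def linear_on_scale[OF X.contract_linear] linear_on_scale[OF Y.contract_linear]
            linear_on_scale[OF X.linear] linear_on_scale[OF Y.linear] del: One_nat_def)
      then show ?thesis by blast
    qed
    then show ?thesis
      using R_dest[OF that] cvec.subspace_scale[OF X.subspace_X] cvec.subspace_scale[OF Y.subspace_X]
      unfolding R_def by blast
  qed
  have R_mu: "R (\<mu> v e) (\<nu> v e)" if ve: "v \<in> X.tuples" "e \<in> rspace E" for v e
  proof -
    have "C \<xi> (\<mu> v e) (\<nu> v e) ((\<Prod>i\<in>{1..n}. \<xi> i (v i)) *\<^sub>C e)" if fr: "X.frame \<xi>" for \<xi>
      using X.contract_mu[OF ve fr] Y.contract_mu[OF ve fr] linear_on_scale[OF X.linear ve(2)]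
        linear_on_scale[OF Y.linear ve(2)] cvec.subspace_scale[OF subE ve(2)]
      by (simp add: C_def del: One_nat_def)
    then show ?thesis using X.mu_in[OF ve] Y.mu_in[OF ve] unfolding R_def by blast
  qed
  \<comment> \<open>A non-zero y would have a non-zero contraction \<open>\<nu> x e\<close>. The
    same \<open>e\<close> describes the contraction of 0 in X, so \<open>\<mu> v0 e = 0\<close>, and
    non-degeneracy gives \<open>e = 0\<close>.\<close>
  have R_left: "y = 0" if R0: "R 0 y" for y
  proof (rule ccontr)
    assume "y \<noteq> 0"
    then obtain \<xi> x where \<xi>: "X.frame \<xi>" "x \<in> X.tuples" "contract F n D Y \<xi> x n y \<noteq> 0"
      using Y.contract_nonzero[OF R_dest(2)[OF R0]] by blast
    obtain e where e: "C \<xi> 0 y e" using R0 \<xi>(1) unfolding R_def by blast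
    then have eE: "e \<in> rspace E" by (simp add: C_def)
    have "\<mu> v0 e = contract F n D X \<xi> v0 n 0" using e v0(1) by (simp add: C_def)
    also have "\<dots> = 0" by (rule linear_on_0[OF X.contract_linear X.subspace_X])
    finally have "e = 0" using X.nondegenerate[OF v0 eE] by blast
    moreover have "contract F n D Y \<xi> x n y = \<nu> x e" using e \<xi>(2) by (simp add: C_def)
    ultimately show False using \<xi>(3) linear_on_0[OF Y.linear[OF \<xi>(2)] subE] by simp
  qed
  have R_right: "w = 0" if R0: "R w 0" for w
  proof (rule ccontr)
    assume "w \<noteq> 0"
    then obtain \<xi> x where \<xi>: "X.frame \<xi>" "x \<in> X.tuples" "contract F n D X \<xi> x n w \<noteq> 0"
      using X.contract_nonzero[OF R_dest(1)[OF R0]] by blast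
    obtain e where e: "C \<xi> w 0 e" using R0 \<xi>(1) unfolding R_def by blast
    then have eE: "e \<in> rspace E" by (simp add: C_def)
    have "\<nu> v0 e = contract F n D Y \<xi> v0 n 0" using e v0(1) by (simp add: C_def)
    also have "\<dots> = 0" by (rule linear_on_0[OF Y.contract_linear Y.subspace_X])
    finally have "e = 0" using Y.nondegenerate[OF v0 eE] by blast
    moreover have "contract F n D X \<xi> x n w = \<mu> x e" using e \<xi>(2) by (simp add: C_def)
    ultimately show False using \<xi>(3) linear_on_0[OF X.linear[OF \<xi>(2)] subE] by simp
  qed
  have R_total: "\<exists>y. R w y" if w: "w \<in> rspace X" for w
  proof -
    have R00: "R 0 0"
      using R_scale[OF R_mu[OF v0(1) cvec.subspace_0[OF subE]], of 0] by simp
    have "cvec.subspace {w. \<exists>y. R w y}"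
    proof (rule cvec.subspaceI)
      show "0 \<in> {w. \<exists>y. R w y}" using R00 by blast
      show "w + w' \<in> {w. \<exists>y. R w y}" if ww': "w \<in> {w. \<exists>y. R w y}" "w' \<in> {w. \<exists>y. R w y}" for w w'
      proof -
        obtain y y' where "R w y" "R w' y'" using ww' by blast
        from R_add[OF this] show ?thesis by blast
      qed
      show "c *\<^sub>C w \<in> {w. \<exists>y. R w y}" if cw: "w \<in> {w. \<exists>y. R w y}" for c w
      proof -
        obtain y where "R w y" using cw by blast
        from R_scale[OF this] show ?thesis by blast
      qed
    qed
    then have "w \<in> {w. \<exists>y. R w y}" by (rule X.in_subspace[OF _ _ w]) (use R_mu in blast)
    then show ?thesis by simp
  qed
  obtain T where T: "linear_on (rspace X) T" "\<And>w y. w \<in> rspace X \<Longrightarrow> R w y \<longleftrightarrow> y = T w"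
    using linear_relation_graph[where R = R, OF X.subspace_X R_add R_scale R_total R_left] by blast
  have T_mu: "T (\<mu> v e) = \<nu> v e" if "v \<in> X.tuples" "e \<in> rspace E" for v e
    using T(2)[OF X.mu_in[OF that]] R_mu[OF that] by simp
  have TY: "T ` rspace X \<subseteq> rspace Y" using T(2) unfolding R_def by blast
  have "w = 0" if "w \<in> rspace X" "T w = 0" for w
    using T(2)[OF that(1), of 0] that(2) R_right by simp
  then have "inj_on T (rspace X)" by (rule linear_on_inj_on[OF T(1) X.subspace_X])
  moreover have "\<nu> v e \<in> T ` rspace X" if "v \<in> X.tuples" "e \<in> rspace E" for v e
    using T_mu[OF that] X.mu_in[OF that] by (intro image_eqI[of _ _ "\<mu> v e"]) auto
  then have "rspace Y \<subseteq> T ` rspace X"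
    using Y.in_subspace[OF linear_on_subspace_image[OF T(1) X.subspace_X]] by blast
  ultimately have bij: "bij_betw T (rspace X) (rspace Y)" using TY by (auto simp: bij_betw_def)
  have "T (ract X g w) = ract Y g (T w)" if g: "g \<in> carrier (wreath F n)" and w: "w \<in> rspace X" for g w
  proof (rule X.linear_eq[OF _ _ _ w])
    show "linear_on (rspace X) (\<lambda>w. T (ract X g w))"
      using X.act_in[OF g] by (intro linear_on_compose[OF X.act_linear[OF g] _ T(1)]) blast
    show "linear_on (rspace X) (\<lambda>w. ract Y g (T w))"
      by (rule linear_on_compose[OF T(1) TY Y.act_linear[OF g]])
    show "T (ract X g (\<mu> v e)) = ract Y g (T (\<mu> v e))" if "v \<in> X.tuples" "e \<in> rspace E" for v e
      using that by (simp add: T_mu X.act[OF g] Y.act[OF g] tuple_act_in[OF X.rep_D g]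
          is_repD(3)[OF X.E snd_wreath_in[OF g]] del: One_nat_def)
  qed
  then show ?thesis unfolding iso_rep_def using T(1) bij by blast
qed

text \<open>An intertwiner commutes with contractions, and \<open>\<mu> x e\<close> is a contraction
  of \<open>\<mu> v0 e\<close>. Hence its image has the form \<open>\<nu> x e'\<close> with
  \<open>e'\<close> independent of \<open>x\<close>, and sending \<open>e\<close> to
  \<open>e'\<close> is the isomorphism. In contraposition, it keeps the constituents of A pairwise
  non-isomorphic.\<close>

lemma wreath_tensor_iso_imp:
  assumes "wreath_tensor F n D X E \<mu>" "wreath_tensor F n D Y E' \<nu>" and iso: "iso_rep (wreath F n) X Y"
  shows "iso_rep (sym_group n) E E'"
proof -
  interpret X: wreath_tensor F n D X E \<mu> by fact
  interpret Y: wreath_tensor F n D Y E' \<nu> by fact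
  note subE = is_repD(2)[OF X.E] and subE' = is_repD(2)[OF Y.E]
  obtain T where T: "linear_on (rspace X) T" "bij_betw T (rspace X) (rspace Y)"
    "\<And>g v. g \<in> carrier (wreath F n) \<Longrightarrow> v \<in> rspace X \<Longrightarrow> T (ract X g v) = ract Y g (T v)"
    using iso_repE[OF iso] by metis
  have inj: "inj_on T (rspace X)" and im: "T ` rspace X = rspace Y" using T(2) by (auto simp: bij_betw_def)
  have TY: "T w \<in> rspace Y" if "w \<in> rspace X" for w using that im by blast
  obtain v0 \<xi> where v0: "v0 \<in> X.tuples" "\<And>i. i \<in> {1..n} \<Longrightarrow> v0 i \<noteq> 0" "X.frame \<xi>"
    "\<And>i. i \<in> {1..n} \<Longrightarrow> \<xi> i (v0 i) = (1::complex)"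
    using X.dual_frame by metis
  have prod1: "(\<Prod>i\<in>{1..n}. \<xi> i (v0 i)) = 1" using v0(4) by (intro prod.neutral) blast
  have con: "T (contract F n D X \<xi> x n w) = contract F n D Y \<xi> x n (T w)" if "w \<in> rspace X" for w x
    using contract_commute[OF X.F(1) X.subspace_X X.act_in T(1,3) that] .
  have "\<exists>e'\<in>rspace E'. \<forall>x\<in>X.tuples. T (\<mu> x e) = \<nu> x e'" if e: "e \<in> rspace E" for e
  proof -
    have "T (\<mu> x e) = contract F n D Y \<xi> x n (T (\<mu> v0 e))" if "x \<in> X.tuples" for x
      using con[OF X.mu_in[OF v0(1) e], of x] X.contract_mu[OF v0(1) e v0(3) that] prod1 by simp
    then show ?thesis
      using Y.contract_form[OF TY[OF X.mu_in[OF v0(1) e]] v0(3)] by simp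
  qed
  then obtain \<tau> where \<tau>: "\<And>e. e \<in> rspace E \<Longrightarrow> \<tau> e \<in> rspace E'"
    "\<And>e x. e \<in> rspace E \<Longrightarrow> x \<in> X.tuples \<Longrightarrow> T (\<mu> x e) = \<nu> x (\<tau> e)"
    by metis
  have \<tau>_eq: "\<tau> e = e'" if "e \<in> rspace E" "e' \<in> rspace E'" "T (\<mu> v0 e) = \<nu> v0 e'" for e e'
    using that \<tau> v0 by (intro Y.mu_eq_imp[OF _ _ v0(1,2)]) auto
  have "linear_on (rspace E) \<tau>"
  proof (rule linear_onI)
    show "\<tau> (x + y) = \<tau> x + \<tau> y" if "x \<in> rspace E" "y \<in> rspace E" for x y
      using that \<tau> v0(1)
      by (intro \<tau>_eq) (simp_all add: cvec.subspace_add subE subE' linear_on_add[OF X.linear]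
          linear_on_add[OF Y.linear] linear_on_add[OF T(1)] X.mu_in del: One_nat_def)
    show "\<tau> (c *\<^sub>C x) = c *\<^sub>C \<tau> x" if "x \<in> rspace E" for c x
      using that \<tau> v0(1)
      by (intro \<tau>_eq) (simp_all add: cvec.subspace_scale subE subE' linear_on_scale[OF X.linear]
          linear_on_scale[OF Y.linear] linear_on_scale[OF T(1)] X.mu_in del: One_nat_def)
  qed
  moreover have "inj_on \<tau> (rspace E)"
  proof (rule inj_onI)
    fix e d assume ed: "e \<in> rspace E" "d \<in> rspace E" "\<tau> e = \<tau> d"
    then have "T (\<mu> v0 e) = T (\<mu> v0 d)" using \<tau>(2) v0(1) by simp
    then have "\<mu> v0 e = \<mu> v0 d" using inj_onD[OF inj] X.mu_in v0(1) ed by blast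
    then show "e = d" using X.mu_eq_imp[OF ed(1,2) v0(1,2)] by simp
  qed
  \<comment> \<open>A preimage of \<open>\<nu> v0 e'\<close> is brought into the form
    \<open>\<mu> v0 e\<close> by contracting along \<xi> and reinserting \<open>v0\<close>. The
    image is unchanged, since each \<open>\<xi> i\<close> is 1 on \<open>v0 i\<close>.\<close>
  moreover have "e' \<in> \<tau> ` rspace E" if e': "e' \<in> rspace E'" for e'
  proof -
    have "\<nu> v0 e' \<in> T ` rspace X" unfolding im by (rule Y.mu_in[OF v0(1) e'])
    then obtain w where w: "w \<in> rspace X" "T w = \<nu> v0 e'" by (metis imageE)
    obtain e where e: "e \<in> rspace E" "contract F n D X \<xi> v0 n w = \<mu> v0 e"
      using X.contract_form[OF w(1) v0(3)] v0(1) by blast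
    have "T (\<mu> v0 e) = contract F n D Y \<xi> v0 n (\<nu> v0 e')"
      using con[OF w(1), of v0] e(2) w(2) by simp
    also have "\<dots> = \<nu> v0 e'" using Y.contract_mu[OF v0(1) e' v0(3,1)] prod1 by simp
    finally show ?thesis using \<tau>_eq[OF e(1) e'] e(1) by blast
  qed
  ultimately have lin: "linear_on (rspace E) \<tau>" and bij: "bij_betw \<tau> (rspace E) (rspace E')"
    using \<tau>(1) by (auto simp: bij_betw_def)
  have "\<tau> (ract E \<sigma> e) = ract E' \<sigma> (\<tau> e)" if \<sigma>: "\<sigma> \<in> carrier (sym_group n)" and e: "e \<in> rspace E" for \<sigma> e
  proof -
    let ?g = "perm_embed F n \<sigma>"
    have g: "?g \<in> carrier (wreath F n)" using perm_embed_in[OF X.F(1) \<sigma>] .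
    \<comment> \<open>Moving \<open>v0\<close> back by \<sigma> lets both sides be compared at
      \<open>v0\<close>, where \<tau> is determined.\<close>
    obtain v where v: "v \<in> X.tuples" "tuple_act n D ?g v = v0"
      using tuple_act_perm_embed_surj[OF X.rep_D \<sigma> v0(1)] .
    have "T (\<mu> v0 (ract E \<sigma> e)) = T (ract X ?g (\<mu> v e))" using X.act[OF g v(1) e] v(2) by simp
    also have "\<dots> = ract Y ?g (\<nu> v (\<tau> e))" using T(3)[OF g X.mu_in[OF v(1) e]] \<tau>(2)[OF e v(1)] by simp
    also have "\<dots> = \<nu> v0 (ract E' \<sigma> (\<tau> e))" using Y.act[OF g v(1) \<tau>(1)[OF e]] v(2) by simp
    finally show ?thesis
      using \<tau>_eq[OF is_repD(3)[OF X.E \<sigma> e] is_repD(3)[OF Y.E \<sigma> \<tau>(1)[OF e]]] by blast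
  qed
  then show ?thesis unfolding iso_rep_def using lin bij by blast
qed

text \<open>Precomposition of \<mu> with the isomorphism leaves X alone. In this way the sum of the
  \<open>(D; E i)\<close>, built over the sum of the \<open>E i\<close>, is viewed over
  \<open>U\<close>, as \<open>wreath_tensor_unique\<close> requires.\<close>

lemma wreath_tensor_transport:
  assumes "wreath_tensor F n D X E \<mu>" and E': "is_rep (sym_group n) E'" and iso: "iso_rep (sym_group n) E' E"
  shows "\<exists>\<nu>. wreath_tensor F n D X E' \<nu>"
proof -
  interpret X: wreath_tensor F n D X E \<mu> by fact
  obtain T where T: "linear_on (rspace E') T" "bij_betw T (rspace E') (rspace E)"
    "\<And>g v. g \<in> carrier (sym_group n) \<Longrightarrow> v \<in> rspace E' \<Longrightarrow> T (ract E' g v) = ract E g (T v)"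
    using iso_repE[OF iso] by metis
  have inj: "inj_on T (rspace E')" and im: "T ` rspace E' = rspace E" using T(2) by (auto simp: bij_betw_def)
  have TE: "T e \<in> rspace E" if "e \<in> rspace E'" for e using that im by blast
  have "wreath_tensor F n D X E' (\<lambda>v e. \<mu> v (T e))"
  proof (rule wreath_tensor.intro, goal_cases)
    case 5
    have "{\<mu> v (T e) | v e. v \<in> X.tuples \<and> e \<in> rspace E'} = {\<mu> v e | v e. v \<in> X.tuples \<and> e \<in> rspace E}"
      unfolding im[symmetric] by auto
    then show ?case by (simp only: X.space)
  next
    case (7 g v e)
    then show ?case using X.act[OF 7(1,2) TE[OF 7(3)]] T(3)[OF snd_wreath_in[OF 7(1)] 7(3)] by simp
  next
    case (8 v e i)
    then show ?case using X.multilinear[OF 8(1) TE[OF 8(2)] 8(3)] by simp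
  next
    case (9 v)
    then show ?case
      using TE by (intro linear_on_compose[OF T(1) _ X.linear]) auto
  next
    case (10 v e)
    have "T e = 0" using X.nondegenerate[OF 10(1,2) TE[OF 10(3)] 10(4)] .
    then show ?case
      using inj_onD[OF inj, of e 0] 10(3) linear_on_0[OF T(1)] is_repD(2)[OF E'] cvec.subspace_0 by metis
  qed (use X.F X.D E' X.act_linear in auto)
  then show ?thesis by blast
qed

text \<open>Tensoring with the n-th power of D distributes over direct sums: the summands share the
  tuple \<open>v\<close>, and only the second argument splits into components.\<close>

lemma wreath_tensor_direct_sum:
  assumes F: "group F" "finite (carrier F)" "irreducible_rep F D" and I: "finite I"
    and X: "\<And>i. i \<in> I \<Longrightarrow> wreath_tensor F n D (X i) (E i) (\<mu> i)"
  shows "wreath_tensor F n D (direct_sum_rep I X) (direct_sum_rep I E)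
    (\<lambda>v u i. if i \<in> I then \<mu> i v (u i) else 0)"
proof (rule wreath_tensor.intro, goal_cases)
  case 4
  show ?case using I wreath_tensor.E[OF X] by (intro is_rep_direct_sum sym_group_is_group)
next
  case 5
  let ?T = "{1..n} \<rightarrow>\<^sub>E rspace D"
  let ?m = "\<lambda>v u i. if i \<in> I then \<mu> i v (u i) else 0"
  let ?S = "\<lambda>i. {\<mu> i v e | v e. v \<in> ?T \<and> e \<in> rspace (E i)}"
  note zero = cvec.subspace_0[OF is_repD(2)[OF wreath_tensor.E[OF X]]]
    linear_on_0[OF wreath_tensor.linear[OF X] is_repD(2)[OF wreath_tensor.E[OF X]]]
  have "rspace (direct_sum_rep I X) = cvec.span (\<Union>i\<in>I. single i ` ?S i)"
    using wreath_tensor.space[OF X] by (intro direct_sum_span I) auto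
  also have "\<dots> \<subseteq> cvec.span {?m v u | v u. v \<in> ?T \<and> u \<in> rspace (direct_sum_rep I E)}"
  proof (rule cvec.span_mono, rule subsetI)
    fix \<phi> assume "\<phi> \<in> (\<Union>i\<in>I. single i ` ?S i)"
    then obtain i v e where i: "i \<in> I" "v \<in> ?T" "e \<in> rspace (E i)" "\<phi> = single i (\<mu> i v e)" by blast
    \<comment> \<open>Although \<open>v\<close> is shared, a generator of one summand is reached by
      a family supported at i, because the other components become
      \<open>\<mu> j v 0 = 0\<close>.\<close>
    have "\<phi> = ?m v (single i e)"
      using i zero(2)[OF _ i(2)] by (auto simp: single_def fun_eq_iff)
    moreover have "single i e \<in> rspace (direct_sum_rep I E)"
      using i zero(1) by (auto simp: direct_sum_simps single_def)
    ultimately show "\<phi> \<in> {?m v u | v u. v \<in> ?T \<and> u \<in> rspace (direct_sum_rep I E)}" using i(2) by blast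
  qed
  finally show ?case
    by (intro equalityI cvec.span_minimal subspace_direct_sum wreath_tensor.subspace_X[OF X])
      (auto simp: direct_sum_simps wreath_tensor.mu_in[OF X] simp del: One_nat_def)
next
  case (6 g)
  then show ?case by (intro direct_sum_act_linear wreath_tensor.act_linear[OF X])
next
  case (7 g v u)
  then show ?case by (auto simp: direct_sum_simps fun_eq_iff wreath_tensor.act[OF X] simp del: One_nat_def)
next
  case (8 v u i)
  have lin: "linear_on (rspace D) (\<lambda>x. \<mu> j (v(i := x)) (u j))" if "j \<in> I" for j
    using 8 that by (intro wreath_tensor.multilinear[OF X]) (auto simp: direct_sum_simps)
  show ?case
    using linear_on_add[OF lin] linear_on_scale[OF lin] by (intro linear_onI) (simp_all add: fun_eq_iff)
next
  case (9 v)
  then show ?case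
    by (intro linear_onI)
      (auto simp: direct_sum_simps fun_eq_iff linear_on_add[OF wreath_tensor.linear[OF X]]
        linear_on_scale[OF wreath_tensor.linear[OF X]] simp del: One_nat_def)
next
  case (10 v u)
  have "u i = 0" for i
  proof (cases "i \<in> I")
    case True
    have "\<mu> i v (u i) = 0" using fun_cong[OF 10(4), of i] True by simp
    then show ?thesis
      using 10(3) True by (intro wreath_tensor.nondegenerate[OF X[OF True] 10(1,2)]) (auto simp: direct_sum_simps)
  qed (use 10(3) in \<open>auto simp: direct_sum_simps\<close>)
  then show ?case by auto
qed (use F in auto)

section \<open>Tensor products\<close>

lemma bilinear_formsD:
  assumes "B \<in> bilinear_forms V W"
  shows "y \<in> W \<Longrightarrow> linear_on V (\<lambda>x. B x y)" "x \<in> V \<Longrightarrow> linear_on W (B x)"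
  using assms by (auto simp: bilinear_forms_def)

lemma bilinear_formsI:
  assumes "\<And>y. y \<in> W \<Longrightarrow> linear_on V (\<lambda>x. B x y)" "\<And>x. x \<in> V \<Longrightarrow> linear_on W (B x)"
  shows "B \<in> bilinear_forms V W"
  using assms by (simp add: bilinear_forms_def)

lemma pure_tensor_linear_left:
  "y \<in> W \<Longrightarrow> linear_on V (\<lambda>x. pure_tensor V W x y)"
  by (rule linear_onI)
    (auto simp: pure_tensor_def fun_eq_iff linear_on_add[OF bilinear_formsD(1)] linear_on_scale[OF bilinear_formsD(1)])

lemma pure_tensor_linear_right:
  "x \<in> V \<Longrightarrow> linear_on W (pure_tensor V W x)"
  by (rule linear_onI)
    (auto simp: pure_tensor_def fun_eq_iff linear_on_add[OF bilinear_formsD(2)] linear_on_scale[OF bilinear_formsD(2)])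

lemma outer_tensor_space:
  "rspace (R \<boxtimes> S) = cvec.span {pure_tensor (rspace R) (rspace S) x y | x y. x \<in> rspace R \<and> y \<in> rspace S}"
  by (simp add: outer_tensor_def)

lemma outer_tensor_span:
  assumes R: "rspace R = cvec.span A" and S: "rspace S = cvec.span B"
  shows "rspace (R \<boxtimes> S) = cvec.span {pure_tensor (rspace R) (rspace S) x y | x y. x \<in> A \<and> y \<in> B}"
    (is "_ = cvec.span ?P")
proof
  let ?p = "pure_tensor (rspace R) (rspace S)"
  have sub: "A \<subseteq> rspace R" "B \<subseteq> rspace S" using R S by (auto intro: cvec.span_base)
  show "cvec.span ?P \<subseteq> rspace (R \<boxtimes> S)"
    unfolding outer_tensor_space using sub by (intro cvec.span_mono) blast
  have 1: "?p x ` cvec.span B \<subseteq> cvec.span ?P" if "x \<in> A" for x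
    using that sub pure_tensor_linear_right[of x "rspace R" "rspace S"] S
    by (intro linear_on_span_image) (auto intro!: cvec.span_base)
  have "(\<lambda>x. ?p x y) ` cvec.span A \<subseteq> cvec.span ?P" if "y \<in> rspace S" for y
    using 1 that pure_tensor_linear_left[OF that, of "rspace R"] R S
    by (intro linear_on_span_image) auto
  then show "rspace (R \<boxtimes> S) \<subseteq> cvec.span ?P"
    unfolding outer_tensor_space by (intro cvec.span_minimal) (auto simp: R)
qed

text \<open>The action precomposes a functional with a fixed map of forms, which is linear on the
  whole ambient type; so \<open>V\<close> is arbitrary.\<close>

lemma outer_tensor_act_linear: "linear_on V (ract (R \<boxtimes> S) g)"
  by (rule linear_onI) (auto simp: outer_tensor_def fun_eq_iff split: prod.splits)

lemma pure_tensor_in: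
  "x \<in> rspace R \<Longrightarrow> y \<in> rspace S \<Longrightarrow> pure_tensor (rspace R) (rspace S) x y \<in> rspace (R \<boxtimes> S)"
  unfolding outer_tensor_space by (blast intro: cvec.span_base)

lemma outer_tensor_eqI:
  assumes "linear_on (rspace (R \<boxtimes> S)) f" "linear_on (rspace (R \<boxtimes> S)) h"
    "\<And>x y. x \<in> rspace R \<Longrightarrow> y \<in> rspace S \<Longrightarrow>
      f (pure_tensor (rspace R) (rspace S) x y) = h (pure_tensor (rspace R) (rspace S) x y)"
    "t \<in> rspace (R \<boxtimes> S)"
  shows "f t = h t"
  using assms unfolding outer_tensor_space by (elim linear_on_eq_span) auto

text \<open>Elements of the model are total functions. With this default value, equality has to be
  tested on bilinear forms only.\<close>

lemma outer_tensor_outside: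
  assumes "t \<in> rspace (R \<boxtimes> S)" "B \<notin> bilinear_forms (rspace R) (rspace S)"
  shows "t B = 0"
  by (rule outer_tensor_eqI[OF _ _ _ assms(1), where f = "\<lambda>t. t B" and h = "\<lambda>_. 0"])
    (use assms(2) in \<open>auto intro: linear_onI simp: pure_tensor_def\<close>)

lemma is_rep_outer_tensor:
  assumes R: "is_rep G R" and S: "is_rep H S" and GH: "group G" "group H"
  shows "is_rep (G \<times>\<times> H) (R \<boxtimes> S)"
proof -
  interpret G: group G by fact
  interpret H: group H by fact
  let ?p = "pure_tensor (rspace R) (rspace S)"
  have carr: "carrier (G \<times>\<times> H) = carrier G \<times> carrier H" by (simp add: DirProd_def)
  obtain A where A: "finite A" "rspace R = cvec.span A" using is_repD(1)[OF R] by blast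
  obtain B where B: "finite B" "rspace S = cvec.span B" using is_repD(1)[OF S] by blast
  have "{?p x y | x y. x \<in> A \<and> y \<in> B} = (\<lambda>(x, y). ?p x y) ` (A \<times> B)" by auto
  then have "finite {?p x y | x y. x \<in> A \<and> y \<in> B}" using A B by simp
  then have ex: "\<exists>B. finite B \<and> rspace (R \<boxtimes> S) = cvec.span B"
    using outer_tensor_span[OF A(2) B(2)] by blast
  have act: "ract (R \<boxtimes> S) (g, h) (?p x y) = ?p (ract R g x) (ract S h y)"
    if "g \<in> carrier G" "h \<in> carrier H" for g h x y
    using outer_tensor_pure[OF R S that] .
  have closed: "ract (R \<boxtimes> S) z ` rspace (R \<boxtimes> S) \<subseteq> rspace (R \<boxtimes> S)"
    if z: "z \<in> carrier (G \<times>\<times> H)" for z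
  proof -
    obtain g h where "z = (g, h)" "g \<in> carrier G" "h \<in> carrier H" using z carr by auto
    then show ?thesis
      unfolding outer_tensor_space[of R S]
      by (intro linear_on_span_image outer_tensor_act_linear)
        (auto simp: act intro!: cvec.span_base is_repD(3)[OF R] is_repD(3)[OF S], metis is_repD(3)[OF R] is_repD(3)[OF S])
  qed
  have one: "ract (R \<boxtimes> S) \<one>\<^bsub>G \<times>\<times> H\<^esub> t = t" if "t \<in> rspace (R \<boxtimes> S)" for t
    by (rule outer_tensor_eqI[OF outer_tensor_act_linear _ _ that])
      (auto intro: linear_onI simp: act is_repD(5)[OF R] is_repD(5)[OF S])
  have mult: "ract (R \<boxtimes> S) (z \<otimes>\<^bsub>G \<times>\<times> H\<^esub> z') t = ract (R \<boxtimes> S) z (ract (R \<boxtimes> S) z' t)"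
    if z: "z \<in> carrier (G \<times>\<times> H)" "z' \<in> carrier (G \<times>\<times> H)" and t: "t \<in> rspace (R \<boxtimes> S)" for z z' t
  proof (rule outer_tensor_eqI[OF outer_tensor_act_linear _ _ t])
    show "linear_on (rspace (R \<boxtimes> S)) (\<lambda>t. ract (R \<boxtimes> S) z (ract (R \<boxtimes> S) z' t))"
      by (rule linear_on_compose[OF outer_tensor_act_linear subset_UNIV outer_tensor_act_linear])
    obtain g h g' h' where zs: "z = (g, h)" "z' = (g', h')" "g \<in> carrier G" "h \<in> carrier H"
      "g' \<in> carrier G" "h' \<in> carrier H" using z carr by auto
    show "ract (R \<boxtimes> S) (z \<otimes>\<^bsub>G \<times>\<times> H\<^esub> z') (?p x y) = ract (R \<boxtimes> S) z (ract (R \<boxtimes> S) z' (?p x y))"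
      if "x \<in> rspace R" "y \<in> rspace S" for x y
      using zs that by (simp add: act is_repD(6)[OF R] is_repD(6)[OF S])
  qed
  have ract_in: "ract (R \<boxtimes> S) z t \<in> rspace (R \<boxtimes> S)"
    if "z \<in> carrier (G \<times>\<times> H)" "t \<in> rspace (R \<boxtimes> S)" for z t
    using closed[OF that(1)] that(2) by blast
  show ?thesis
    by (rule is_repI[OF ex ract_in outer_tensor_act_linear one mult])
qed

lemma pullback_rep_simps [simp]:
  "rspace (pullback_rep \<theta> R) = rspace R" "ract (pullback_rep \<theta> R) g = ract R (\<theta> g)"
  by (simp_all add: pullback_rep_def)

lemma is_rep_pullback:
  assumes "group_hom G H \<theta>" "is_rep H R"
  shows "is_rep G (pullback_rep \<theta> R)"
proof -
  interpret group_hom G H \<theta> by fact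
  show ?thesis
    using assms(2) hom_closed hom_one hom_mult unfolding is_rep_def by simp
qed

section \<open>The representation \<open>(D; E)\<close>\<close>

lemma multilinear_formsD:
  "B \<in> multilinear_forms m V \<Longrightarrow> v \<in> {1..m} \<rightarrow>\<^sub>E V \<Longrightarrow> i \<in> {1..m} \<Longrightarrow> linear_on V (\<lambda>x. B (v(i := x)))"
  unfolding multilinear_forms_def by blast

text \<open>These products are the test forms that show a pure tensor with non-zero entries to be
  non-zero.\<close>

lemma prod_functionals_multilinear:
  assumes "\<And>i. i \<in> {1..m} \<Longrightarrow> linear_on V (\<xi> i)"
  shows "(\<lambda>w. \<Prod>i\<in>{1..m}. \<xi> i (w i)) \<in> multilinear_forms m V"
  unfolding multilinear_forms_def mem_Collect_eq
proof (intro ballI)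
  fix v i assume i: "i \<in> {1..m}"
  have "(\<Prod>j\<in>{1..m}. \<xi> j ((v(i := x)) j)) = \<xi> i x * (\<Prod>j\<in>{1..m} - {i}. \<xi> j (v j))" for x
    using i by (subst prod.remove[OF _ i]) (auto intro!: prod.cong)
  then show "linear_on V (\<lambda>x. \<Prod>j\<in>{1..m}. \<xi> j ((v(i := x)) j))"
    using linear_on_add[OF assms[OF i]] linear_on_scale[OF assms[OF i]]
    by (intro linear_onI) (simp_all add: distrib_right mult.assoc del: fun_upd_apply)
qed

lemma pure_power_multilinear:
  assumes "v \<in> {1..m} \<rightarrow>\<^sub>E V" "i \<in> {1..m}"
  shows "linear_on V (\<lambda>x. pure_power m V (v(i := x)))"
  using linear_on_add[OF multilinear_formsD[OF _ assms]] linear_on_scale[OF multilinear_formsD[OF _ assms]]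
  by (intro linear_onI) (auto simp: pure_power_def fun_eq_iff)

text \<open>The tensor power corresponds to the trivial one-dimensional representation of S_n, whose
  vectors are the scalars \<open>c\<close>. Its representation laws and dual frames then come from
  the locale.\<close>

lemma wreath_tensor_power:
  fixes D :: "('f, 'd::complex_vector) repn"
  assumes F: "group F" "finite (carrier F)" "irreducible_rep F D"
  shows "wreath_tensor F n D (tensor_power n D) \<lparr>rspace = (UNIV :: complex set), ract = (\<lambda>\<sigma> c. c)\<rparr>
    (\<lambda>v c. c *\<^sub>C pure_power n (rspace D) v)"
proof (rule wreath_tensor.intro, goal_cases)
  case 4
  have "(x::complex) \<in> cvec.span {1}" for x
    using cvec.span_scale[OF cvec.span_base, of "1::complex" "{1}" x] by simp
  then have "(UNIV :: complex set) = cvec.span {1}" by blast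
  then have "\<exists>B. finite B \<and> (UNIV :: complex set) = cvec.span B" by blast
  then show ?case by (auto simp: is_rep_def linear_on_def)
next
  case 5
  let ?S = "{c *\<^sub>C pure_power n (rspace D) v | v c. v \<in> {1..n} \<rightarrow>\<^sub>E rspace D \<and> c \<in> (UNIV :: complex set)}"
  have "pure_power n (rspace D) v \<in> ?S" if "v \<in> {1..n} \<rightarrow>\<^sub>E rspace D" for v
    using that by (intro CollectI exI[of _ v] exI[of _ 1]) simp
  then have "cvec.span (pure_power n (rspace D) ` ({1..n} \<rightarrow>\<^sub>E rspace D)) = cvec.span ?S"
    by (intro equalityI cvec.span_mono cvec.span_minimal) (auto intro: cvec.span_scale cvec.span_base)
  then show ?case by (simp add: tensor_power_def)
next
  case (6 g)
  then show ?case
    by (intro linear_onI) (auto simp: tensor_power_def fun_eq_iff split: prod.splits)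
next
  case (7 g v c)
  obtain f \<pi> where g: "g = (f, \<pi>)" "f \<in> {1..n} \<rightarrow>\<^sub>E carrier F" "\<pi> permutes {1..n}"
    using 7(1) by (auto simp: wreath_simps sym_group_carrier)
  have lin: "linear_on UNIV (ract (tensor_power n D) g)"
    by (intro linear_onI) (auto simp: tensor_power_def fun_eq_iff split: prod.splits)
  show ?case
    using tensor_power_pure[OF irreducible_repD(1)[OF F(3)] g(2,3), of v] linear_on_scale[OF lin]
    by (simp add: g(1) tuple_act_def)
next
  case (8 v c i)
  then show ?case
    using linear_on_add[OF pure_power_multilinear[OF 8(1,3)]] linear_on_scale[OF pure_power_multilinear[OF 8(1,3)]]
    by (intro linear_onI) (simp_all add: cvec.scale_right_distrib mult.commute)
next
  case (9 v)
  then show ?case by (intro linear_onI) (simp_all add: cvec.scale_left_distrib)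
next
  case (10 v c)
  obtain B0 where B0: "finite B0" "rspace D = cvec.span B0"
    using is_repD(1)[OF irreducible_repD(1)[OF F(3)]] by blast
  obtain \<xi> :: "nat \<Rightarrow> 'd \<Rightarrow> complex" where \<xi>: "\<And>i. i \<in> {1..n} \<Longrightarrow> linear_on (rspace D) (\<xi> i)"
    "\<And>i. i \<in> {1..n} \<Longrightarrow> \<xi> i (v i) = 1"
    using dual_functionals[OF B0, of "{1..n}" v] 10(1,2) by (metis PiE_mem)
  let ?B = "\<lambda>w. \<Prod>i\<in>{1..n}. \<xi> i (w i)"
  have "?B v = 1" using \<xi>(2) by (intro prod.neutral) blast
  moreover have "(c *\<^sub>C pure_power n (rspace D) v) ?B = 0" by (simp only: 10(4) zero_fun_apply)
  ultimately show ?case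
    using prod_functionals_multilinear[OF \<xi>(1)] by (simp add: pure_power_def)
qed (use F in auto)

text \<open>Pure tensors serve as \<mu>. Non-degeneracy is seen by evaluating at the product of a
  multilinear form, dual to the entries of v, and a functional on \<open>E\<close>.\<close>

lemma wreath_tensor_wreath_rep:
  fixes D :: "('f, 'd::complex_vector) repn" and E :: "(nat \<Rightarrow> nat, 'e::complex_vector) repn"
  assumes F: "group F" "finite (carrier F)" "irreducible_rep F D" and E: "is_rep (sym_group n) E"
  shows "wreath_tensor F n D (wreath_rep n D E) E
    (\<lambda>v e. pure_tensor (rspace (tensor_power n D)) (rspace E) (pure_power n (rspace D) v) e)"
proof -
  let ?P = "tensor_power n D" and ?E = "pullback_rep snd E :: ((nat \<Rightarrow> 'f) \<times> (nat \<Rightarrow> nat), 'e) repn"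
  let ?pp = "pure_power n (rspace D)" and ?pt = "pure_tensor (rspace (tensor_power n D)) (rspace E)"
  interpret P: wreath_tensor F n D ?P "\<lparr>rspace = (UNIV :: complex set), ract = (\<lambda>\<sigma> c. c)\<rparr>"
    "\<lambda>v c. c *\<^sub>C ?pp v"
    by (rule wreath_tensor_power[OF F])
  have pp: "?pp v \<in> rspace ?P" if "v \<in> P.tuples" for v
    using P.mu_in[OF that, of 1] by simp
  have repE: "is_rep (wreath F n) ?E"
    by (rule is_rep_pullback[OF snd_wreath_hom[OF F(1)] E])
  have rsp: "rspace (wreath_rep n D E) = rspace (?P \<boxtimes> ?E)"
    by (simp add: wreath_rep_def inner_tensor_def)
  have ract: "ract (wreath_rep n D E) g = ract (?P \<boxtimes> ?E) (g, g)" for g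
    by (simp add: wreath_rep_def inner_tensor_def)
  show ?thesis
  proof (rule wreath_tensor.intro, goal_cases)
    case 5
    have "rspace ?P = cvec.span (?pp ` P.tuples)" by (simp add: tensor_power_def)
    moreover have "rspace ?E = cvec.span (rspace E)"
      using is_repD(2)[OF E] by (simp add: cvec.span_eq_iff[symmetric] del: cvec.span_eq_iff)
    ultimately have "rspace (?P \<boxtimes> ?E) = cvec.span {?pt x y | x y. x \<in> ?pp ` P.tuples \<and> y \<in> rspace E}"
      using outer_tensor_span[of ?P _ ?E] by simp
    moreover have "{?pt x y | x y. x \<in> ?pp ` P.tuples \<and> y \<in> rspace E}
        = {?pt (?pp v) e | v e. v \<in> P.tuples \<and> e \<in> rspace E}" by blast
    ultimately show ?case by (simp only: rsp)
  next
    case (6 g)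
    show ?case unfolding ract by (rule outer_tensor_act_linear)
  next
    case (7 g v e)
    have "ract (?P \<boxtimes> ?E) (g, g) (?pt (?pp v) e) = ?pt (ract ?P g (?pp v)) (ract E (snd g) e)"
      using outer_tensor_pure[OF P.is_rep_X repE 7(1,1)] by simp
    also have "ract ?P g (?pp v) = ?pp (tuple_act n D g v)"
      using P.act[OF 7(1,2), of 1] by simp
    finally show ?case by (simp only: ract)
  next
    case (8 v e i)
    have "(\<lambda>x. ?pp (v(i := x))) ` rspace D \<subseteq> rspace ?P"
      using 8(1,3) pp by (auto simp: PiE_iff extensional_def simp del: One_nat_def atLeastAtMost_iff)
    then show ?case
      by (rule linear_on_compose[OF pure_power_multilinear[OF 8(1,3)] _ pure_tensor_linear_left[OF 8(2)]])
  next
    case (9 v)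
    then show ?case by (intro pure_tensor_linear_right pp)
  next
    case (10 v e)
    show ?case
    proof (rule ccontr)
      assume "e \<noteq> 0"
      obtain C0 where C0: "finite C0" "rspace E = cvec.span C0" using is_repD(1)[OF E] by blast
      obtain \<eta> :: "'e \<Rightarrow> complex" where \<eta>: "linear_on (rspace E) \<eta>" "\<eta> e = 1"
        using functional_nonzero[OF C0 10(3) \<open>e \<noteq> 0\<close>] .
      obtain \<xi> where \<xi>: "P.frame \<xi>" "\<And>i. i \<in> {1..n} \<Longrightarrow> \<xi> i (v i) = (1::complex)"
        using P.dual_frame_of[OF 10(1,2)] by metis
      let ?\<Xi> = "\<lambda>w. \<Prod>i\<in>{1..n}. \<xi> i (w i)"
      have "?\<Xi> v = 1" using \<xi>(2) by (intro prod.neutral) blast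
      moreover have "?\<Xi> \<in> multilinear_forms n (rspace D)"
        using \<xi>(1) by (intro prod_functionals_multilinear) blast
      ultimately have 1: "?pp v ?\<Xi> = 1" by (simp add: pure_power_def)
      \<comment> \<open>An element \<open>t\<close> of the tensor power is itself a functional on
        forms, so \<open>t ?\<Xi>\<close> is linear in \<open>t\<close> and \<open>?B\<close> is
        bilinear.\<close>
      let ?B = "\<lambda>t y. t ?\<Xi> * \<eta> y"
      have "?B \<in> bilinear_forms (rspace ?P) (rspace E)"
        by (intro bilinear_formsI linear_onI)
          (simp_all add: distrib_left distrib_right linear_on_add[OF \<eta>(1)] linear_on_scale[OF \<eta>(1)])
      then have "?pt (?pp v) e ?B = 1" using 1 \<eta>(2) by (simp add: pure_tensor_def)
      then show False using 10(4) by simp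
    qed
  qed (use F E in auto)
qed

section \<open>Induced representations\<close>

lemma induced_rep_simps:
  "\<phi> \<in> rspace (induced_rep G H R) \<longleftrightarrow> (\<forall>x\<in>carrier G. \<phi> x \<in> rspace R) \<and> (\<forall>x. x \<notin> carrier G \<longrightarrow> \<phi> x = 0) \<and>
     (\<forall>x\<in>carrier G. \<forall>h\<in>H. \<phi> (x \<otimes>\<^bsub>G\<^esub> h) = ract R (inv\<^bsub>G\<^esub> h) (\<phi> x))"
  "ract (induced_rep G H R) g \<phi> = (\<lambda>x. if x \<in> carrier G then \<phi> (inv\<^bsub>G\<^esub> g \<otimes>\<^bsub>G\<^esub> x) else 0)"
  by (simp_all add: induced_rep_def)

lemma induced_rep_act_linear: "linear_on V (ract (induced_rep G H R) g)"
  by (rule linear_onI) (auto simp: induced_rep_simps fun_eq_iff)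

text \<open>With induction seen as a tensor product over the group algebra of \<open>H\<close>, this
  is \<open>g \<otimes> y\<close>: a function supported on the coset g H, with value y at g.\<close>

definition coset_fun :: "('g, 'x) monoid_scheme \<Rightarrow> 'g set \<Rightarrow> ('g, 'v::complex_vector) repn \<Rightarrow> 'g \<Rightarrow> 'v \<Rightarrow> 'g \<Rightarrow> 'v" where
  "coset_fun G H R g y =
     (\<lambda>x. if x \<in> carrier G \<and> inv\<^bsub>G\<^esub> x \<otimes>\<^bsub>G\<^esub> g \<in> H then ract R (inv\<^bsub>G\<^esub> x \<otimes>\<^bsub>G\<^esub> g) y else 0)"

locale induction_data = group G for G :: "('g, 'x) monoid_scheme" (structure) +
  fixes H :: "'g set" and R :: "('g, 'v::complex_vector) repn"
  assumes H: "subgroup H G" and R: "is_rep (G\<lparr>carrier := H\<rparr>) R"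
begin

lemma HG: "h \<in> H \<Longrightarrow> h \<in> carrier G"
  using subgroup.mem_carrier[OF H] .

lemma R_in: "h \<in> H \<Longrightarrow> v \<in> rspace R \<Longrightarrow> ract R h v \<in> rspace R"
  using is_repD(3)[OF R] by simp

lemma R_linear: "h \<in> H \<Longrightarrow> linear_on (rspace R) (ract R h)"
  using is_repD(4)[OF R] by simp

lemma R_mult: "h \<in> H \<Longrightarrow> h' \<in> H \<Longrightarrow> v \<in> rspace R \<Longrightarrow> ract R (h \<otimes> h') v = ract R h (ract R h' v)"
  using is_repD(6)[OF R] by simp

lemma R_one: "v \<in> rspace R \<Longrightarrow> ract R \<one> v = v"
  using is_repD(5)[OF R] by simp

lemmas subspace_R = is_repD(2)[OF R]

lemma R_zero: "h \<in> H \<Longrightarrow> ract R h 0 = 0"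
  using linear_on_0[OF R_linear subspace_R] .

lemma subspace_induced: "cvec.subspace (rspace (induced_rep G H R))"
proof (rule cvec.subspaceI)
  show "0 \<in> rspace (induced_rep G H R)"
    using subspace_R R_zero H by (simp add: induced_rep_simps cvec.subspace_0 subgroup.m_inv_closed)
  show "\<phi> + \<psi> \<in> rspace (induced_rep G H R)"
    if "\<phi> \<in> rspace (induced_rep G H R)" "\<psi> \<in> rspace (induced_rep G H R)" for \<phi> \<psi>
    using that subspace_R H
    by (simp add: induced_rep_simps cvec.subspace_add subgroup.m_inv_closed linear_on_add[OF R_linear])
  show "c *\<^sub>C \<phi> \<in> rspace (induced_rep G H R)" if "\<phi> \<in> rspace (induced_rep G H R)" for c \<phi>
    using that subspace_R H
    by (simp add: induced_rep_simps cvec.subspace_scale subgroup.m_inv_closed linear_on_scale[OF R_linear])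
qed

lemma induced_act_in:
  assumes "g \<in> carrier G" "\<phi> \<in> rspace (induced_rep G H R)"
  shows "ract (induced_rep G H R) g \<phi> \<in> rspace (induced_rep G H R)"
  using assms by (simp add: induced_rep_simps HG m_assoc[symmetric])

lemma coset_fun_in:
  assumes g: "g \<in> carrier G" and y: "y \<in> rspace R"
  shows "coset_fun G H R g y \<in> rspace (induced_rep G H R)"
proof -
  have "coset_fun G H R g y (x \<otimes> h) = ract R (inv h) (coset_fun G H R g y x)"
    if x: "x \<in> carrier G" and h: "h \<in> H" for x h
  proof -
    have eq: "inv (x \<otimes> h) \<otimes> g = inv h \<otimes> (inv x \<otimes> g)"
      using x g HG[OF h] by (simp add: inv_mult_group m_assoc)
    have ih: "inv h \<in> H" using subgroup.m_inv_closed[OF H h] .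
    have "inv h \<otimes> (inv x \<otimes> g) \<in> H \<longleftrightarrow> inv x \<otimes> g \<in> H"
    proof
      assume "inv h \<otimes> (inv x \<otimes> g) \<in> H"
      then have "h \<otimes> (inv h \<otimes> (inv x \<otimes> g)) \<in> H" using subgroup.m_closed[OF H h] by blast
      then show "inv x \<otimes> g \<in> H" using x g HG[OF h] by (simp add: m_assoc[symmetric])
    qed (use subgroup.m_closed[OF H ih] in blast)
    then show ?thesis
      using x HG[OF h] R_mult[OF ih _ y] R_zero[OF ih] by (simp add: coset_fun_def eq)
  qed
  then show ?thesis
    using y R_in subspace_R by (auto simp: induced_rep_simps coset_fun_def cvec.subspace_0)
qed

lemma coset_fun_linear:
  "linear_on (rspace R) (coset_fun G H R g)"
  by (rule linear_onI)
    (auto simp: coset_fun_def fun_eq_iff linear_on_add[OF R_linear] linear_on_scale[OF R_linear])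

text \<open>Summing over the whole group avoids choosing coset representatives: at x every g in the
  coset x H contributes \<open>\<phi> x\<close>, and \<open>1 / card H\<close> corrects the
  count.\<close>

lemma induced_expansion:
  assumes fin: "finite (carrier G)" and \<phi>: "\<phi> \<in> rspace (induced_rep G H R)"
  shows "\<phi> = (\<Sum>g\<in>carrier G. (1 / of_nat (card H)) *\<^sub>C coset_fun G H R g (\<phi> g))"
proof
  fix x
  have finH: "finite H" using fin subgroup.subset[OF H] finite_subset by blast
  have cardH: "card H \<noteq> 0" using finH subgroup.one_closed[OF H] by auto
  show "\<phi> x = (\<Sum>g\<in>carrier G. (1 / of_nat (card H)) *\<^sub>C coset_fun G H R g (\<phi> g)) x"
  proof (cases "x \<in> carrier G")
    case True
    have val: "coset_fun G H R g (\<phi> g) x = (if g \<in> (\<lambda>h. x \<otimes> h) ` H then \<phi> x else 0)" if g: "g \<in> carrier G" for g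
    proof -
      have "g \<in> (\<lambda>h. x \<otimes> h) ` H \<longleftrightarrow> inv x \<otimes> g \<in> H"
      proof
        assume "inv x \<otimes> g \<in> H"
        moreover have "g = x \<otimes> (inv x \<otimes> g)" using True g by (simp add: m_assoc[symmetric])
        ultimately show "g \<in> (\<lambda>h. x \<otimes> h) ` H" by blast
      qed (use True HG in \<open>auto simp: m_assoc[symmetric]\<close>)
      moreover have "ract R (inv x \<otimes> g) (\<phi> g) = \<phi> x" if h: "inv x \<otimes> g \<in> H"
      proof -
        let ?h = "inv x \<otimes> g"
        have "\<phi> (x \<otimes> ?h) = ract R (inv ?h) (\<phi> x)" using \<phi> True h unfolding induced_rep_simps by blast
        moreover have "x \<otimes> ?h = g" using True g by (simp add: m_assoc[symmetric])
        ultimately have "\<phi> g = ract R (inv ?h) (\<phi> x)" by simp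
        then have "ract R ?h (\<phi> g) = ract R (?h \<otimes> inv ?h) (\<phi> x)"
          using R_mult[OF h subgroup.m_inv_closed[OF H h]] \<phi> True by (simp add: induced_rep_simps)
        also have "?h \<otimes> inv ?h = \<one>" using HG[OF h] by (rule r_inv)
        finally show ?thesis using R_one \<phi> True by (simp add: induced_rep_simps)
      qed
      ultimately show ?thesis using True by (simp add: coset_fun_def)
    qed
    have sub: "(\<lambda>h. x \<otimes> h) ` H \<subseteq> carrier G" using True HG by auto
    have "inj_on (\<lambda>h. x \<otimes> h) H" using True HG by (intro inj_onI) simp
    then have card: "card ((\<lambda>h. x \<otimes> h) ` H) = card H" by (rule card_image)
    have "(\<Sum>g\<in>carrier G. (1 / of_nat (card H)) *\<^sub>C coset_fun G H R g (\<phi> g)) x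
        = (\<Sum>g\<in>carrier G. if g \<in> (\<lambda>h. x \<otimes> h) ` H then (1 / of_nat (card H)) *\<^sub>C \<phi> x else 0)"
      unfolding sum_apply scaleC_fun_apply by (intro sum.cong refl) (simp add: val)
    also have "\<dots> = (\<Sum>g\<in>(\<lambda>h. x \<otimes> h) ` H. (1 / of_nat (card H)) *\<^sub>C \<phi> x)"
      using sub by (simp add: sum.If_cases[OF fin] Int_absorb1)
    also have "\<dots> = \<phi> x"
      unfolding cvec.sum_constant_scale card using cardH by (simp add: scaleC_one)
    finally show ?thesis by simp
  next
    case False
    then show ?thesis using \<phi> by (simp add: sum_apply coset_fun_def induced_rep_simps)
  qed
qed

end

section \<open>Young subgroups\<close>

lemma permutes_finiteI:
  assumes "finite S" "inj_on p S" "p ` S \<subseteq> S" "\<And>x. x \<notin> S \<Longrightarrow> p x = x"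
  shows "p permutes S"
  using assms endo_inj_surj[OF assms(1,3,2)] by (intro bij_imp_permutes) (auto simp: bij_betw_def)

lemma young_subgroupD:
  assumes "\<sigma> \<in> young_subgroup n k"
  shows "\<sigma> permutes {1..n}" "i \<in> {1..n - k} \<Longrightarrow> \<sigma> i \<in> {1..n - k}" "\<sigma> \<in> carrier (sym_group n)"
  using assms by (auto simp: young_subgroup_def sym_group_carrier)

text \<open>\<sigma> is injective and maps the first block onto itself, so no point of the second
  block can land there.\<close>

lemma young_subgroup_second_block:
  assumes "\<sigma> \<in> young_subgroup n k" "k \<le> n" "i \<in> {1..k}"
  shows "\<sigma> (n - k + i) \<in> {n - k + 1..n}"
proof -
  have p: "\<sigma> permutes {1..n}" and im: "\<sigma> ` {1..n - k} = {1..n - k}"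
    using assms(1) by (auto simp: young_subgroup_def sym_group_carrier)
  have "n - k + i \<in> {1..n}" using assms(2,3) by auto
  then have "\<sigma> (n - k + i) \<in> {1..n}" using permutes_in_image[OF p] by blast
  moreover have "\<sigma> (n - k + i) \<notin> {1..n - k}"
  proof
    assume "\<sigma> (n - k + i) \<in> {1..n - k}"
    then obtain j where j: "j \<in> {1..n - k}" "\<sigma> (n - k + i) = \<sigma> j" using im by (metis imageE)
    then have "n - k + i = j" using injD[OF permutes_inj[OF p]] by blast
    then show False using j(1) assms(3) by simp
  qed
  ultimately show ?thesis by auto
qed

lemma subgroup_young: "subgroup (young_subgroup n k) (sym_group n)"
proof -
  interpret S: group "sym_group n" by (rule sym_group_is_group)
  show ?thesis
  proof (rule S.subgroupI)
    show "young_subgroup n k \<subseteq> carrier (sym_group n)" by (auto simp: young_subgroup_def)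
    have "id \<in> young_subgroup n k" by (simp add: young_subgroup_def sym_group_carrier permutes_id)
    then show "young_subgroup n k \<noteq> {}" by blast
    show "inv\<^bsub>sym_group n\<^esub> \<sigma> \<in> young_subgroup n k" if s: "\<sigma> \<in> young_subgroup n k" for \<sigma>
    proof -
      have c: "\<sigma> \<in> carrier (sym_group n)" and im: "\<sigma> ` {1..n - k} = {1..n - k}"
        using s by (auto simp: young_subgroup_def)
      have "inv' \<sigma> ` \<sigma> ` {1..n - k} = {1..n - k}"
        using c permutes_inj[of \<sigma> "{1..n}"] by (simp only: sym_group_carrier image_inv_f_f)
      then show ?thesis
        using c im sym_group_inv_closed[OF c] by (simp add: young_subgroup_def)
    qed
    show "\<sigma> \<otimes>\<^bsub>sym_group n\<^esub> \<tau> \<in> young_subgroup n k"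
      if "\<sigma> \<in> young_subgroup n k" "\<tau> \<in> young_subgroup n k" for \<sigma> \<tau>
      using that S.m_closed[of \<sigma> \<tau>]
      by (simp only: young_subgroup_def mem_Collect_eq sym_group_mult image_comp[symmetric])
  qed
qed

lemma young_split_second:
  assumes "\<sigma> \<in> young_subgroup n k" "k \<le> n" "i \<in> {1..k}"
  shows "\<sigma> (n - k + i) = n - k + snd (young_split n k \<sigma>) i" "snd (young_split n k \<sigma>) i \<in> {1..k}"
  using young_subgroup_second_block[OF assms] assms(2,3) by (auto simp: young_split_def)

lemma young_split_permutes:
  assumes s: "\<sigma> \<in> young_subgroup n k" and "k \<le> n"
  shows "fst (young_split n k \<sigma>) permutes {1..n - k}" "snd (young_split n k \<sigma>) permutes {1..k}"
proof -
  have inj: "inj \<sigma>" using young_subgroupD(1)[OF s] by (rule permutes_inj)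
  show "fst (young_split n k \<sigma>) permutes {1..n - k}"
  proof (rule permutes_finiteI)
    show "inj_on (fst (young_split n k \<sigma>)) {1..n - k}"
      using injD[OF inj] by (intro inj_onI) (simp add: young_split_def del: One_nat_def atLeastAtMost_iff)
    show "fst (young_split n k \<sigma>) ` {1..n - k} \<subseteq> {1..n - k}"
      using young_subgroupD(2)[OF s] by (auto simp: young_split_def)
  qed (auto simp: young_split_def)
  show "snd (young_split n k \<sigma>) permutes {1..k}"
  proof (rule permutes_finiteI)
    show "inj_on (snd (young_split n k \<sigma>)) {1..k}"
    proof (rule inj_onI)
      fix i j assume ij: "i \<in> {1..k}" "j \<in> {1..k}" "snd (young_split n k \<sigma>) i = snd (young_split n k \<sigma>) j"
      then have "\<sigma> (n - k + i) = \<sigma> (n - k + j)"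
        using young_split_second(1)[OF assms] by simp
      then have "n - k + i = n - k + j" using injD[OF inj] by blast
      then show "i = j" by simp
    qed
    show "snd (young_split n k \<sigma>) ` {1..k} \<subseteq> {1..k}"
      using young_split_second(2)[OF assms] by blast
  qed (auto simp: young_split_def)
qed

text \<open>Wreath products act through inverse permutations, so cutting a tuple action into blocks
  requires the inverse of \<sigma> blockwise, with the second block renumbered by n - k.\<close>

lemma young_split_inv:
  assumes s: "\<sigma> \<in> young_subgroup n k" and "k \<le> n"
  shows "i \<in> {1..n - k} \<Longrightarrow> inv' \<sigma> i = inv' (fst (young_split n k \<sigma>)) i"
    "i \<in> {1..k} \<Longrightarrow> inv' \<sigma> (n - k + i) = n - k + inv' (snd (young_split n k \<sigma>)) i"
proof -
  note p = young_subgroupD(1)[OF s] and q = young_split_permutes[OF assms]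
  show "inv' \<sigma> i = inv' (fst (young_split n k \<sigma>)) i" if i: "i \<in> {1..n - k}"
  proof -
    let ?j = "inv' (fst (young_split n k \<sigma>)) i"
    have "?j \<in> {1..n - k}" using permutes_inv_in[OF q(1) i] .
    then have "\<sigma> ?j = fst (young_split n k \<sigma>) ?j" by (simp add: young_split_def)
    also have "\<dots> = i" using permutes_inverses(1)[OF q(1)] .
    finally show ?thesis using permutes_inv_eq[OF p] by blast
  qed
  show "inv' \<sigma> (n - k + i) = n - k + inv' (snd (young_split n k \<sigma>)) i" if i: "i \<in> {1..k}"
  proof -
    let ?j = "inv' (snd (young_split n k \<sigma>)) i"
    have "?j \<in> {1..k}" using permutes_inv_in[OF q(2) i] .
    then have "\<sigma> (n - k + ?j) = n - k + snd (young_split n k \<sigma>) ?j"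
      by (rule young_split_second(1)[OF assms])
    also have "snd (young_split n k \<sigma>) ?j = i" using permutes_inverses(1)[OF q(2)] .
    finally show ?thesis using permutes_inv_eq[OF p] by blast
  qed
qed

lemma young_split_comp:
  assumes s: "\<sigma> \<in> young_subgroup n k" "\<tau> \<in> young_subgroup n k" and "k \<le> n"
  shows "young_split n k (\<sigma> \<circ> \<tau>) =
    (fst (young_split n k \<sigma>) \<circ> fst (young_split n k \<tau>), snd (young_split n k \<sigma>) \<circ> snd (young_split n k \<tau>))"
proof (rule prod_eqI)
  show "fst (young_split n k (\<sigma> \<circ> \<tau>)) = fst (fst (young_split n k \<sigma>) \<circ> fst (young_split n k \<tau>), snd (young_split n k \<sigma>) \<circ> snd (young_split n k \<tau>))"
    using young_subgroupD(2)[OF s(2)] by (auto simp: young_split_def fun_eq_iff)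
  have "snd (young_split n k (\<sigma> \<circ> \<tau>)) i = snd (young_split n k \<sigma>) (snd (young_split n k \<tau>) i)" for i
  proof (cases "i \<in> {1..k}")
    case True
    note t = young_split_second[OF s(2) \<open>k \<le> n\<close> True]
    have "snd (young_split n k (\<sigma> \<circ> \<tau>)) i = \<sigma> (\<tau> (n - k + i)) - (n - k)"
      using True by (simp add: young_split_def)
    also have "\<dots> = \<sigma> (n - k + snd (young_split n k \<tau>) i) - (n - k)" by (simp only: t(1))
    finally have "snd (young_split n k (\<sigma> \<circ> \<tau>)) i = \<sigma> (n - k + snd (young_split n k \<tau>) i) - (n - k)" .
    then show ?thesis using young_split_second(1)[OF s(1) \<open>k \<le> n\<close> t(2)] by simp
  next
    case False
    then show ?thesis by (auto simp: young_split_def)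
  qed
  then show "snd (young_split n k (\<sigma> \<circ> \<tau>)) = snd (fst (young_split n k \<sigma>) \<circ> fst (young_split n k \<tau>), snd (young_split n k \<sigma>) \<circ> snd (young_split n k \<tau>))"
    by auto
qed

lemma group_hom_young_split:
  assumes "k \<le> n"
  shows "group_hom (sym_group n\<lparr>carrier := young_subgroup n k\<rparr>) (sym_group (n - k) \<times>\<times> sym_group k) (young_split n k)"
proof (intro group_hom.intro group_hom_axioms.intro)
  show "group (sym_group n\<lparr>carrier := young_subgroup n k\<rparr>)"
    using group.subgroup_imp_group[OF sym_group_is_group subgroup_young] .
  show "group (sym_group (n - k) \<times>\<times> sym_group k)"
    by (intro DirProd_group sym_group_is_group)
  show "young_split n k \<in> hom (sym_group n\<lparr>carrier := young_subgroup n k\<rparr>) (sym_group (n - k) \<times>\<times> sym_group k)"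
    using young_split_permutes[OF _ assms] young_split_comp[OF _ _ assms]
    by (auto simp: hom_def DirProd_def sym_group_carrier sym_group_mult mem_Times_iff split: prod.splits)
qed

lemma wreath_youngD:
  assumes "h \<in> wreath_young_subgroup F n k"
  shows "h \<in> carrier (wreath F n)" "snd h \<in> young_subgroup n k"
  using assms by (auto simp: wreath_young_subgroup_def wreath_simps young_subgroup_def)

text \<open>As a preimage under the homomorphism \<open>snd\<close>, the subgroup inherits its
  closure properties from the Young subgroup.\<close>

lemma wreath_young_iff:
  "h \<in> wreath_young_subgroup F n k \<longleftrightarrow> h \<in> carrier (wreath F n) \<and> snd h \<in> young_subgroup n k"
  by (auto simp: wreath_young_subgroup_def wreath_simps young_subgroup_def)

lemma subgroup_wreath_young:
  assumes "group F"
  shows "subgroup (wreath_young_subgroup F n k) (wreath F n)"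
proof -
  interpret p: group_hom "wreath F n" "sym_group n" snd by (rule snd_wreath_hom[OF assms])
  note Y = subgroup_young[of n k]
  show ?thesis
  proof (rule p.G.subgroupI)
    show "wreath_young_subgroup F n k \<subseteq> carrier (wreath F n)" by (auto simp: wreath_young_iff)
    have "\<one>\<^bsub>wreath F n\<^esub> \<in> wreath_young_subgroup F n k"
      using subgroup.one_closed[OF Y] by (simp add: wreath_young_iff)
    then show "wreath_young_subgroup F n k \<noteq> {}" by blast
    show "inv\<^bsub>wreath F n\<^esub> h \<in> wreath_young_subgroup F n k" if "h \<in> wreath_young_subgroup F n k" for h
      using that subgroup.m_inv_closed[OF Y] p.hom_inv[of h]
      by (simp add: wreath_young_iff del: sym_group_inv_equality)
    show "g \<otimes>\<^bsub>wreath F n\<^esub> h \<in> wreath_young_subgroup F n k"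
      if "g \<in> wreath_young_subgroup F n k" "h \<in> wreath_young_subgroup F n k" for g h
      using that subgroup.m_closed[OF Y] by (simp add: wreath_young_iff)
  qed
qed

section \<open>Cutting tuples and wreath elements into two blocks\<close>

definition first_block :: "nat \<Rightarrow> nat \<Rightarrow> (nat \<Rightarrow> 'a) \<Rightarrow> nat \<Rightarrow> 'a" where
  "first_block n k v = (\<lambda>i\<in>{1..n - k}. v i)"

definition second_block :: "nat \<Rightarrow> nat \<Rightarrow> (nat \<Rightarrow> 'a) \<Rightarrow> nat \<Rightarrow> 'a" where
  "second_block n k v = (\<lambda>i\<in>{1..k}. v (n - k + i))"

lemma wreath_young_split_eq:
  "wreath_young_split n k h =
    ((first_block n k (fst h), fst (young_split n k (snd h))), (second_block n k (fst h), snd (young_split n k (snd h))))"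
  by (cases h) (simp add: wreath_young_split_def first_block_def second_block_def)

lemma blocks_in:
  assumes "v \<in> {1..n} \<rightarrow>\<^sub>E A" "k \<le> n"
  shows "first_block n k v \<in> {1..n - k} \<rightarrow>\<^sub>E A" "second_block n k v \<in> {1..k} \<rightarrow>\<^sub>E A"
proof -
  have "i \<in> {1..n}" if "i \<in> {1..n - k}" for i using that by auto
  then show "first_block n k v \<in> {1..n - k} \<rightarrow>\<^sub>E A"
    using assms(1) by (simp add: first_block_def PiE_iff del: One_nat_def atLeastAtMost_iff)
  have "n - k + i \<in> {1..n}" if "i \<in> {1..k}" for i using that assms(2) by auto
  then show "second_block n k v \<in> {1..k} \<rightarrow>\<^sub>E A"
    using assms(1) by (simp add: second_block_def PiE_iff del: One_nat_def atLeastAtMost_iff)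
qed

lemma wreath_young_split_in:
  assumes "h \<in> wreath_young_subgroup F n k" "k \<le> n"
  shows "fst (wreath_young_split n k h) \<in> carrier (wreath F (n - k))"
    "snd (wreath_young_split n k h) \<in> carrier (wreath F k)"
proof -
  have "fst h \<in> {1..n} \<rightarrow>\<^sub>E carrier F" using assms(1) by (auto simp: wreath_young_subgroup_def)
  note b = blocks_in[OF this assms(2)] and s = young_split_permutes[OF wreath_youngD(2)[OF assms(1)] assms(2)]
  show "fst (wreath_young_split n k h) \<in> carrier (wreath F (n - k))"
    "snd (wreath_young_split n k h) \<in> carrier (wreath F k)"
    using b s by (simp_all add: wreath_young_split_eq wreath_simps sym_group_carrier del: One_nat_def)
qed

text \<open>A Young permutation does not mix the blocks, so this reduces to
  \<open>young_split_inv\<close>; the equivariance \<open>merge_act\<close> rests on it.\<close>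

lemma blocks_tuple_act:
  assumes "h \<in> wreath_young_subgroup F n k" "k \<le> n"
  shows "first_block n k (tuple_act n D h v) = tuple_act (n - k) D (fst (wreath_young_split n k h)) (first_block n k v)"
    "second_block n k (tuple_act n D h v) = tuple_act k D (snd (wreath_young_split n k h)) (second_block n k v)"
proof -
  note y = wreath_youngD(2)[OF assms(1)]
  note q = young_split_permutes[OF y assms(2)]
  have sub: "i \<in> {1..n}" if "i \<in> {1..n - k}" for i using that by auto
  have sub': "n - k + i \<in> {1..n}" if "i \<in> {1..k}" for i using that assms(2) by auto
  show "first_block n k (tuple_act n D h v) = tuple_act (n - k) D (fst (wreath_young_split n k h)) (first_block n k v)"
    using young_split_inv(1)[OF y assms(2)] permutes_inv_in[OF q(1)] sub
    by (auto simp: first_block_def tuple_act_def wreath_young_split_eq fun_eq_iff restrict_def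
        simp del: One_nat_def atLeastAtMost_iff)
  show "second_block n k (tuple_act n D h v) = tuple_act k D (snd (wreath_young_split n k h)) (second_block n k v)"
    using young_split_inv(2)[OF y assms(2)] permutes_inv_in[OF q(2)] sub'
    by (auto simp: second_block_def tuple_act_def wreath_young_split_eq fun_eq_iff restrict_def
        simp del: One_nat_def atLeastAtMost_iff)
qed

lemma group_hom_wreath_young_split:
  assumes "group F" "k \<le> n"
  shows "group_hom (wreath F n\<lparr>carrier := wreath_young_subgroup F n k\<rparr>) (wreath F (n - k) \<times>\<times> wreath F k)
    (wreath_young_split n k)"
proof (intro group_hom.intro group_hom_axioms.intro)
  show "group (wreath F n\<lparr>carrier := wreath_young_subgroup F n k\<rparr>)"
    using group.subgroup_imp_group[OF group_wreath[OF assms(1)] subgroup_wreath_young[OF assms(1)]] .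
  show "group (wreath F (n - k) \<times>\<times> wreath F k)"
    by (intro DirProd_group group_wreath assms)
  have mult: "wreath_young_split n k (g \<otimes>\<^bsub>wreath F n\<^esub> h) =
      (fst (wreath_young_split n k g) \<otimes>\<^bsub>wreath F (n - k)\<^esub> fst (wreath_young_split n k h),
       snd (wreath_young_split n k g) \<otimes>\<^bsub>wreath F k\<^esub> snd (wreath_young_split n k h))"
    if g: "g \<in> wreath_young_subgroup F n k" and h: "h \<in> wreath_young_subgroup F n k" for g h
  proof -
    note y = wreath_youngD(2)[OF g] and y' = wreath_youngD(2)[OF h]
    note q = young_split_permutes[OF y assms(2)]
    have sub: "i \<in> {1..n}" if "i \<in> {1..n - k}" for i using that by auto
    have sub': "n - k + i \<in> {1..n}" if "i \<in> {1..k}" for i using that assms(2) by auto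
    obtain f \<sigma> f' \<sigma>' where gh: "g = (f, \<sigma>)" "h = (f', \<sigma>')" by (metis surj_pair)
    have "first_block n k (\<lambda>i\<in>{1..n}. f i \<otimes>\<^bsub>F\<^esub> f' (inv' \<sigma> i)) =
        (\<lambda>i\<in>{1..n - k}. first_block n k f i \<otimes>\<^bsub>F\<^esub> first_block n k f' (inv' (fst (young_split n k \<sigma>)) i))"
      using young_split_inv(1)[OF y assms(2)] permutes_inv_in[OF q(1)] sub
      by (auto simp: first_block_def gh fun_eq_iff restrict_def simp del: One_nat_def atLeastAtMost_iff)
    moreover have "second_block n k (\<lambda>i\<in>{1..n}. f i \<otimes>\<^bsub>F\<^esub> f' (inv' \<sigma> i)) =
        (\<lambda>i\<in>{1..k}. second_block n k f i \<otimes>\<^bsub>F\<^esub> second_block n k f' (inv' (snd (young_split n k \<sigma>)) i))"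
      using young_split_inv(2)[OF y assms(2)] permutes_inv_in[OF q(2)] sub'
      by (auto simp: second_block_def gh fun_eq_iff restrict_def simp del: One_nat_def atLeastAtMost_iff)
    ultimately show ?thesis
      using young_split_comp[OF y y' assms(2)]
      by (simp add: wreath_young_split_eq gh wreath_simps del: One_nat_def)
  qed
  show "wreath_young_split n k \<in> hom (wreath F n\<lparr>carrier := wreath_young_subgroup F n k\<rparr>) (wreath F (n - k) \<times>\<times> wreath F k)"
    using wreath_young_split_in[OF _ assms(2), of _ F] mult
    by (auto simp: hom_def DirProd_def mem_Times_iff split: prod.splits)
qed

section \<open>The induced representation of the wreath product\<close>

text \<open>
  \<open>merge v\<close> is the map \<open>E \<otimes> E' \<rightarrow> (D; E) \<otimes> (D; E')\<close> that attaches the first \<open>n - k\<close> entries of \<open>v\<close> to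
  \<open>E\<close> and the remaining ones to \<open>E'\<close>.
\<close>

locale two_blocks =
  first: wreath_tensor F "n - k" D X\<^sub>1 E \<mu>\<^sub>1 + second: wreath_tensor F k D X\<^sub>2 E' \<mu>\<^sub>2
  for F :: "('f, 'x) monoid_scheme" and n k :: nat and D :: "('f, 'd::complex_vector) repn"
    and X\<^sub>1 :: "((nat \<Rightarrow> 'f) \<times> (nat \<Rightarrow> nat), 'v::complex_vector) repn"
    and E :: "(nat \<Rightarrow> nat, 'e::complex_vector) repn" and \<mu>\<^sub>1
    and X\<^sub>2 :: "((nat \<Rightarrow> 'f) \<times> (nat \<Rightarrow> nat), 'v1::complex_vector) repn"
    and E' :: "(nat \<Rightarrow> nat, 'e1::complex_vector) repn" and \<mu>\<^sub>2 +
  assumes k: "k \<le> n"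
begin

abbreviation "tuples \<equiv> {1..n} \<rightarrow>\<^sub>E rspace D"
abbreviation "pX \<equiv> pure_tensor (rspace X\<^sub>1) (rspace X\<^sub>2)"
abbreviation "pE \<equiv> pure_tensor (rspace E) (rspace E')"

definition merge :: "(nat \<Rightarrow> 'd) \<Rightarrow> (('e \<Rightarrow> 'e1 \<Rightarrow> complex) \<Rightarrow> complex) \<Rightarrow> (('v \<Rightarrow> 'v1 \<Rightarrow> complex) \<Rightarrow> complex)" where
  "merge v t = (\<lambda>B. if B \<in> bilinear_forms (rspace X\<^sub>1) (rspace X\<^sub>2)
     then t (\<lambda>e e'. B (\<mu>\<^sub>1 (first_block n k v) e) (\<mu>\<^sub>2 (second_block n k v) e')) else 0)"

abbreviation "R\<^sub>U \<equiv> pullback_rep (young_split n k) (E \<boxtimes> E')"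
abbreviation "R\<^sub>A \<equiv> pullback_rep (wreath_young_split n k) (X\<^sub>1 \<boxtimes> X\<^sub>2)"
abbreviation "H \<equiv> wreath_young_subgroup F n k"
abbreviation "U \<equiv> induced_rep (sym_group n) (young_subgroup n k) R\<^sub>U"
abbreviation "A \<equiv> induced_rep (wreath F n) H R\<^sub>A"

lemma merge_linear: "linear_on V (merge v)"
  by (rule linear_onI) (auto simp: merge_def fun_eq_iff)

lemma merge_pure:
  assumes v: "v \<in> tuples"
  shows "merge v (pE e e') = pX (\<mu>\<^sub>1 (first_block n k v) e) (\<mu>\<^sub>2 (second_block n k v) e')"
proof
  fix B
  let ?m1 = "\<mu>\<^sub>1 (first_block n k v)" and ?m2 = "\<mu>\<^sub>2 (second_block n k v)"
  note b = blocks_in[OF v k]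
  have "(\<lambda>e e'. B (?m1 e) (?m2 e')) \<in> bilinear_forms (rspace E) (rspace E')"
    if B: "B \<in> bilinear_forms (rspace X\<^sub>1) (rspace X\<^sub>2)"
  proof (rule bilinear_formsI)
    show "linear_on (rspace E) (\<lambda>e. B (?m1 e) (?m2 e'))" if "e' \<in> rspace E'" for e'
      using that first.mu_in[OF b(1)] second.mu_in[OF b(2)]
      by (intro linear_on_compose[OF first.linear[OF b(1)] _ bilinear_formsD(1)[OF B]]) auto
    show "linear_on (rspace E') (\<lambda>e'. B (?m1 e) (?m2 e'))" if "e \<in> rspace E" for e
      using that first.mu_in[OF b(1)] second.mu_in[OF b(2)]
      by (intro linear_on_compose[OF second.linear[OF b(2)] _ bilinear_formsD(2)[OF B]]) auto
  qed
  then show "merge v (pE e e') B = pX (?m1 e) (?m2 e') B"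
    by (auto simp: merge_def pure_tensor_def)
qed

lemma merge_in:
  assumes v: "v \<in> tuples" and t: "t \<in> rspace (E \<boxtimes> E')"
  shows "merge v t \<in> rspace (X\<^sub>1 \<boxtimes> X\<^sub>2)"
proof -
  note b = blocks_in[OF v k]
  have "merge v ` cvec.span {pE x y | x y. x \<in> rspace E \<and> y \<in> rspace E'} \<subseteq> rspace (X\<^sub>1 \<boxtimes> X\<^sub>2)"
  proof (rule linear_on_span_image[OF merge_linear])
    fix s assume "s \<in> {pE x y | x y. x \<in> rspace E \<and> y \<in> rspace E'}"
    then show "merge v s \<in> rspace (X\<^sub>1 \<boxtimes> X\<^sub>2)"
      using pure_tensor_in[OF first.mu_in[OF b(1)] second.mu_in[OF b(2)]] by (auto simp: merge_pure[OF v])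
  qed (simp add: outer_tensor_space)
  then show ?thesis using t by (auto simp: outer_tensor_space)
qed

text \<open>Slot i belongs to exactly one block, so only one tensor factor varies with x. The case
  of pure t extends to all t because \<open>merge\<close> is linear in t.\<close>

lemma merge_multilinear:
  assumes v: "v \<in> tuples" and i: "i \<in> {1..n}" and t: "t \<in> rspace (E \<boxtimes> E')"
  shows "linear_on (rspace D) (\<lambda>x. merge (v(i := x)) t)"
proof -
  note b = blocks_in[OF v k]
  have upd: "v(i := x) \<in> tuples" if "x \<in> rspace D" for x
    using that v i by (auto simp: PiE_iff extensional_def simp del: One_nat_def atLeastAtMost_iff)
  have pure: "linear_on (rspace D) (\<lambda>x. merge (v(i := x)) (pE e e'))"
    if e: "e \<in> rspace E" "e' \<in> rspace E'" for e e'
  proof -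
    have "linear_on (rspace D) (\<lambda>x. pX (\<mu>\<^sub>1 (first_block n k (v(i := x))) e) (\<mu>\<^sub>2 (second_block n k (v(i := x))) e'))"
    proof (cases "i \<in> {1..n - k}")
      case True
      have 1: "first_block n k (v(i := x)) = (first_block n k v)(i := x)" for x
        using True by (auto simp: first_block_def fun_eq_iff)
      have 2: "second_block n k (v(i := x)) = second_block n k v" for x
        using True by (auto simp: second_block_def fun_eq_iff)
      have "(\<lambda>x. \<mu>\<^sub>1 ((first_block n k v)(i := x)) e) ` rspace D \<subseteq> rspace X\<^sub>1"
        using first.mu_in[OF blocks_in(1)[OF upd k] e(1)] unfolding 1 by blast
      then show ?thesis
        unfolding 1 2 using second.mu_in[OF b(2) e(2)]
        by (intro linear_on_compose[OF first.multilinear[OF b(1) e(1) True] _ pure_tensor_linear_left])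
    next
      case False
      \<comment> \<open>No truncation occurs, since i exceeds n - k in this case.\<close>
      let ?j = "i - (n - k)"
      have j: "?j \<in> {1..k}" using False i k by auto
      have 1: "first_block n k (v(i := x)) = first_block n k v" for x
        using False by (auto simp: first_block_def fun_eq_iff)
      have 2: "second_block n k (v(i := x)) = (second_block n k v)(?j := x)" for x
        using False i k by (auto simp: second_block_def fun_eq_iff)
      have "(\<lambda>x. \<mu>\<^sub>2 ((second_block n k v)(?j := x)) e') ` rspace D \<subseteq> rspace X\<^sub>2"
        using second.mu_in[OF blocks_in(2)[OF upd k] e(2)] unfolding 2 by blast
      then show ?thesis
        unfolding 1 2 using first.mu_in[OF b(1) e(1)]
        by (intro linear_on_compose[OF second.multilinear[OF b(2) e(2) j] _ pure_tensor_linear_right])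
    qed
    then show ?thesis
      using merge_pure[OF upd] by (simp add: linear_on_def is_repD(2)[OF first.rep_D] cvec.subspace_add cvec.subspace_scale)
  qed
  have V: "cvec.subspace (rspace D)" using is_repD(2)[OF first.rep_D] .
  show ?thesis
  proof (rule linear_onI)
    show "merge (v(i := x + y)) t = merge (v(i := x)) t + merge (v(i := y)) t"
      if "x \<in> rspace D" "y \<in> rspace D" for x y
    proof (rule outer_tensor_eqI[OF merge_linear _ _ t])
      show "linear_on (rspace (E \<boxtimes> E')) (\<lambda>t. merge (v(i := x)) t + merge (v(i := y)) t)"
        by (rule linear_onI)
          (simp_all add: linear_on_add[OF merge_linear[of UNIV]] linear_on_scale[OF merge_linear[of UNIV]]
            cvec.scale_right_distrib)
    qed (use linear_on_add[OF pure] that in blast)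
    show "merge (v(i := c *\<^sub>C x)) t = c *\<^sub>C merge (v(i := x)) t" if "x \<in> rspace D" for c x
    proof (rule outer_tensor_eqI[OF merge_linear _ _ t])
      show "linear_on (rspace (E \<boxtimes> E')) (\<lambda>t. c *\<^sub>C merge (v(i := x)) t)"
        by (rule linear_onI)
          (simp_all add: linear_on_add[OF merge_linear[of UNIV]] linear_on_scale[OF merge_linear[of UNIV]]
            cvec.scale_right_distrib mult.commute)
    qed (use linear_on_scale[OF pure] that in blast)
  qed
qed

text \<open>Left inverses \<kappa> and \<kappa>' of the maps attaching the two blocks of v turn a
  form \<beta> on \<open>E\<close> and \<open>E'\<close> into a form on \<open>X\<^sub>1\<close> and
  \<open>X\<^sub>2\<close> at which \<open>merge v t\<close> takes the value
  \<open>t \<beta>\<close>. Thus t can be recovered from \<open>merge v t\<close>.\<close>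

lemma merge_nondegenerate:
  assumes v: "v \<in> tuples" "\<And>i. i \<in> {1..n} \<Longrightarrow> v i \<noteq> 0" and t: "t \<in> rspace (E \<boxtimes> E')" and z: "merge v t = 0"
  shows "t = 0"
proof
  fix \<beta>
  let ?v1 = "first_block n k v" and ?v2 = "second_block n k v"
  note b = blocks_in[OF v(1) k]
  have nz: "?v1 i \<noteq> 0" if "i \<in> {1..n - k}" for i using that v(2)[of i] le_trans[of i "n - k" n] by (simp add: first_block_def)
  have nz': "?v2 i \<noteq> 0" if "i \<in> {1..k}" for i
  proof -
    have "n - k + i \<in> {1..n}" using that k by auto
    then show ?thesis using that v(2) by (simp add: second_block_def del: One_nat_def atLeastAtMost_iff)
  qed
  obtain \<kappa> where \<kappa>: "linear_on (rspace X\<^sub>1) \<kappa>" "\<And>w. w \<in> rspace X\<^sub>1 \<Longrightarrow> \<kappa> w \<in> rspace E"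
    "\<And>e. e \<in> rspace E \<Longrightarrow> \<kappa> (\<mu>\<^sub>1 ?v1 e) = e"
    using first.contraction[OF b(1) nz] by metis
  obtain \<kappa>' where \<kappa>': "linear_on (rspace X\<^sub>2) \<kappa>'" "\<And>w. w \<in> rspace X\<^sub>2 \<Longrightarrow> \<kappa>' w \<in> rspace E'"
    "\<And>e. e \<in> rspace E' \<Longrightarrow> \<kappa>' (\<mu>\<^sub>2 ?v2 e) = e"
    using second.contraction[OF b(2) nz'] by metis
  show "t \<beta> = 0 \<beta>"
  proof (cases "\<beta> \<in> bilinear_forms (rspace E) (rspace E')")
    case True
    let ?B = "\<lambda>s s'. \<beta> (\<kappa> s) (\<kappa>' s')"
    have B: "?B \<in> bilinear_forms (rspace X\<^sub>1) (rspace X\<^sub>2)"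
    proof (rule bilinear_formsI)
      show "linear_on (rspace X\<^sub>1) (\<lambda>s. ?B s s')" if "s' \<in> rspace X\<^sub>2" for s'
        using that \<kappa>(2) \<kappa>'(2) by (intro linear_on_compose[OF \<kappa>(1) _ bilinear_formsD(1)[OF True]]) auto
      show "linear_on (rspace X\<^sub>2) (?B s)" if "s \<in> rspace X\<^sub>1" for s
        using that \<kappa>(2) \<kappa>'(2) by (intro linear_on_compose[OF \<kappa>'(1) _ bilinear_formsD(2)[OF True]]) auto
    qed
    have "merge v t ?B = t \<beta>"
    proof (rule outer_tensor_eqI[OF _ _ _ t, where f = "\<lambda>t. merge v t ?B" and h = "\<lambda>t. t \<beta>"])
      show "linear_on (rspace (E \<boxtimes> E')) (\<lambda>t. merge v t ?B)"
        by (rule linear_onI)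
          (simp_all add: linear_on_add[OF merge_linear[of UNIV]] linear_on_scale[OF merge_linear[of UNIV]])
      show "linear_on (rspace (E \<boxtimes> E')) (\<lambda>t. t \<beta>)" by (rule linear_onI) simp_all
      show "merge v (pE e e') ?B = pE e e' \<beta>" if "e \<in> rspace E" "e' \<in> rspace E'" for e e'
        unfolding merge_pure[OF v(1)] using True B that by (simp add: pure_tensor_def \<kappa>(3) \<kappa>'(3))
    qed
    then show ?thesis using z by simp
  qed (use outer_tensor_outside[OF t] in simp)
qed

lemma merge_act:
  assumes h: "h \<in> H" and v: "v \<in> tuples" and t: "t \<in> rspace (E \<boxtimes> E')"
  shows "ract R\<^sub>A h (merge v t) = merge (tuple_act n D h v) (ract R\<^sub>U (snd h) t)"
proof -
  let ?h1 = "fst (wreath_young_split n k h)" and ?h2 = "snd (wreath_young_split n k h)"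
  note hc = wreath_young_split_in[OF h k]
  note b = blocks_in[OF v k]
  have hv: "tuple_act n D h v \<in> tuples"
    using tuple_act_in[OF first.rep_D wreath_youngD(1)[OF h] v] .
  note p = young_split_permutes[OF wreath_youngD(2)[OF h] k]
  have snds: "snd ?h1 = fst (young_split n k (snd h))" "snd ?h2 = snd (young_split n k (snd h))"
    by (simp_all add: wreath_young_split_eq)
  have "ract (X\<^sub>1 \<boxtimes> X\<^sub>2) (?h1, ?h2) (merge v t)
      = merge (tuple_act n D h v) (ract (E \<boxtimes> E') (snd ?h1, snd ?h2) t)"
  proof (rule outer_tensor_eqI[OF _ _ _ t])
    show "linear_on (rspace (E \<boxtimes> E')) (\<lambda>t. ract (X\<^sub>1 \<boxtimes> X\<^sub>2) (?h1, ?h2) (merge v t))"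
      by (rule linear_on_compose[OF merge_linear subset_UNIV outer_tensor_act_linear])
    show "linear_on (rspace (E \<boxtimes> E')) (\<lambda>t. merge (tuple_act n D h v) (ract (E \<boxtimes> E') (snd ?h1, snd ?h2) t))"
      by (rule linear_on_compose[OF outer_tensor_act_linear subset_UNIV merge_linear])
    fix e e' assume e: "e \<in> rspace E" "e' \<in> rspace E'"
    have "ract (X\<^sub>1 \<boxtimes> X\<^sub>2) (?h1, ?h2) (merge v (pE e e'))
        = pX (ract X\<^sub>1 ?h1 (\<mu>\<^sub>1 (first_block n k v) e)) (ract X\<^sub>2 ?h2 (\<mu>\<^sub>2 (second_block n k v) e'))"
      unfolding merge_pure[OF v] by (rule outer_tensor_pure[OF first.is_rep_X second.is_rep_X hc])
    also have "\<dots> = merge (tuple_act n D h v) (pE (ract E (snd ?h1) e) (ract E' (snd ?h2) e'))"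
      unfolding merge_pure[OF hv] blocks_tuple_act[OF h k]
      by (simp only: first.act[OF hc(1) b(1) e(1)] second.act[OF hc(2) b(2) e(2)])
    also have "pE (ract E (snd ?h1) e) (ract E' (snd ?h2) e') = ract (E \<boxtimes> E') (snd ?h1, snd ?h2) (pE e e')"
      using outer_tensor_pure[OF first.E second.E snd_wreath_in[OF hc(1)] snd_wreath_in[OF hc(2)]] by simp
    finally show "ract (X\<^sub>1 \<boxtimes> X\<^sub>2) (?h1, ?h2) (merge v (pE e e'))
      = merge (tuple_act n D h v) (ract (E \<boxtimes> E') (snd ?h1, snd ?h2) (pE e e'))" .
  qed
  then show ?thesis by (simp add: snds)
qed

lemma merge_span:
  "rspace (X\<^sub>1 \<boxtimes> X\<^sub>2) = cvec.span {merge v t | v t. v \<in> tuples \<and> t \<in> rspace (E \<boxtimes> E')}" (is "_ = cvec.span ?S")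
proof
  show "cvec.span ?S \<subseteq> rspace (X\<^sub>1 \<boxtimes> X\<^sub>2)"
    by (intro cvec.span_minimal) (auto simp: merge_in, simp add: outer_tensor_space)
  have "rspace (X\<^sub>1 \<boxtimes> X\<^sub>2) = cvec.span {pX x y | x y.
      x \<in> {\<mu>\<^sub>1 v e | v e. v \<in> first.tuples \<and> e \<in> rspace E} \<and> y \<in> {\<mu>\<^sub>2 v e | v e. v \<in> second.tuples \<and> e \<in> rspace E'}}"
    by (rule outer_tensor_span[OF first.space second.space])
  also have "\<dots> \<subseteq> cvec.span ?S"
  proof (rule cvec.span_mono, rule subsetI)
    fix z assume "z \<in> {pX x y | x y. x \<in> {\<mu>\<^sub>1 v e | v e. v \<in> first.tuples \<and> e \<in> rspace E} \<and>
      y \<in> {\<mu>\<^sub>2 v e | v e. v \<in> second.tuples \<and> e \<in> rspace E'}}"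
    then obtain v e w e' where z: "z = pX (\<mu>\<^sub>1 v e) (\<mu>\<^sub>2 w e')" "v \<in> first.tuples" "e \<in> rspace E"
      "w \<in> second.tuples" "e' \<in> rspace E'" by blast
    \<comment> \<open>Concatenation of \<open>v\<close> and \<open>w\<close>, the latter shifted by
      n - k: a tensor product of two pure vectors comes from a single tuple.\<close>
    let ?u = "\<lambda>i\<in>{1..n}. if i \<in> {1..n - k} then v i else w (i - (n - k))"
    have "i - (n - k) \<in> {1..k}" if "i \<in> {1..n}" "i \<notin> {1..n - k}" for i using that by auto
    then have u: "?u \<in> tuples"
      using z(2,4) by (auto simp: PiE_iff simp del: One_nat_def atLeastAtMost_iff)
    have "first_block n k ?u = v"
      using z(2) k by (auto simp: first_block_def fun_eq_iff PiE_iff extensional_def)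
    moreover have "second_block n k ?u = w"
      using z(4) k by (auto simp: second_block_def fun_eq_iff PiE_iff extensional_def)
    ultimately have "z = merge ?u (pE e e')" by (simp only: merge_pure[OF u] z(1))
    then show "z \<in> ?S" using u pure_tensor_in[OF z(3,5)] by blast
  qed
  finally show "rspace (X\<^sub>1 \<boxtimes> X\<^sub>2) \<subseteq> cvec.span ?S" .
qed

sublocale U: induction_data "sym_group n" "young_subgroup n k" R\<^sub>U
  by (intro induction_data.intro induction_data_axioms.intro sym_group_is_group subgroup_young
      is_rep_pullback[OF group_hom_young_split[OF k]] is_rep_outer_tensor first.E second.E)

sublocale A: induction_data "wreath F n" H R\<^sub>A
  by (intro induction_data.intro induction_data_axioms.intro group_wreath first.F subgroup_wreath_young
      is_rep_pullback[OF group_hom_wreath_young_split[OF first.F(1) k]] is_rep_outer_tensor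
      first.is_rep_X second.is_rep_X)

sublocale proj: group_hom "wreath F n" "sym_group n" snd
  by (rule snd_wreath_hom[OF first.F(1)])

text \<open>The projection formula, pointwise: v tensor u becomes the function whose value at x is
  the inverse of x applied to v, tensored with u at the permutation of x. Moving v by the inverse of
  x supplies the covariance that the induced representation requires in the base group and in the
  factor v.\<close>

definition \<mu> :: "(nat \<Rightarrow> 'd) \<Rightarrow> ((nat \<Rightarrow> nat) \<Rightarrow> ('e \<Rightarrow> 'e1 \<Rightarrow> complex) \<Rightarrow> complex) \<Rightarrow>
    (nat \<Rightarrow> 'f) \<times> (nat \<Rightarrow> nat) \<Rightarrow> ('v \<Rightarrow> 'v1 \<Rightarrow> complex) \<Rightarrow> complex" where
  "\<mu> v u = (\<lambda>x. if x \<in> carrier (wreath F n)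
     then merge (tuple_act n D (inv\<^bsub>wreath F n\<^esub> x) v) (u (snd x)) else 0)"

lemma U_value: "u \<in> rspace U \<Longrightarrow> x \<in> carrier (wreath F n) \<Longrightarrow> u (snd x) \<in> rspace (E \<boxtimes> E')"
  using snd_wreath_in by (auto simp: induced_rep_simps)

lemma mu_in_A:
  assumes v: "v \<in> tuples" and u: "u \<in> rspace U"
  shows "\<mu> v u \<in> rspace A"
proof -
  have "\<mu> v u (x \<otimes>\<^bsub>wreath F n\<^esub> h) = ract R\<^sub>A (inv\<^bsub>wreath F n\<^esub> h) (\<mu> v u x)"
    if x: "x \<in> carrier (wreath F n)" and h: "h \<in> H" for x h
  proof -
    note hc = wreath_youngD[OF h]
    have ih: "inv\<^bsub>wreath F n\<^esub> h \<in> H" using subgroup.m_inv_closed[OF A.H h] .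
    have "\<mu> v u (x \<otimes>\<^bsub>wreath F n\<^esub> h) = merge (tuple_act n D (inv\<^bsub>wreath F n\<^esub> h \<otimes>\<^bsub>wreath F n\<^esub> inv\<^bsub>wreath F n\<^esub> x) v)
        (u (snd x \<otimes>\<^bsub>sym_group n\<^esub> snd h))"
      using x hc(1) by (simp add: \<mu>_def A.inv_mult_group)
    also have "u (snd x \<otimes>\<^bsub>sym_group n\<^esub> snd h) = ract R\<^sub>U (inv\<^bsub>sym_group n\<^esub> (snd h)) (u (snd x))"
      using u snd_wreath_in[OF x] hc(2) unfolding induced_rep_simps by blast
    also have "inv\<^bsub>sym_group n\<^esub> (snd h) = snd (inv\<^bsub>wreath F n\<^esub> h)"
      using proj.hom_inv[OF hc(1)] by simp
    also have "tuple_act n D (inv\<^bsub>wreath F n\<^esub> h \<otimes>\<^bsub>wreath F n\<^esub> inv\<^bsub>wreath F n\<^esub> x) v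
        = tuple_act n D (inv\<^bsub>wreath F n\<^esub> h) (tuple_act n D (inv\<^bsub>wreath F n\<^esub> x) v)"
      using x hc(1) v by (intro tuple_act_mult[OF first.rep_D]) auto
    also have "merge \<dots> (ract R\<^sub>U (snd (inv\<^bsub>wreath F n\<^esub> h)) (u (snd x)))
        = ract R\<^sub>A (inv\<^bsub>wreath F n\<^esub> h) (merge (tuple_act n D (inv\<^bsub>wreath F n\<^esub> x) v) (u (snd x)))"
      using x v by (intro merge_act[symmetric] ih tuple_act_in[OF first.rep_D] U_value[OF u]) auto
    finally show ?thesis using x by (simp add: \<mu>_def)
  qed
  moreover have "\<mu> v u x \<in> rspace R\<^sub>A" if x: "x \<in> carrier (wreath F n)" for x
    using x v tuple_act_in[OF first.rep_D A.inv_closed[OF x] v] U_value[OF u x] by (simp add: \<mu>_def merge_in)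
  ultimately show ?thesis unfolding induced_rep_simps by (simp add: \<mu>_def)
qed

text \<open>On generators the projection formula is inverted by sending g tensor (v tensor t) to g v
  tensor (g tensor t). The supports agree because the inverse of x times g lies in \<open>H\<close>
  exactly when its permutation part lies in the Young subgroup.\<close>

lemma coset_fun_merge:
  assumes g: "g \<in> carrier (wreath F n)" and v: "v \<in> tuples" and t: "t \<in> rspace (E \<boxtimes> E')"
  shows "coset_fun (wreath F n) H R\<^sub>A g (merge v t)
    = \<mu> (tuple_act n D g v) (coset_fun (sym_group n) (young_subgroup n k) R\<^sub>U (snd g) t)"
proof
  fix x
  show "coset_fun (wreath F n) H R\<^sub>A g (merge v t) x
    = \<mu> (tuple_act n D g v) (coset_fun (sym_group n) (young_subgroup n k) R\<^sub>U (snd g) t) x"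
  proof (cases "x \<in> carrier (wreath F n)")
    case True
    let ?h = "inv\<^bsub>wreath F n\<^esub> x \<otimes>\<^bsub>wreath F n\<^esub> g"
    have h: "?h \<in> carrier (wreath F n)" using True g by simp
    have sh: "snd ?h = inv\<^bsub>sym_group n\<^esub> (snd x) \<otimes>\<^bsub>sym_group n\<^esub> snd g"
      using True g proj.hom_mult[of "inv\<^bsub>wreath F n\<^esub> x" g] proj.hom_inv[OF True] by simp
    have tm: "tuple_act n D ?h v = tuple_act n D (inv\<^bsub>wreath F n\<^esub> x) (tuple_act n D g v)"
      using True g v by (intro tuple_act_mult[OF first.rep_D]) auto
    have m0: "merge w 0 = 0" for w
      using linear_on_0[OF merge_linear[of UNIV]] by simp
    show ?thesis
    proof (cases "?h \<in> H")
      case in_H: True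
      then have "snd ?h \<in> young_subgroup n k" by (simp only: wreath_young_iff)
      then have "\<mu> (tuple_act n D g v) (coset_fun (sym_group n) (young_subgroup n k) R\<^sub>U (snd g) t) x
          = merge (tuple_act n D ?h v) (ract R\<^sub>U (snd ?h) t)"
        unfolding \<mu>_def coset_fun_def using True snd_wreath_in[OF True]
        by (simp only: if_True sh tm simp_thms)
      also have "\<dots> = ract R\<^sub>A ?h (merge v t)" by (rule merge_act[OF in_H v t, symmetric])
      finally show ?thesis using True in_H by (simp only: coset_fun_def if_True simp_thms)
    next
      case not_H: False
      then have "snd ?h \<notin> young_subgroup n k" using h by (simp only: wreath_young_iff simp_thms)
      then show ?thesis
        unfolding \<mu>_def coset_fun_def using True not_H by (simp only: sh m0 if_True if_False simp_thms)
    qed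
  qed (simp add: \<mu>_def coset_fun_def)
qed

lemma wreath_tensor_induced:
  assumes U: "is_rep (sym_group n) U"
  shows "wreath_tensor F n D A U \<mu>"
proof (rule wreath_tensor.intro, goal_cases)
  \<comment> \<open>Every function in \<open>A\<close> is an average of coset functions, and
    \<open>coset_fun_merge\<close> turns these into combinations of values of \<mu>.\<close>
  case 5
  let ?S = "{\<mu> v u | v u. v \<in> tuples \<and> u \<in> rspace U}"
  have cos_merge: "coset_fun (wreath F n) H R\<^sub>A g (merge v t) \<in> cvec.span ?S"
    if "g \<in> carrier (wreath F n)" "v \<in> tuples" "t \<in> rspace (E \<boxtimes> E')" for g v t
  proof -
    have "coset_fun (sym_group n) (young_subgroup n k) R\<^sub>U (snd g) t \<in> rspace U"
      using that snd_wreath_in[OF that(1)] by (intro U.coset_fun_in) auto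
    then show ?thesis
      using that tuple_act_in[OF first.rep_D that(1,2)] coset_fun_merge[OF that]
      by (intro cvec.span_base) blast
  qed
  have cos: "coset_fun (wreath F n) H R\<^sub>A g ` cvec.span {merge v t | v t. v \<in> tuples \<and> t \<in> rspace (E \<boxtimes> E')} \<subseteq> cvec.span ?S"
    if g: "g \<in> carrier (wreath F n)" for g
  proof (rule linear_on_span_image)
    show "linear_on (cvec.span {merge v t | v t. v \<in> tuples \<and> t \<in> rspace (E \<boxtimes> E')}) (coset_fun (wreath F n) H R\<^sub>A g)"
      using A.coset_fun_linear by (simp add: merge_span)
  qed (use cos_merge[OF g] in blast, simp)
  have "\<phi> \<in> cvec.span ?S" if \<phi>: "\<phi> \<in> rspace A" for \<phi>
  proof -
    have "coset_fun (wreath F n) H R\<^sub>A g (\<phi> g) \<in> cvec.span ?S" if g: "g \<in> carrier (wreath F n)" for g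
    proof -
      have "\<phi> g \<in> rspace (X\<^sub>1 \<boxtimes> X\<^sub>2)" using \<phi> g by (simp add: induced_rep_simps)
      then show ?thesis using cos[OF g] by (auto simp: merge_span)
    qed
    then have "(\<Sum>g\<in>carrier (wreath F n). (1 / of_nat (card H)) *\<^sub>C coset_fun (wreath F n) H R\<^sub>A g (\<phi> g)) \<in> cvec.span ?S"
      by (intro cvec.span_sum cvec.span_scale)
    then show ?thesis
      using A.induced_expansion[OF finite_wreath[OF first.F(2)] \<phi>] by simp
  qed
  moreover have "cvec.span ?S \<subseteq> rspace A"
    using mu_in_A by (intro cvec.span_minimal A.subspace_induced) blast
  ultimately show ?case by blast
next
  case (6 g)
  show ?case by (rule induced_rep_act_linear)
next
  case (7 g v u)
  show ?case
  proof
    fix x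
    show "ract A g (\<mu> v u) x = \<mu> (tuple_act n D g v) (ract U (snd g) u) x"
    proof (cases "x \<in> carrier (wreath F n)")
      case True
      have "inv\<^bsub>wreath F n\<^esub> (inv\<^bsub>wreath F n\<^esub> g \<otimes>\<^bsub>wreath F n\<^esub> x) = inv\<^bsub>wreath F n\<^esub> x \<otimes>\<^bsub>wreath F n\<^esub> g"
        using True 7(1) by (simp add: A.inv_mult_group)
      moreover have "tuple_act n D (inv\<^bsub>wreath F n\<^esub> x \<otimes>\<^bsub>wreath F n\<^esub> g) v
          = tuple_act n D (inv\<^bsub>wreath F n\<^esub> x) (tuple_act n D g v)"
        using True 7(1,2) by (intro tuple_act_mult[OF first.rep_D]) auto
      moreover have "snd (inv\<^bsub>wreath F n\<^esub> g \<otimes>\<^bsub>wreath F n\<^esub> x) = inv\<^bsub>sym_group n\<^esub> (snd g) \<otimes>\<^bsub>sym_group n\<^esub> snd x"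
        using True 7(1) proj.hom_mult[of "inv\<^bsub>wreath F n\<^esub> g" x] proj.hom_inv[OF 7(1)] by simp
      moreover have "inv\<^bsub>wreath F n\<^esub> g \<otimes>\<^bsub>wreath F n\<^esub> x \<in> carrier (wreath F n)" using True 7(1) by simp
      ultimately show ?thesis
        unfolding \<mu>_def induced_rep_simps using True snd_wreath_in[OF True] by (simp only: if_True)
    qed (simp add: \<mu>_def induced_rep_simps)
  qed
next
  case (8 v u i)
  \<comment> \<open>At a fixed x, acting by the inverse of x moves slot i to another slot and
    applies a linear map of D to its entry; \<open>merge\<close> is linear in that slot.\<close>
  have "linear_on (rspace D) (\<lambda>y. merge (tuple_act n D (inv\<^bsub>wreath F n\<^esub> x) (v(i := y))) (u (snd x)))"
    if x: "x \<in> carrier (wreath F n)" for x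
  proof -
    let ?g = "inv\<^bsub>wreath F n\<^esub> x"
    have g: "?g \<in> carrier (wreath F n)" using x by simp
    have p: "snd ?g permutes {1..n}" using snd_wreath_in[OF g] by (simp add: sym_group_carrier)
    have gi: "snd ?g i \<in> {1..n}" using permutes_in_image[OF p] 8(3) by blast
    have f: "fst ?g (snd ?g i) \<in> carrier F" using g gi by (auto simp: wreath_simps simp del: One_nat_def atLeastAtMost_iff)
    show ?thesis
      unfolding tuple_act_upd[OF g 8(3)]
      using is_repD(3)[OF first.rep_D f]
      by (intro linear_on_compose[OF is_repD(4)[OF first.rep_D f] _
            merge_multilinear[OF tuple_act_in[OF first.rep_D g 8(1)] gi U_value[OF 8(2) x]]]) blast
  qed
  note lin = this
  show ?case
  proof (rule linear_onI)
    show "\<mu> (v(i := x + y)) u = \<mu> (v(i := x)) u + \<mu> (v(i := y)) u" if "x \<in> rspace D" "y \<in> rspace D" for x y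
      by (rule ext) (simp add: \<mu>_def linear_on_add[OF lin that])
    show "\<mu> (v(i := c *\<^sub>C x)) u = c *\<^sub>C \<mu> (v(i := x)) u" if "x \<in> rspace D" for c x
      by (rule ext) (simp add: \<mu>_def linear_on_scale[OF lin that])
  qed
next
  case (9 v)
  show ?case
    by (rule linear_onI)
      (simp_all add: \<mu>_def fun_eq_iff linear_on_add[OF merge_linear[of UNIV]] linear_on_scale[OF merge_linear[of UNIV]])
next
  case (10 v u)
  show ?case
  proof
    fix \<sigma>
    show "u \<sigma> = 0 \<sigma>"
    proof (cases "\<sigma> \<in> carrier (sym_group n)")
      case True
      \<comment> \<open>A point over \<sigma>: there the value of \<open>\<mu> v u\<close> is
        \<open>merge\<close> of a tuple with non-zero entries and \<open>u \<sigma>\<close>, so its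
        vanishing forces \<open>u \<sigma> = 0\<close>.\<close>
      let ?x = "perm_embed F n \<sigma>"
      have x: "?x \<in> carrier (wreath F n)" using perm_embed_in[OF first.F(1) True] .
      let ?w = "tuple_act n D (inv\<^bsub>wreath F n\<^esub> ?x) v"
      have "merge ?w (u \<sigma>) = 0" using fun_cong[OF 10(4), of ?x] x by (simp add: \<mu>_def)
      moreover have "?w \<in> tuples" "\<And>i. i \<in> {1..n} \<Longrightarrow> ?w i \<noteq> 0"
        using tuple_act_in[OF first.rep_D A.inv_closed[OF x] 10(1)]
          tuple_act_nonzero[OF first.rep_D first.F(1) A.inv_closed[OF x] 10(1,2)] by blast+
      moreover have "u \<sigma> \<in> rspace (E \<boxtimes> E')" using U_value[OF 10(3) x] by simp
      ultimately show ?thesis using merge_nondegenerate by simp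
    qed (use 10(3) in \<open>simp add: induced_rep_simps\<close>)
  qed
qed (use first.F first.D U in auto)

end

text \<open>The decomposition of \<open>U\<close> is arbitrary, including the ambient type of its
  constituents, because two different ones are fed in later. That \<open>A\<close> is a
  representation is needed to find constituents inside \<open>A\<close>.\<close>

lemma wreath_induced_decomposes:
  fixes F :: "('f, 'x) monoid_scheme"
    and D :: "('f, 'd::complex_vector) repn"
    and E :: "(nat \<Rightarrow> nat, 'e::complex_vector) repn"
    and E' :: "(nat \<Rightarrow> nat, 'e1::complex_vector) repn"
    and Es :: "nat \<Rightarrow> (nat \<Rightarrow> nat, 'u::complex_vector) repn"
  assumes F: "group F" "finite (carrier F)" "irreducible_rep F D" and k: "k \<le> n"
    and E: "is_rep (sym_group (n - k)) E" and E': "is_rep (sym_group k) E'"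
    and U: "U = induced_rep (sym_group n) (young_subgroup n k)
                  (pullback_rep (young_split n k) (E \<boxtimes> E'))"
    and A: "A = induced_rep (wreath F n) (wreath_young_subgroup F n k)
                  (pullback_rep (wreath_young_split n k)
                     (wreath_rep (n - k) D E \<boxtimes> wreath_rep k D E'))"
    and dec: "decomposes (sym_group n) U r m Es"
  shows "decomposes (wreath F n) A r m (\<lambda>i. wreath_rep n D (Es i))" "is_rep (wreath F n) A"
proof -
  interpret two_blocks F n k D "wreath_rep (n - k) D E" E
    "\<lambda>v e. pure_tensor (rspace (tensor_power (n - k) D)) (rspace E) (pure_power (n - k) (rspace D) v) e"
    "wreath_rep k D E'" E'
    "\<lambda>v e. pure_tensor (rspace (tensor_power k D)) (rspace E') (pure_power k (rspace D) v) e"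
    by (intro two_blocks.intro two_blocks_axioms.intro wreath_tensor_wreath_rep F E E' k)
  let ?I = "SIGMA i:{1..r}. {1..m i}"
  let ?S = "direct_sum_rep ?I (\<lambda>(i, j). Es i)" and ?X = "direct_sum_rep ?I (\<lambda>(i, j). wreath_rep n D (Es i))"
  have irr: "\<And>i. i \<in> {1..r} \<Longrightarrow> irreducible_rep (sym_group n) (Es i)" and m: "\<And>i. i \<in> {1..r} \<Longrightarrow> 1 \<le> m i"
    and non: "\<And>i j. i \<in> {1..r} \<Longrightarrow> j \<in> {1..r} \<Longrightarrow> i \<noteq> j \<Longrightarrow> \<not> iso_rep (sym_group n) (Es i) (Es j)"
    and iso: "iso_rep (sym_group n) U ?S"
    using dec unfolding decomposes_def by blast+
  have tensor: "wreath_tensor F n D (wreath_rep n D (Es i)) (Es i)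
      (\<lambda>v e. pure_tensor (rspace (tensor_power n D)) (rspace (Es i)) (pure_power n (rspace D) v) e)"
    if "i \<in> {1..r}" for i
    using wreath_tensor_wreath_rep[OF F irreducible_repD(1)[OF irr[OF that]]] .
  have "is_rep (sym_group n) ?S"
    using irreducible_repD(1)[OF irr] by (intro is_rep_direct_sum sym_group_is_group) auto
  \<comment> \<open>The finite dimension of \<open>U\<close> is taken from the given
    decomposition.\<close>
  then have repU: "is_rep (sym_group n) U"
    using U.induced_act_in unfolding U
    by (intro is_rep_iso[OF iso[unfolded U] _ sym_group_is_group U.subspace_induced _ induced_rep_act_linear]) auto
  have tA: "wreath_tensor F n D A U \<mu>"
    unfolding U A by (rule wreath_tensor_induced[OF repU[unfolded U]])
  then show "is_rep (wreath F n) A" by (rule wreath_tensor.is_rep_X)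
  have "wreath_tensor F n D ?X ?S (\<lambda>v u p. if p \<in> ?I
      then (case p of (i, j) \<Rightarrow> \<lambda>v e. pure_tensor (rspace (tensor_power n D)) (rspace (Es i)) (pure_power n (rspace D) v) e) v (u p)
      else 0)"
    by (rule wreath_tensor_direct_sum[OF F]) (auto intro: tensor)
  \<comment> \<open>Replacing the sum of the \<open>Es i\<close> by \<open>U\<close> puts
    \<open>?X\<close> over the same representation of S_n as \<open>A\<close>.\<close>
  then obtain \<nu> where "wreath_tensor F n D ?X U \<nu>"
    using wreath_tensor_transport[OF _ repU iso] by blast
  then have "iso_rep (wreath F n) A ?X" by (rule wreath_tensor_unique[OF tA])
  moreover have "irreducible_rep (wreath F n) (wreath_rep n D (Es i))" if "i \<in> {1..r}" for i
    using wreath_tensor.irreducible_X[OF tensor[OF that] irr[OF that]] .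
  moreover have "\<not> iso_rep (wreath F n) (wreath_rep n D (Es i)) (wreath_rep n D (Es j))"
    if "i \<in> {1..r}" "j \<in> {1..r}" "i \<noteq> j" for i j
    using wreath_tensor_iso_imp[OF tensor[OF that(1)] tensor[OF that(2)]] non[OF that] by blast
  ultimately show "decomposes (wreath F n) A r m (\<lambda>i. wreath_rep n D (Es i))"
    unfolding decomposes_def using m by blast
qed

theorem lemma3p1:
  fixes F :: "('f, 'x) monoid_scheme"
    and D :: "('f, 'd::complex_vector) repn"
    and E :: "(nat \<Rightarrow> nat, 'e::complex_vector) repn"
    and E' :: "(nat \<Rightarrow> nat, 'e1::complex_vector) repn"
    and n k r :: nat
    and m :: "nat \<Rightarrow> nat"
    and Es :: "nat \<Rightarrow> (nat \<Rightarrow> nat, 'u::complex_vector) repn"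
  assumes "group F" and "finite (carrier F)"
    and "irreducible_rep F D"
    and "k \<le> n"
    and "irreducible_rep (sym_group (n - k)) E"
    and "irreducible_rep (sym_group k) E'"
    and U: "U = induced_rep (sym_group n) (young_subgroup n k)
                  (pullback_rep (young_split n k) (E \<boxtimes> E'))"
    and A: "A = induced_rep (wreath F n) (wreath_young_subgroup F n k)
                  (pullback_rep (wreath_young_split n k)
                     (wreath_rep (n - k) D E \<boxtimes> wreath_rep k D E'))"
    and "decomposes (sym_group n) U r m Es"
  shows "decomposes (wreath F n) A r m (\<lambda>i. wreath_rep n D (Es i))
         \<and> (multiplicity_free (sym_group n) U \<longrightarrow> multiplicity_free (wreath F n) A)"
proof (intro conjI impI)
  note main = wreath_induced_decomposes[OF assms(1-4) irreducible_repD(1)[OF assms(5)]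
      irreducible_repD(1)[OF assms(6)] U A]
  show "decomposes (wreath F n) A r m (\<lambda>i. wreath_rep n D (Es i))"
    by (rule main(1)[OF assms(9)])
  assume "multiplicity_free (sym_group n) U"
  \<comment> \<open>This decomposition need not be the given one: its constituents live in the
    ambient type of \<open>U\<close>, so the first part is applied to it afresh. The constituents
    found for \<open>A\<close> are then moved into the ambient type of \<open>A\<close>.\<close>
  then obtain r' and E'' :: "nat \<Rightarrow> (nat \<Rightarrow> nat, (nat \<Rightarrow> nat) \<Rightarrow> ('e \<Rightarrow> 'e1 \<Rightarrow> complex) \<Rightarrow> complex) repn"
    where dec: "decomposes (sym_group n) U r' (\<lambda>_. 1) E''"
    unfolding multiplicity_free_def by blast
  show "multiplicity_free (wreath F n) A"
    by (rule multiplicity_free_transfer[OF main(2)[OF dec] group_wreath[OF assms(1)] main(1)[OF dec]])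
qed

end
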